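(* Let $L$ be a non-degenerate even lattice of signature $(b^+,b^-)$ whose discriminant group $L'/L$ has prime order $p\ge 3$, put $r=b^+-b^-$, let $\rho=\rho_L$ be the Weil representation of $\mathrm{SL}_2(\mathbb{Z})$ on $\mathbb{C}[L'/L]$, and let $\epsilon=\chi_p(\alpha)\in\{\pm1\}$ be the sign determined by the quadratic form $q(x)=\alpha x^2/p$ on $L'/L\cong\mathbb{F}_p$. Let $k\in\mathbb{Z}$ with $k\equiv r/2\pmod 2$. Let $f=\sum_{n}a(n)q^n\in A_k^\epsilon(p,\chi_p)$ and define $$F=\sum_{\gamma\in L'/L}F_\gamma\,\mathfrak{e}_\gamma = i^{r/2}p^{k/2-1/2}\sum_{M\in\Gamma_0(p)\backslash \mathrm{SL}_2(\mathbb{Z})}\bigl(\rho(M)^{-1}\mathfrak{e}_0\bigr)\, f\mid_k W_p\mid_k M .$$ Then $F\in\mathcal{A}_{k,\rho}$, and the components $F_\gamma$ have the Fourier expansions $$F_0=2\sum_{\substack{n\in\mathbb{Z}\\ n\equiv 0\,(p)}}a(n)e(n\tau/p),\qquad F_\gamma=\sum_{\substack{n\in\mathbb{Z}\\ n\equiv p\,q(\gamma)\,(p)}}a(n)e(n\tau/p)\quad(\gamma\neq 0).$$ The map $f\mapsto F$ and the map $$F\mapsto \frac{i^{r/2}}{2}p^{(1-k)/2}F_0\mid_k W_p=\frac12\sum_{\gamma\in L'/L}F_\gamma(p\tau)$$ are mutually inverse isomorphisms between $A_k^\epsilon(p,\chi_p)$ and $\mathcal{A}_{k,\rho}$.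
   Context: $e(\tau)=e^{2\pi i\tau}$; in Fourier expansions $q=e^{2\pi i\tau}$ with $\tau\in\mathbb{H}$ (upper half-plane). $\chi_p(\cdot)=(\frac{\cdot}{p})$ is the Legendre symbol, with $\chi_p(n)=0$ for $p\mid n$. Lattice: $L$ is an even lattice with non-degenerate quadratic form $q(x)=\frac12(x,x)$ and dual lattice $L'$. On $L'/L\cong\mathbb{F}_p$ the induced form (mod $1$) is equivalent to $q(x)=\alpha x^2/p$ with $\alpha\in\mathbb{F}_p\setminus\{0\}$; $\epsilon=\chi_p(\alpha)$. For $\gamma\in L'/L$, $p\,q(\gamma)$ is a well-defined class mod $p$. The rank of $L$ and $r$ are automatically even. Weil representation: with $(\mathfrak{e}_\gamma)_{\gamma\in L'/L}$ the standard basis of $\mathbb{C}[L'/L]$, $T=\begin{pmatrix}1&1\\0&1\end{pmatrix}$, $S=\begin{pmatrix}0&-1\\1&0\end{pmatrix}$, $\rho=\rho_L$ is the unitary representation of $\mathrm{SL}_2(\mathbb{Z})$ on $\mathbb{C}[L'/L]$ given by $\rho(T)\mathfrak{e}_\gamma=e(q(\gamma))\mathfrak{e}_\gamma$, $\rho(S)\mathfrak{e}_\gamma=\frac{i^{-r/2}}{\sqrt{|L'/L|}}\sum_{\delta\in L'/L}e(-(\gamma,\delta))\mathfrak{e}_\delta$. $\mathcal{A}_{k,\rho}$ (nearly holomorphic modular forms of weight $k$ with representation $\rho$) is the space of holomorphic functions $F=\sum_\gamma F_\gamma\mathfrak{e}_\gamma:\mathbb{H}\to\mathbb{C}[L'/L]$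 with $F(M\tau)=(c\tau+d)^k\rho(M)F(\tau)$ for $M=\begin{pmatrix}a&b\\c&d\end{pmatrix}\in \mathrm{SL}_2(\mathbb{Z})$, whose components have expansions $F_\gamma=\sum_{n\in\mathbb{Z}+q(\gamma),\ n\gg-\infty}a(\gamma,n)e(n\tau)$. Slash operator: $(f\mid_k M)(\tau)=(\det M)^{k/2}(c\tau+d)^{-k}f(M\tau)$ for $M=\begin{pmatrix}a&b\\c&d\end{pmatrix}\in \mathrm{GL}_2^+(\mathbb{R})$. $W_p=\begin{pmatrix}0&-1\\ p&0\end{pmatrix}$. $A_k(p,\chi_p)$ is the space of holomorphic functions $f$ on $\mathbb{H}$ with $f\mid_k M=\chi_p(d)f$ for all $M=\begin{pmatrix}a&b\\c&d\end{pmatrix}\in\Gamma_0(p)$ that are meromorphic at the cusps. $A_k^\epsilon(p,\chi_p)$ is the subspace of those $f=\sum_n a(n)q^n$ with $a(n)=0$ whenever $\chi_p(n)=-\epsilon$. *)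

theory Defs
  imports
    "HOL-Complex_Analysis.Complex_Analysis"
    "HOL-Algebra.Elementary_Groups"
    "HOL-Algebra.Group_Action"
    "HOL-Number_Theory.Number_Theory"
    "HOL-Library.Real_Mod"
begin

section \<open>Even lattices and their discriminant groups\<close>

text \<open>
  A quadratic space is a finite-dimensional real vector space \<open>'v\<close> with a bilinear form
  \<open>B x y = (x, y)\<close>. The class \<open>euclidean_space\<close> only serves to provide
  finite dimension; its inner product is unrelated to \<open>B\<close>.
\<close>

definition quad :: "('v::euclidean_space \<Rightarrow> 'v \<Rightarrow> real) \<Rightarrow> 'v \<Rightarrow> real" where
  "quad B x = B x x / 2"

definition full_lattice :: "'v::euclidean_space set \<Rightarrow> bool" where
  "full_lattice L \<longleftrightarrow> (\<exists>b. independent b \<and> span b = UNIV \<and>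
     L = {(\<Sum>v\<in>b. of_int (c v) *\<^sub>R v) | c :: 'v \<Rightarrow> int. True})"

definition nondegenerate :: "('v::euclidean_space \<Rightarrow> 'v \<Rightarrow> real) \<Rightarrow> bool" where
  "nondegenerate B \<longleftrightarrow> (\<forall>x. (\<forall>y. B x y = 0) \<longrightarrow> x = 0)"

text \<open>Integrality of \<open>(x, y)\<close> on the lattice follows from the last condition by polarization.\<close>

definition even_lattice :: "('v::euclidean_space \<Rightarrow> 'v \<Rightarrow> real) \<Rightarrow> 'v set \<Rightarrow> bool" where
  "even_lattice B L \<longleftrightarrow> full_lattice L \<and> bilinear B \<and> (\<forall>x y. B x y = B y x) \<and>
     nondegenerate B \<and> (\<forall>x\<in>L. quad B x \<in> \<int>)"

definition has_signature :: "('v::euclidean_space \<Rightarrow> 'v \<Rightarrow> real) \<Rightarrow> nat \<Rightarrow> nat \<Rightarrow> bool" where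
  "has_signature B bp bn \<longleftrightarrow> (\<exists>P N. subspace P \<and> subspace N \<and>
     P \<inter> N = {0} \<and> {x + y | x y. x \<in> P \<and> y \<in> N} = UNIV \<and> (\<forall>x\<in>P. \<forall>y\<in>N. B x y = 0) \<and>
     (\<forall>x\<in>P. x \<noteq> 0 \<longrightarrow> B x x > 0) \<and> (\<forall>y\<in>N. y \<noteq> 0 \<longrightarrow> B y y < 0) \<and>
     dim P = bp \<and> dim N = bn)"

definition dual_lattice :: "('v::euclidean_space \<Rightarrow> 'v \<Rightarrow> real) \<Rightarrow> 'v set \<Rightarrow> 'v set" where
  "dual_lattice B L = {x. \<forall>y\<in>L. B x y \<in> \<int>}"

definition disc_group :: "('v::euclidean_space \<Rightarrow> 'v \<Rightarrow> real) \<Rightarrow> 'v set \<Rightarrow> 'v set monoid" where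
  "disc_group B L =
     \<lparr>carrier = dual_lattice B L, monoid.mult = (+), monoid.one = 0\<rparr> Mod L"

text \<open>
  For an even lattice, \<open>q(\<gamma>)\<close> and \<open>(\<gamma>, \<delta>)\<close> are well defined only modulo 1. The functions below
  evaluate them on chosen representatives and must only be used where the class
  modulo 1 matters.
\<close>

definition disc_quad :: "('v::euclidean_space \<Rightarrow> 'v \<Rightarrow> real) \<Rightarrow> 'v set \<Rightarrow> real" where
  "disc_quad B \<gamma> = quad B (SOME x. x \<in> \<gamma>)"

definition disc_pair :: "('v::euclidean_space \<Rightarrow> 'v \<Rightarrow> real) \<Rightarrow> 'v set \<Rightarrow> 'v set \<Rightarrow> real" where
  "disc_pair B \<gamma> \<delta> = B (SOME x. x \<in> \<gamma>) (SOME y. y \<in> \<delta>)"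

definition disc_form_equiv ::
  "('v::euclidean_space \<Rightarrow> 'v \<Rightarrow> real) \<Rightarrow> 'v set \<Rightarrow> nat \<Rightarrow> int \<Rightarrow> bool" where
  "disc_form_equiv B L p \<alpha> \<longleftrightarrow>
     (\<exists>\<phi> \<in> iso (integer_mod_group p) (disc_group B L).
        \<forall>x \<in> carrier (integer_mod_group p).
          [disc_quad B (\<phi> x) = of_int (\<alpha> * x^2) / real p] (rmod 1))"


section \<open>The modular group and the Weil representation\<close>

definition e :: "complex \<Rightarrow> complex" where
  "e \<tau> = exp (2 * of_real pi * \<i> * \<tau>)"

definition SL2Z :: "(int^2^2) monoid" where
  "SL2Z = \<lparr>carrier = {M. det M = 1}, monoid.mult = (**), monoid.one = mat 1\<rparr>"

definition Gamma0 :: "nat \<Rightarrow> (int^2^2) set" where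
  "Gamma0 p = {M \<in> carrier SL2Z. int p dvd M $ 2 $ 1}"

definition T_mat :: "int^2^2" where "T_mat = vector [vector [1, 1], vector [0, 1]]"
definition S_mat :: "int^2^2" where "S_mat = vector [vector [0, -1], vector [1, 0]]"

definition Gamma0_transversal :: "nat \<Rightarrow> (int^2^2) set \<Rightarrow> bool" where
  "Gamma0_transversal p R \<longleftrightarrow> R \<subseteq> carrier SL2Z \<and>
     (\<forall>C \<in> rcosets\<^bsub>SL2Z\<^esub> (Gamma0 p). \<exists>!M. M \<in> R \<inter> C)"

text \<open>Elements of \<open>\<complex>[L'/L]\<close> are functions on cosets, extended by zero.\<close>

definition group_alg ::
  "('v::euclidean_space \<Rightarrow> 'v \<Rightarrow> real) \<Rightarrow> 'v set \<Rightarrow> ('v set \<Rightarrow> complex) set" where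
  "group_alg B L = {v. \<forall>\<gamma>. \<gamma> \<notin> carrier (disc_group B L) \<longrightarrow> v \<gamma> = 0}"

definition basis_vec :: "'v set \<Rightarrow> 'v set \<Rightarrow> complex" where
  "basis_vec \<gamma> = (\<lambda>\<delta>. if \<delta> = \<gamma> then 1 else 0)"

text \<open>
  The parameter \<open>r\<close> is the (even) signature difference, so that \<open>i\<^bsup>-r/2\<^esup>\<close> is an integer power.
  Since \<open>T\<close> and \<open>S\<close> generate the modular group, at most one \<open>\<rho>\<close> satisfies this predicate
  (up to its values outside the group).
\<close>

definition weil_rep ::
  "('v::euclidean_space \<Rightarrow> 'v \<Rightarrow> real) \<Rightarrow> 'v set \<Rightarrow> int \<Rightarrow>
   (int^2^2 \<Rightarrow> ('v set \<Rightarrow> complex) \<Rightarrow> ('v set \<Rightarrow> complex)) \<Rightarrow> bool" where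
  "weil_rep B L r \<rho> \<longleftrightarrow>
     group_action SL2Z (group_alg B L) \<rho> \<and>
     (\<forall>M \<in> carrier SL2Z. \<forall>u \<in> group_alg B L. \<forall>v \<in> group_alg B L. \<forall>c.
        \<rho> M (\<lambda>\<gamma>. c * u \<gamma> + v \<gamma>) = (\<lambda>\<gamma>. c * \<rho> M u \<gamma> + \<rho> M v \<gamma>)) \<and>
     (\<forall>M \<in> carrier SL2Z. \<forall>u \<in> group_alg B L. \<forall>v \<in> group_alg B L.
        (\<Sum>\<gamma>\<in>carrier (disc_group B L). \<rho> M u \<gamma> * cnj (\<rho> M v \<gamma>)) =
        (\<Sum>\<gamma>\<in>carrier (disc_group B L). u \<gamma> * cnj (v \<gamma>))) \<and>
     (\<forall>\<gamma> \<in> carrier (disc_group B L).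
        \<rho> T_mat (basis_vec \<gamma>) =
          (\<lambda>\<eta>. e (of_real (disc_quad B \<gamma>)) * basis_vec \<gamma> \<eta>)) \<and>
     (\<forall>\<gamma> \<in> carrier (disc_group B L).
        \<rho> S_mat (basis_vec \<gamma>) =
          (\<lambda>\<eta>. \<i> powi (- (r div 2)) / of_real (sqrt (real (order (disc_group B L)))) *
            (\<Sum>\<delta>\<in>carrier (disc_group B L).
               e (- of_real (disc_pair B \<gamma> \<delta>)) * basis_vec \<delta> \<eta>)))"


section \<open>Modular forms\<close>

text \<open>
  A function on the upper half-plane is represented by its extension by zero to the whole
  complex plane, so that spaces of such functions are genuine sets of functions.
\<close>

definition \<H> :: "complex set" where
  "\<H> = {\<tau>. Im \<tau> > 0}"

definition mob :: "real^2^2 \<Rightarrow> complex \<Rightarrow> complex" where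
  "mob M \<tau> = (of_real (M $ 1 $ 1) * \<tau> + of_real (M $ 1 $ 2)) /
             (of_real (M $ 2 $ 1) * \<tau> + of_real (M $ 2 $ 2))"

definition autf :: "real^2^2 \<Rightarrow> complex \<Rightarrow> complex" where
  "autf M \<tau> = of_real (M $ 2 $ 1) * \<tau> + of_real (M $ 2 $ 2)"

definition slash :: "int \<Rightarrow> (complex \<Rightarrow> complex) \<Rightarrow> real^2^2 \<Rightarrow> complex \<Rightarrow> complex" where
  "slash k f M \<tau> =
     (if \<tau> \<in> \<H> then of_real (det M powr (of_int k / 2)) * autf M \<tau> powi (- k) * f (mob M \<tau>)
      else 0)"

abbreviation realmat :: "int^2^2 \<Rightarrow> real^2^2" where
  "realmat \<equiv> map_matrix of_int"

definition W_mat :: "nat \<Rightarrow> real^2^2" where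
  "W_mat p = vector [vector [0, -1], vector [real p, 0]]"

definition mero_at_cusps :: "int \<Rightarrow> (complex \<Rightarrow> complex) \<Rightarrow> bool" where
  "mero_at_cusps k f \<longleftrightarrow>
     (\<forall>M \<in> carrier SL2Z. \<exists>(h::nat) (n0::int) (a :: int \<Rightarrow> complex). h > 0 \<and>
        (\<forall>\<tau>\<in>\<H>. ((\<lambda>n. a n * e (of_int n * \<tau> / of_nat h)) has_sum slash k f (realmat M) \<tau>) {n0..}))"

definition A_space :: "int \<Rightarrow> nat \<Rightarrow> (complex \<Rightarrow> complex) set" where
  "A_space k p = {f.
     (\<forall>\<tau>. \<tau> \<notin> \<H> \<longrightarrow> f \<tau> = 0) \<and> f holomorphic_on \<H> \<and>
     (\<forall>M \<in> Gamma0 p. \<forall>\<tau>\<in>\<H>.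
        slash k f (realmat M) \<tau> = of_int (Legendre (M $ 2 $ 2) (int p)) * f \<tau>) \<and>
     mero_at_cusps k f}"

definition q_expansion :: "(complex \<Rightarrow> complex) \<Rightarrow> (int \<Rightarrow> complex) \<Rightarrow> bool" where
  "q_expansion f a \<longleftrightarrow> (\<forall>\<tau>\<in>\<H>. ((\<lambda>n. a n * e (of_int n * \<tau>)) has_sum f \<tau>) UNIV)"

definition A_eps_space :: "int \<Rightarrow> nat \<Rightarrow> int \<Rightarrow> (complex \<Rightarrow> complex) set" where
  "A_eps_space k p \<epsilon> = {f \<in> A_space k p.
     \<exists>a. q_expansion f a \<and> (\<forall>n. Legendre n (int p) = - \<epsilon> \<longrightarrow> a n = 0)}"

definition A_rho_space ::
  "('v::euclidean_space \<Rightarrow> 'v \<Rightarrow> real) \<Rightarrow> 'v set \<Rightarrow> int \<Rightarrow>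
   (int^2^2 \<Rightarrow> ('v set \<Rightarrow> complex) \<Rightarrow> ('v set \<Rightarrow> complex)) \<Rightarrow>
   (complex \<Rightarrow> 'v set \<Rightarrow> complex) set" where
  "A_rho_space B L k \<rho> = {F.
     (\<forall>\<tau>. \<tau> \<notin> \<H> \<longrightarrow> F \<tau> = (\<lambda>\<gamma>. 0)) \<and> (\<forall>\<tau>. F \<tau> \<in> group_alg B L) \<and>
     (\<forall>\<gamma> \<in> carrier (disc_group B L). (\<lambda>\<tau>. F \<tau> \<gamma>) holomorphic_on \<H>) \<and>
     (\<forall>M \<in> carrier SL2Z. \<forall>\<tau>\<in>\<H>.
        F (mob (realmat M) \<tau>) = (\<lambda>\<gamma>. autf (realmat M) \<tau> powi k * \<rho> M (F \<tau>) \<gamma>)) \<and>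
     (\<forall>\<gamma> \<in> carrier (disc_group B L). \<exists>(a :: real \<Rightarrow> complex) (n0::real). \<forall>\<tau>\<in>\<H>.
        ((\<lambda>n. a n * e (of_real n * \<tau>)) has_sum F \<tau> \<gamma>)
          {n. [n = disc_quad B \<gamma>] (rmod 1) \<and> n \<ge> n0})}"


section \<open>The two maps\<close>

text \<open>
  The sum over cosets of \<open>\<Gamma>\<^sub>0(p)\<close> is taken over a set \<open>R\<close> of representatives of the right cosets
  \<open>\<Gamma>\<^sub>0(p) M\<close> that is passed as a parameter.
\<close>

definition lift_map ::
  "('v::euclidean_space \<Rightarrow> 'v \<Rightarrow> real) \<Rightarrow> 'v set \<Rightarrow> nat \<Rightarrow> int \<Rightarrow> int \<Rightarrow>
   (int^2^2 \<Rightarrow> ('v set \<Rightarrow> complex) \<Rightarrow> ('v set \<Rightarrow> complex)) \<Rightarrow> (int^2^2) set \<Rightarrow>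
   (complex \<Rightarrow> complex) \<Rightarrow> complex \<Rightarrow> 'v set \<Rightarrow> complex" where
  "lift_map B L p r k \<rho> R f = (\<lambda>\<tau> \<gamma>.
     \<i> powi (r div 2) * of_real (real p powr (of_int k / 2 - 1 / 2)) *
     (\<Sum>M\<in>R. inv_into (group_alg B L) (\<rho> M) (basis_vec \<one>\<^bsub>disc_group B L\<^esub>) \<gamma> *
             slash k (slash k f (W_mat p)) (realmat M) \<tau>))"

definition descent_map ::
  "('v::euclidean_space \<Rightarrow> 'v \<Rightarrow> real) \<Rightarrow> 'v set \<Rightarrow> nat \<Rightarrow> int \<Rightarrow> int \<Rightarrow>
   (complex \<Rightarrow> 'v set \<Rightarrow> complex) \<Rightarrow> complex \<Rightarrow> complex" where
  "descent_map B L p r k F = (\<lambda>\<tau>.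
     \<i> powi (r div 2) / 2 * of_real (real p powr ((1 - of_int k) / 2)) *
     slash k (\<lambda>\<tau>'. F \<tau>' \<one>\<^bsub>disc_group B L\<^esub>) (W_mat p) \<tau>)"

end

theory Submission
  imports Defs
begin

text \<open>
  Let \<open>C = i\<^bsup>-r/2\<^esup> p\<^bsup>-1/2\<^esup>\<close>. Applying the relation \<open>T S T S T = S\<close> to the zero basis vector shows that
  \<open>C\<close> times the Gauss sum of the discriminant form is 1, and then \<open>\<rho>(M)\<close> can be evaluated on the zero
  basis vector for all \<open>M\<close> by induction along words in \<open>S\<close> and \<open>T\<close>; in particular \<open>\<Gamma>\<^sub>0(p)\<close> acts on it by
  the quadratic character. Hence the sum defining \<open>F\<close> does not depend on the representatives, \<open>F\<close> is
  modular, and the representatives \<open>1\<close> and \<open>S T\<^sup>j\<close> give the expansions of \<open>F\<^sub>\<gamma>\<close> for \<open>\<gamma> \<noteq> 0\<close>. The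
  condition on the coefficients of \<open>f\<close> enters for \<open>F\<^sub>0\<close> only: let \<open>u\<close> be the part of \<open>f(\<tau>/p)\<close> with
  exponents in \<open>\<int>\<close> minus the multiple of \<open>f | W\<^sub>p\<close> that occurs in \<open>F\<^sub>0\<close>. The \<open>S\<close>-transformation of \<open>F\<^sub>0\<close>
  gives \<open>u(-1/\<tau>) = - C \<tau>\<^sup>k u(\<tau>)\<close>, and applying this twice yields \<open>u = u / p\<close>, so \<open>u = 0\<close>. For the
  descent, unitarity turns the action of \<open>\<Gamma>\<^sub>0(p)\<close> on the zero basis vector into the transformation law
  of \<open>F\<^sub>0\<close>.
\<close>

text \<open>Both \<open>fps_nth\<close> and \<open>vec_nth\<close> are written \<open>$\<close>, which makes terms with many matrix entries ambiguous.\<close>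

no_notation fps_nth (infixl \<open>$\<close> 75)

subsection \<open>Exponential sums modulo an odd prime\<close>

text \<open>The coset sum is a root-of-unity filter in disguise. The term of S T^j is
  \<open>1 / p\<close> times f((\<tau> + j)/p) times a character of j, so these terms together cut
  out of f(\<tau>/p) the exponents n/p with n congruent to \<alpha> x^2. The remaining
  representative 1 contributes only to the zero component, through f | W_p. This describes f at the
  other cusp and cannot be read off from the coefficients a(n); yet the factor 2 in F_0 says that it
  equals the part of f(\<tau>/p) with p | n. That is the obstacle. The coefficient condition gives
  access to it because n has the form \<alpha> x^2 for 1 + chi(\<alpha>) chi(n) residues x. Where
  this count is 0, a(n) vanishes; elsewhere it is 2, or 1 if p | n. Summing all components therefore
  yields a multiple of f(\<tau>/p) up to the terms with p | n, and this is what lets f drop out of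
  the relation for u. The same count brings F back from half the sum of its components: the residues
  giving the value \<alpha> x^2 are x and -x, and F_x = F_(-x) follows from S^2 = -1 and the
  congruence between k and r/2 modulo 2.\<close>

lemma e_add: "e (x + y) = e x * e y"
  by (simp add: e_def distrib_left exp_add)

lemma e_0 [simp]: "e 0 = 1"
  by (simp add: e_def)

lemma e_of_int [simp]: "e (of_int n) = 1"
proof -
  have "\<exists>m. 2 * pi * of_int n = of_int (2 * m) * pi"
    by (rule exI[of _ n]) simp
  thus ?thesis
    by (auto simp: e_def exp_eq_1)
qed

lemma e_nonzero [simp]: "e x \<noteq> 0"
  by (simp add: e_def)

lemma cnj_e_of_real: "cnj (e (of_real x)) = e (- of_real x)"
  by (simp add: e_def exp_cnj)

lemma e_of_nat_mult: "e (of_nat n * x) = e x ^ n"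
  by (induction n) (simp_all add: distrib_right e_add)

lemma e_rcong_of_int_mult:
  assumes "[x = y] (rmod 1)"
  shows "e (of_int m * of_real x) = e (of_int m * of_real y)"
proof -
  obtain n where "y = x + of_int n * 1"
    using assms by (auto simp: rcong_altdef)
  hence "of_int m * complex_of_real y = of_int m * of_real x + of_int (m * n)"
    by (simp add: algebra_simps)
  thus ?thesis by (simp only: e_add e_of_int mult_1_right)
qed

lemma e_eq_1_iff: "e (of_real x) = 1 \<longleftrightarrow> x \<in> \<int>"
proof
  assume "e (of_real x) = 1"
  then obtain n where "2 * pi * x = of_int (2 * n) * pi"
    by (auto simp: e_def exp_eq_1)
  hence "x = of_int n" by (simp add: field_simps)
  thus "x \<in> \<int>" by simp
next
  assume "x \<in> \<int>"
  then obtain n where "x = of_int n" by (auto elim: Ints_cases)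
  thus "e (of_real x) = 1"
    using e_of_int[of n] by (simp del: e_of_int)
qed

section \<open>Additive characters modulo p and their orthogonality\<close>

definition unit_root :: "nat \<Rightarrow> int \<Rightarrow> complex" where
  "unit_root p m = e (of_int m / of_nat p)"

lemma unit_root_add: "unit_root p (m + n) = unit_root p m * unit_root p n"
  by (simp add: unit_root_def add_divide_distrib e_add)

lemma unit_root_0 [simp]: "unit_root p 0 = 1"
  by (simp add: unit_root_def)

lemma unit_root_minus: "unit_root p (- m) = cnj (unit_root p m)"
  using cnj_e_of_real[of "of_int m / real p"] by (simp add: unit_root_def)

lemma unit_root_eq_1_iff:
  assumes "p > 0"
  shows "unit_root p m = 1 \<longleftrightarrow> int p dvd m"
proof -
  have "unit_root p m = e (of_real (of_int m / real p))"
    by (simp add: unit_root_def)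
  hence "unit_root p m = 1 \<longleftrightarrow> (of_int m / real p) \<in> \<int>"
    by (simp only: e_eq_1_iff)
  also have "\<dots> \<longleftrightarrow> int p dvd m"
  proof
    assume "(of_int m / real p) \<in> \<int>"
    then obtain n where "of_int m / real p = of_int n" by (auto elim: Ints_cases)
    hence "real_of_int m = of_int (n * int p)" using assms by (simp add: field_simps)
    hence "m = n * int p" by (simp only: of_int_eq_iff)
    thus "int p dvd m" by simp
  next
    assume "int p dvd m"
    then obtain n where "m = int p * n" by auto
    thus "(of_int m / real p) \<in> \<int>" using assms by simp
  qed
  finally show ?thesis .
qed

lemma unit_root_cong:
  assumes "p > 0" "[m = n] (mod int p)"
  shows "unit_root p m = unit_root p n"
proof -
  have "unit_root p (m - n) = 1"
    using assms by (simp add: unit_root_eq_1_iff cong_iff_dvd_diff)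
  thus ?thesis using unit_root_add[of p "m - n" n] by simp
qed

lemma unit_root_power: "unit_root p (m * int j) = unit_root p m ^ j"
  using e_of_nat_mult[of j "of_int m / of_nat p"] by (simp add: unit_root_def algebra_simps)

lemma sum_int_interval_nat: "(\<Sum>j\<in>{0..<int p}. f j) = (\<Sum>j<p. f (int j))"
  by (rule sum.reindex_bij_witness[where i = int and j = nat]) auto

lemma unit_root_sum:
  assumes "p > 0"
  shows "(\<Sum>j\<in>{0..<int p}. unit_root p (m * j)) = (if int p dvd m then of_nat p else 0)"
proof (cases "int p dvd m")
  case True
  hence "unit_root p (m * j) = 1" for j
    using assms by (simp add: unit_root_eq_1_iff)
  thus ?thesis using True by simp
next
  case False
  have "unit_root p m ^ p = 1"
    using assms by (simp flip: unit_root_power add: unit_root_eq_1_iff)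
  moreover have "unit_root p m \<noteq> 1"
    using False assms by (simp add: unit_root_eq_1_iff)
  ultimately show ?thesis
    using False by (simp add: sum_int_interval_nat unit_root_power geometric_sum)
qed

definition periodic_mod :: "nat \<Rightarrow> (int \<Rightarrow> 'a) \<Rightarrow> bool" where
  "periodic_mod p f \<longleftrightarrow> (\<forall>x y. [x = y] (mod int p) \<longrightarrow> f x = f y)"

lemma periodic_modD: "periodic_mod p f \<Longrightarrow> [x = y] (mod int p) \<Longrightarrow> f x = f y"
  by (simp add: periodic_mod_def)

text \<open>An affine map with invertible slope permutes the residues. It is applied with t = 1 to
  complete squares and with s = 0 to rescale Gauss sums.\<close>

lemma sum_residues_affine:
  fixes f :: "int \<Rightarrow> 'a::comm_monoid_add"
  assumes f: "periodic_mod p f" and p: "p > 0" and t: "coprime t (int p)"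
  shows "(\<Sum>x\<in>{0..<int p}. f (t * x + s)) = (\<Sum>x\<in>{0..<int p}. f x)"
proof -
  define g where "g x = (t * x + s) mod int p" for x
  have inj: "inj_on g {0..<int p}"
  proof (rule inj_onI)
    fix x y assume xy: "x \<in> {0..<int p}" "y \<in> {0..<int p}" "g x = g y"
    hence "[t * x + s = t * y + s] (mod int p)" by (simp add: g_def cong_def)
    hence "[x = y] (mod int p)"
      by (metis cong_add_rcancel cong_mult_lcancel t)
    thus "x = y" using xy by (simp add: cong_def)
  qed
  moreover have "g ` {0..<int p} \<subseteq> {0..<int p}" using p by (auto simp: g_def)
  ultimately have bij: "bij_betw g {0..<int p} {0..<int p}"
    by (simp add: bij_betw_def endo_inj_surj)
  have "(\<Sum>x\<in>{0..<int p}. f (t * x + s)) = (\<Sum>x\<in>{0..<int p}. f (g x))"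
    by (intro sum.cong refl periodic_modD[OF f]) (simp add: g_def cong_def)
  thus ?thesis using sum.reindex_bij_betw[OF bij, of f] by simp
qed

section \<open>The Legendre symbol and quadratic Gauss sums\<close>

locale odd_prime =
  fixes p :: nat
  assumes p: "prime p" and p3: "p \<ge> 3"
begin

lemma p_pos [simp]: "p > 0" using p3 by simp

lemma prime_int_p: "prime (int p)" using p by simp

lemma coprime_p_iff: "coprime t (int p) \<longleftrightarrow> \<not> int p dvd t"
  using prime_imp_coprime[OF prime_int_p, of t] prime_int_p
  by (metis coprime_commute not_coprimeI not_prime_unit dvd_refl)

lemma dvd_mult_iff: "int p dvd a * b \<longleftrightarrow> int p dvd a \<or> int p dvd b"
  using prime_int_p by (simp add: prime_dvd_mult_iff)

abbreviation chi :: "int \<Rightarrow> int" where "chi n \<equiv> Legendre n (int p)"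

lemma chi_cong:
  assumes "[m = n] (mod int p)"
  shows "chi m = chi n"
proof -
  have "[x = m] (mod int p) \<longleftrightarrow> [x = n] (mod int p)" for x
    using assms by (meson cong_sym cong_trans)
  moreover have "[m = 0] (mod int p) \<longleftrightarrow> [n = 0] (mod int p)"
    using assms by (meson cong_sym cong_trans)
  ultimately show ?thesis by (simp add: Legendre_def QuadRes_def)
qed

lemma chi_eq_0_iff: "chi n = 0 \<longleftrightarrow> int p dvd n"
  by (simp add: Legendre_def cong_0_iff)

lemma chi_values: "chi n = 0 \<or> chi n = 1 \<or> chi n = -1"
  by (simp add: Legendre_def)

text \<open>Euler's criterion gives the identity modulo p. Both sides lie in {-1, 0, 1}, so they
  differ by at most 2, and p \<ge> 3 turns the congruence into an equality.\<close>

lemma chi_mult: "chi (a * b) = chi a * chi b"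
proof -
  have "[chi a * chi b = a ^ ((p - 1) div 2) * b ^ ((p - 1) div 2)] (mod int p)"
    using p p3 by (intro cong_mult euler_criterion) auto
  moreover have "[chi (a * b) = (a * b) ^ ((p - 1) div 2)] (mod int p)"
    using p p3 by (intro euler_criterion) auto
  ultimately have "[chi (a * b) = chi a * chi b] (mod int p)"
    by (simp add: power_mult_distrib) (meson cong_sym cong_trans)
  hence "int p dvd chi (a * b) - chi a * chi b" by (simp add: cong_iff_dvd_diff)
  moreover have "\<bar>chi (a * b) - chi a * chi b\<bar> \<le> 2"
    using chi_values[of a] chi_values[of b] chi_values[of "a * b"] by auto
  ultimately show ?thesis
    using p3 zdvd_imp_le[of "int p" "\<bar>chi (a * b) - chi a * chi b\<bar>"] by fastforce
qed

lemma chi_1 [simp]: "chi 1 = 1"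
proof -
  have "chi 1 * chi 1 = chi 1" by (simp flip: chi_mult)
  moreover have "chi 1 \<noteq> 0" using p3 by (simp add: chi_eq_0_iff)
  ultimately show ?thesis by simp
qed

lemma chi_square: "\<not> int p dvd n \<Longrightarrow> chi n * chi n = 1"
  using chi_values[of n] chi_eq_0_iff[of n] by auto

lemma chi_inverse:
  assumes "[a * b = 1] (mod int p)"
  shows "chi b = chi a"
proof -
  have "chi a * chi b = 1"
    using chi_cong[OF assms] by (simp add: chi_mult)
  thus ?thesis using chi_values[of a] chi_values[of b] by auto
qed

lemma square_cong_iff:
  "[x\<^sup>2 = y\<^sup>2] (mod int p) \<longleftrightarrow> [x = y] (mod int p) \<or> [x = - y] (mod int p)"
proof -
  have "x\<^sup>2 - y\<^sup>2 = (x - y) * (x - (- y))" by (simp add: power2_eq_square algebra_simps)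
  thus ?thesis by (simp only: cong_iff_dvd_diff dvd_mult_iff)
qed

lemma not_dvd_double: "\<not> int p dvd x \<Longrightarrow> \<not> int p dvd 2 * x"
  using p3 dvd_mult_iff[of 2 x] zdvd_imp_le[of "int p" 2] by auto

text \<open>This count turns sums over squares into character sums; later it also measures how often
  an exponent n occurs among the components of the lift.\<close>

lemma card_square_roots:
  "int (card {x \<in> {0..<int p}. [x\<^sup>2 = n] (mod int p)}) = 1 + chi n"
proof (cases "int p dvd n")
  case True
  have "[x\<^sup>2 = n] (mod int p) \<longleftrightarrow> int p dvd x" for x
    using True by (metis cong_dvd_iff cong_0_iff cong_sym cong_trans dvd_mult_iff power2_eq_square)
  hence "{x \<in> {0..<int p}. [x\<^sup>2 = n] (mod int p)} = {0}"
    using zdvd_not_zless by (auto simp: order_le_less)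
  thus ?thesis using True chi_eq_0_iff[of n] by simp
next
  case False
  show ?thesis
  proof (cases "QuadRes (int p) n")
    case True
    then obtain y where y: "[y\<^sup>2 = n] (mod int p)" by (auto simp: QuadRes_def)
    have py: "\<not> int p dvd y"
      using False y by (metis cong_dvd_iff dvd_mult_iff power2_eq_square)
    have "[x\<^sup>2 = n] (mod int p) \<longleftrightarrow> [x = y] (mod int p) \<or> [x = - y] (mod int p)" for x
      using y square_cong_iff[of x y] by (meson cong_sym cong_trans)
    moreover have "x \<in> {0..<int p} \<and> [x = z] (mod int p) \<longleftrightarrow> x = z mod int p" for x z
      using p_pos by (auto simp: cong_def simp del: p_pos)
    ultimately have "{x \<in> {0..<int p}. [x\<^sup>2 = n] (mod int p)} = {y mod int p, (- y) mod int p}"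
      by blast
    moreover have "y mod int p \<noteq> (- y) mod int p"
    proof
      assume "y mod int p = (- y) mod int p"
      hence "int p dvd y - (- y)" by (simp only: mod_eq_dvd_iff)
      thus False using not_dvd_double[OF py] by (simp only: diff_minus_eq_add mult_2 not_True_eq_False simp_thms)
    qed
    ultimately have "card {x \<in> {0..<int p}. [x\<^sup>2 = n] (mod int p)} = 2" by simp
    thus ?thesis using False True by (simp add: Legendre_def cong_0_iff)
  next
    case nqr: False
    hence "{x \<in> {0..<int p}. [x\<^sup>2 = n] (mod int p)} = {}" by (auto simp: QuadRes_def)
    hence "card {x \<in> {0..<int p}. [x\<^sup>2 = n] (mod int p)} = 0" by (simp only: card.empty)
    thus ?thesis using False nqr by (simp add: Legendre_def cong_0_iff)
  qed
qed

lemma sum_over_squares: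
  fixes f :: "int \<Rightarrow> complex"
  assumes f: "periodic_mod p f"
  shows "(\<Sum>x\<in>{0..<int p}. f (x\<^sup>2)) = (\<Sum>n\<in>{0..<int p}. of_int (1 + chi n) * f n)"
proof -
  have "(\<Sum>x\<in>{0..<int p}. f (x\<^sup>2)) =
        (\<Sum>n\<in>{0..<int p}. \<Sum>x\<in>{x \<in> {0..<int p}. x\<^sup>2 mod int p = n}. f (x\<^sup>2))"
    by (rule sum.group[symmetric]) auto
  also have "\<dots> = (\<Sum>n\<in>{0..<int p}. of_int (1 + chi n) * f n)"
  proof (rule sum.cong[OF refl])
    fix n assume n: "n \<in> {0..<int p}"
    have *: "x\<^sup>2 mod int p = n \<longleftrightarrow> [x\<^sup>2 = n] (mod int p)" for x
      using n by (simp add: cong_def)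
    have "(\<Sum>x\<in>{x \<in> {0..<int p}. x\<^sup>2 mod int p = n}. f (x\<^sup>2)) =
          (\<Sum>x\<in>{x \<in> {0..<int p}. [x\<^sup>2 = n] (mod int p)}. f n)"
      unfolding * by (intro sum.cong refl periodic_modD[OF f]) auto
    also have "\<dots> = of_int (int (card {x \<in> {0..<int p}. [x\<^sup>2 = n] (mod int p)})) * f n"
      by simp
    finally show "(\<Sum>x\<in>{x \<in> {0..<int p}. x\<^sup>2 mod int p = n}. f (x\<^sup>2)) = of_int (1 + chi n) * f n"
      by (simp only: card_square_roots)
  qed
  finally show ?thesis .
qed

lemma periodic_unit_root: "periodic_mod p (\<lambda>x. unit_root p (t * x))"
  unfolding periodic_mod_def using unit_root_cong[OF p_pos] cong_scalar_left by blast

definition gauss_sum :: "int \<Rightarrow> complex" where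
  "gauss_sum t = (\<Sum>x\<in>{0..<int p}. unit_root p (t * x\<^sup>2))"

text \<open>In the weight 1 + chi n the summand 1 is killed by orthogonality, which leaves the sum
  of chi n against a nontrivial additive character. The substitution n -> t n then pulls out chi
  t.\<close>

lemma gauss_sum_mult:
  assumes t: "\<not> int p dvd t" and u: "\<not> int p dvd u"
  shows "gauss_sum (t * u) = of_int (chi t) * gauss_sum u"
proof -
  define K where "K t = (\<Sum>n\<in>{0..<int p}. of_int (chi n) * unit_root p (t * n))" for t
  have G: "gauss_sum t = K t" if "\<not> int p dvd t" for t
  proof -
    have "gauss_sum t = (\<Sum>n\<in>{0..<int p}. of_int (1 + chi n) * unit_root p (t * n))"
      unfolding gauss_sum_def using sum_over_squares[OF periodic_unit_root] .
    also have "\<dots> = (\<Sum>n\<in>{0..<int p}. unit_root p (t * n)) + K t"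
      by (simp add: K_def distrib_right sum.distrib)
    finally show ?thesis using that by (simp add: unit_root_sum)
  qed
  have "of_int (chi t) * K u = (\<Sum>n\<in>{0..<int p}. of_int (chi t * chi n) * unit_root p (u * n))"
    by (simp add: K_def sum_distrib_left mult.assoc)
  also have "\<dots> = (\<Sum>n\<in>{0..<int p}. of_int (chi t * chi (t * n + 0)) * unit_root p (u * (t * n + 0)))"
  proof (rule sum_residues_affine[symmetric])
    show "periodic_mod p (\<lambda>n. of_int (chi t * chi n) * unit_root p (u * n))"
      using periodic_unit_root[of u] chi_cong unfolding periodic_mod_def by metis
  qed (use t in \<open>auto simp: coprime_p_iff\<close>)
  also have "\<dots> = K (t * u)"
    unfolding K_def
  proof (rule sum.cong[OF refl])
    fix n
    have "chi t * chi (t * n) = chi n"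
      using chi_square[OF t] by (simp add: chi_mult flip: mult.assoc)
    thus "of_int (chi t * chi (t * n + 0)) * unit_root p (u * (t * n + 0)) =
          of_int (chi n) * unit_root p (t * u * n)"
      by (simp add: mult_ac)
  qed
  finally show ?thesis using G t u by (simp add: dvd_mult_iff)
qed

lemma cnj_gauss_sum: "cnj (gauss_sum t) = gauss_sum (- t)"
  by (simp add: gauss_sum_def flip: unit_root_minus)

end

subsection \<open>The modular group and the slash operator\<close>

definition mat2 :: "'a \<Rightarrow> 'a \<Rightarrow> 'a \<Rightarrow> 'a \<Rightarrow> 'a::zero^2^2" where
  "mat2 a b c d = vector [vector [a, b], vector [c, d]]"

lemma mat2_nth [simp]:
  "mat2 a b c d $ 1 $ 1 = a" "mat2 a b c d $ 1 $ 2 = b"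
  "mat2 a b c d $ 2 $ 1 = c" "mat2 a b c d $ 2 $ 2 = d"
  by (simp_all add: mat2_def)

lemma mat2_eq_iff:
  fixes M N :: "'a^2^2"
  shows "M = N \<longleftrightarrow> M $ 1 $ 1 = N $ 1 $ 1 \<and> M $ 1 $ 2 = N $ 1 $ 2 \<and> M $ 2 $ 1 = N $ 2 $ 1 \<and> M $ 2 $ 2 = N $ 2 $ 2"
  by (auto simp: vec_eq_iff forall_2)

lemma mat2_mult_nth:
  fixes M N :: "'a::comm_semiring_1^2^2"
  shows "(M ** N) $ 1 $ 1 = M $ 1 $ 1 * N $ 1 $ 1 + M $ 1 $ 2 * N $ 2 $ 1"
    "(M ** N) $ 1 $ 2 = M $ 1 $ 1 * N $ 1 $ 2 + M $ 1 $ 2 * N $ 2 $ 2"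
    "(M ** N) $ 2 $ 1 = M $ 2 $ 1 * N $ 1 $ 1 + M $ 2 $ 2 * N $ 2 $ 1"
    "(M ** N) $ 2 $ 2 = M $ 2 $ 1 * N $ 1 $ 2 + M $ 2 $ 2 * N $ 2 $ 2"
  by (simp_all add: matrix_matrix_mult_def sum_2)

lemma mat2_one_nth [simp]:
  "(mat 1 :: 'a::zero_neq_one^2^2) $ 1 $ 1 = 1" "(mat 1 :: 'a^2^2) $ 1 $ 2 = 0"
  "(mat 1 :: 'a^2^2) $ 2 $ 1 = 0" "(mat 1 :: 'a^2^2) $ 2 $ 2 = 1"
  by (simp_all add: mat_def)

lemma T_mat_nth [simp]: "T_mat $ 1 $ 1 = 1" "T_mat $ 1 $ 2 = 1" "T_mat $ 2 $ 1 = 0" "T_mat $ 2 $ 2 = 1"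
  by (simp_all add: T_mat_def)

lemma S_mat_nth [simp]: "S_mat $ 1 $ 1 = 0" "S_mat $ 1 $ 2 = -1" "S_mat $ 2 $ 1 = 1" "S_mat $ 2 $ 2 = 0"
  by (simp_all add: S_mat_def)

lemma W_mat_nth [simp]:
  "W_mat p $ 1 $ 1 = 0" "W_mat p $ 1 $ 2 = -1" "W_mat p $ 2 $ 1 = real p" "W_mat p $ 2 $ 2 = 0"
  by (simp_all add: W_mat_def)

text \<open>The inverse in determinant 1. As an adjugate it is involutive and reverses products for
  all integer matrices, without side conditions.\<close>

definition adj2 :: "int^2^2 \<Rightarrow> int^2^2" where
  "adj2 M = mat2 (M $ 2 $ 2) (- M $ 1 $ 2) (- M $ 2 $ 1) (M $ 1 $ 1)"

lemma adj2_nth [simp]: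
  "adj2 M $ 1 $ 1 = M $ 2 $ 2" "adj2 M $ 1 $ 2 = - M $ 1 $ 2"
  "adj2 M $ 2 $ 1 = - M $ 2 $ 1" "adj2 M $ 2 $ 2 = M $ 1 $ 1"
  by (simp_all add: adj2_def)

lemma adj2_adj2 [simp]: "adj2 (adj2 M) = M"
  by (simp add: mat2_eq_iff)

lemma adj2_mult: "adj2 (M ** N) = adj2 N ** adj2 M"
  by (simp add: mat2_eq_iff mat2_mult_nth algebra_simps)

lemma SL2Z_simps [simp]:
  "monoid.mult SL2Z = (**)" "monoid.one SL2Z = mat 1"
  by (simp_all add: SL2Z_def)

lemma SL2Z_iff: "M \<in> carrier SL2Z \<longleftrightarrow> M $ 1 $ 1 * M $ 2 $ 2 - M $ 1 $ 2 * M $ 2 $ 1 = 1"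
  by (simp add: SL2Z_def det_2)

lemma SL2Z_det: "M \<in> carrier SL2Z \<Longrightarrow> det M = 1"
  by (simp add: SL2Z_def)

lemma SL2Z_mult: "M \<in> carrier SL2Z \<Longrightarrow> N \<in> carrier SL2Z \<Longrightarrow> M ** N \<in> carrier SL2Z"
  by (simp add: SL2Z_def det_mul)

lemma SL2Z_one [simp]: "mat 1 \<in> carrier SL2Z"
  and SL2Z_T [simp]: "T_mat \<in> carrier SL2Z"
  and SL2Z_S [simp]: "S_mat \<in> carrier SL2Z"
  by (simp_all add: SL2Z_iff)

lemma SL2Z_adj2_iff [simp]: "adj2 M \<in> carrier SL2Z \<longleftrightarrow> M \<in> carrier SL2Z"
  by (simp add: SL2Z_iff algebra_simps)

lemma adj2_inverse:
  assumes "M \<in> carrier SL2Z"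
  shows "M ** adj2 M = mat 1" "adj2 M ** M = mat 1"
  using assms by (simp_all add: SL2Z_iff mat2_eq_iff mat2_mult_nth algebra_simps)

text \<open>Euclid's algorithm on the first column. Left multiplication by S and T suffices because
  the inverses of both generators are themselves positive words in S and T.\<close>

lemma SL2Z_induct [consumes 1, case_names one S T]:
  assumes "M \<in> carrier SL2Z"
    and one: "P (mat 1)"
    and S: "\<And>M. M \<in> carrier SL2Z \<Longrightarrow> P M \<Longrightarrow> P (S_mat ** M)"
    and T: "\<And>M. M \<in> carrier SL2Z \<Longrightarrow> P M \<Longrightarrow> P (T_mat ** M)"
  shows "P M"
proof -
  define U :: "int \<Rightarrow> int^2^2" where "U n = mat2 1 n 0 1" for n
  have U [simp]: "U n \<in> carrier SL2Z" for n by (simp add: SL2Z_iff U_def)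
  have S3: "P (S_mat ** (S_mat ** (S_mat ** M)))" if "M \<in> carrier SL2Z" "P M" for M
    using that by (intro S SL2Z_mult) auto
  have pos: "P (U (int n) ** M)" if "M \<in> carrier SL2Z" "P M" for M n
  proof (induction n)
    case 0
    have "U 0 ** M = M" by (simp add: U_def mat2_eq_iff mat2_mult_nth)
    thus ?case using that by simp
  next
    case (Suc n)
    have "U (int (Suc n)) ** M = T_mat ** (U (int n) ** M)"
      by (simp add: U_def mat2_eq_iff mat2_mult_nth algebra_simps)
    thus ?case using T[OF SL2Z_mult[OF U that(1)] Suc] by simp
  qed
  have Tinv: "P (U (-1) ** M)" if M: "M \<in> carrier SL2Z" "P M" for M
  proof -
    have 1: "P (S_mat ** M)" "S_mat ** M \<in> carrier SL2Z" using M by (auto intro: S SL2Z_mult)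
    have 2: "P (T_mat ** (S_mat ** M))" "T_mat ** (S_mat ** M) \<in> carrier SL2Z"
      using 1 by (auto intro: T SL2Z_mult)
    have 3: "P (S_mat ** (T_mat ** (S_mat ** M)))" "S_mat ** (T_mat ** (S_mat ** M)) \<in> carrier SL2Z"
      using 2 by (auto intro: S SL2Z_mult)
    have 4: "P (T_mat ** (S_mat ** (T_mat ** (S_mat ** M))))"
      "T_mat ** (S_mat ** (T_mat ** (S_mat ** M))) \<in> carrier SL2Z"
      using 3 by (auto intro: T SL2Z_mult)
    \<comment> \<open>The relation (S T)^3 = S^2 together with S^4 = 1, solved for T^-1.\<close>
    have "U (-1) ** M = S_mat ** (S_mat ** (S_mat ** (T_mat ** (S_mat ** (T_mat ** (S_mat ** M))))))"
      by (simp add: U_def mat2_eq_iff mat2_mult_nth algebra_simps)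
    thus ?thesis using S3[OF 4(2,1)] by simp
  qed
  have neg: "P (U (- int n) ** M)" if "M \<in> carrier SL2Z" "P M" for M n
  proof (induction n)
    case 0
    have "U 0 ** M = M" by (simp add: U_def mat2_eq_iff mat2_mult_nth)
    thus ?case using that by simp
  next
    case (Suc n)
    have "U (- int (Suc n)) ** M = U (-1) ** (U (- int n) ** M)"
      by (simp add: U_def mat2_eq_iff mat2_mult_nth algebra_simps)
    thus ?case using Tinv[OF SL2Z_mult[OF U that(1)] Suc] by simp
  qed
  have Un: "P (U n ** M)" if "M \<in> carrier SL2Z" "P M" for M n
    using pos[OF that, of "nat n"] neg[OF that, of "nat (- n)"] by (cases "n \<ge> 0") auto
  show ?thesis
    using assms(1)
  proof (induction "nat \<bar>M $ 2 $ 1\<bar>" arbitrary: M rule: less_induct)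
    case less
    show ?case
    proof (cases "M $ 2 $ 1 = 0")
      case True
      hence "M $ 1 $ 1 * M $ 2 $ 2 = 1" using less.prems by (simp add: SL2Z_iff)
      then consider "M $ 1 $ 1 = 1" "M $ 2 $ 2 = 1" | "M $ 1 $ 1 = -1" "M $ 2 $ 2 = -1"
        by (auto simp: zmult_eq_1_iff)
      thus ?thesis
      proof cases
        case 1
        hence "M = U (M $ 1 $ 2) ** mat 1"
          using True by (simp add: U_def mat2_eq_iff mat2_mult_nth)
        thus ?thesis using Un[OF SL2Z_one one] by metis
      next
        case 2
        hence "M = U (- M $ 1 $ 2) ** (S_mat ** (S_mat ** mat 1))"
          using True by (simp add: U_def mat2_eq_iff mat2_mult_nth)
        moreover have "P (S_mat ** (S_mat ** mat 1))" by (intro S SL2Z_mult one) auto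
        ultimately show ?thesis using Un by (metis SL2Z_mult SL2Z_S SL2Z_one)
      qed
    next
      case False
      \<comment> \<open>Division with remainder: subtracting q times the second row from the first
        and swapping by S leaves the remainder as the new lower left entry.\<close>
      define q where "q = M $ 1 $ 1 div M $ 2 $ 1"
      define N where "N = S_mat ** (U (- q) ** M)"
      have N: "N \<in> carrier SL2Z" using less.prems by (auto simp: N_def intro!: SL2Z_mult)
      have "N $ 2 $ 1 = M $ 1 $ 1 mod M $ 2 $ 1"
        by (simp add: N_def U_def mat2_mult_nth q_def minus_div_mult_eq_mod[symmetric] algebra_simps)
      hence "nat \<bar>N $ 2 $ 1\<bar> < nat \<bar>M $ 2 $ 1\<bar>" using False abs_mod_less by auto
      hence "P N" using less.hyps N by blast
      hence "P (U q ** (S_mat ** (S_mat ** (S_mat ** N))))"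
        using N by (intro Un S3 SL2Z_mult) auto
      moreover have "M = U q ** (S_mat ** (S_mat ** (S_mat ** N)))"
        by (simp add: N_def U_def mat2_eq_iff mat2_mult_nth algebra_simps)
      ultimately show ?thesis by simp
    qed
  qed
qed

section \<open>Fractional linear action and slash operator\<close>

lemma realmat_mult: "realmat (M ** N) = realmat M ** realmat N"
  by (simp add: mat2_eq_iff mat2_mult_nth)

lemma det_realmat: "det (realmat M) = of_int (det M)"
  by (simp add: det_2)

lemma realmat_one [simp]: "realmat (mat 1) = mat 1"
  by (simp add: mat2_eq_iff)

lemma \<H>_iff: "\<tau> \<in> \<H> \<longleftrightarrow> Im \<tau> > 0"
  by (simp add: \<H>_def)

lemma autf_nonzero:
  assumes "det M > 0" "\<tau> \<in> \<H>"
  shows "autf M \<tau> \<noteq> 0"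
proof
  assume "autf M \<tau> = 0"
  hence "M $ 2 $ 1 * Im \<tau> = 0" "M $ 2 $ 1 * Re \<tau> + M $ 2 $ 2 = 0"
    by (auto simp: autf_def complex_eq_iff)
  thus False using assms by (auto simp: \<H>_iff det_2)
qed

lemma Im_mob: "Im (mob M \<tau>) = det M * Im \<tau> / (norm (autf M \<tau>))\<^sup>2"
  by (simp add: mob_def autf_def Im_divide cmod_power2 det_2 algebra_simps)

lemma mob_in_\<H>:
  assumes "det M > 0" "\<tau> \<in> \<H>"
  shows "mob M \<tau> \<in> \<H>"
  using assms autf_nonzero[OF assms] by (simp add: \<H>_iff Im_mob)

lemma autf_mult:
  assumes "det N > 0" "\<tau> \<in> \<H>"
  shows "autf (M ** N) \<tau> = autf M (mob N \<tau>) * autf N \<tau>"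
  using autf_nonzero[OF assms]
  by (simp add: autf_def mob_def mat2_mult_nth field_simps)

lemma mob_mult:
  assumes "det M > 0" "det N > 0" "\<tau> \<in> \<H>"
  shows "mob (M ** N) \<tau> = mob M (mob N \<tau>)"
proof -
  have "autf N \<tau> \<noteq> 0" "autf M (mob N \<tau>) \<noteq> 0"
    using assms autf_nonzero mob_in_\<H> by blast+
  thus ?thesis
    using autf_mult[OF assms(2,3), of M]
    by (simp add: autf_def mob_def mat2_mult_nth divide_simps) (simp add: algebra_simps)
qed

lemma slash_slash:
  assumes "det M > 0" "det N > 0"
  shows "slash k (slash k f M) N = slash k f (M ** N)"
proof
  fix \<tau>
  show "slash k (slash k f M) N \<tau> = slash k f (M ** N) \<tau>"
    using assms
    by (simp add: slash_def mob_in_\<H> autf_mult mob_mult power_int_mult_distrib det_mul powr_mult)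
qed

lemma slash_mat1: "\<tau> \<in> \<H> \<Longrightarrow> slash k f (mat 1) \<tau> = f \<tau>"
  by (simp add: slash_def autf_def mob_def)

lemma slash_linear:
  "slash k (\<lambda>\<tau>. c * f \<tau> + g \<tau>) M = (\<lambda>\<tau>. c * slash k f M \<tau> + slash k g M \<tau>)"
  by (auto simp: slash_def algebra_simps)

lemma slash_cmult: "slash k (\<lambda>\<tau>. c * f \<tau>) M = (\<lambda>\<tau>. c * slash k f M \<tau>)"
  by (auto simp: slash_def algebra_simps)

lemma slash_notin: "\<tau> \<notin> \<H> \<Longrightarrow> slash k f M \<tau> = 0"
  by (simp add: slash_def)

lemma slash_holomorphic:
  assumes "f holomorphic_on \<H>" "det M > 0"
  shows "slash k f M holomorphic_on \<H>"
proof -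
  have *: "autf M holomorphic_on \<H>" "mob M holomorphic_on \<H>"
    using autf_nonzero[OF assms(2)] unfolding autf_def mob_def
    by (auto intro!: holomorphic_intros)
  have "(f \<circ> mob M) holomorphic_on \<H>"
    using * assms mob_in_\<H> by (intro holomorphic_on_compose_gen[of _ _ _ \<H>]) auto
  hence "(\<lambda>\<tau>. f (mob M \<tau>)) holomorphic_on \<H>" by (simp add: o_def)
  hence "(\<lambda>\<tau>. of_real (det M powr (of_int k / 2)) * autf M \<tau> powi (- k) * f (mob M \<tau>)) holomorphic_on \<H>"
    using * autf_nonzero[OF assms(2)] by (intro holomorphic_on_mult holomorphic_intros) auto
  thus ?thesis
    by (rule holomorphic_transform) (auto simp: slash_def)
qed

section \<open>Cosets of the congruence subgroup and sums over transversals\<close>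

lemma Gamma0_iff: "M \<in> Gamma0 p \<longleftrightarrow> M \<in> carrier SL2Z \<and> int p dvd M $ 2 $ 1"
  by (simp add: Gamma0_def)

lemma Gamma0_adj2: "M \<in> Gamma0 p \<Longrightarrow> adj2 M \<in> Gamma0 p"
  by (simp add: Gamma0_iff)

lemma Gamma0_coset_iff:
  assumes "M \<in> carrier SL2Z" "N \<in> carrier SL2Z"
  shows "N \<in> Gamma0 p #>\<^bsub>SL2Z\<^esub> M \<longleftrightarrow> N ** adj2 M \<in> Gamma0 p"
proof -
  have 1: "(G ** M) ** adj2 M = G" for G
    using adj2_inverse[OF assms(1)] by (simp flip: matrix_mul_assoc)
  have 2: "N = (N ** adj2 M) ** M"
    using adj2_inverse[OF assms(1)] by (simp flip: matrix_mul_assoc)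
  show ?thesis
  proof
    assume "N \<in> Gamma0 p #>\<^bsub>SL2Z\<^esub> M"
    then obtain G where "G \<in> Gamma0 p" "N = G ** M" by (auto simp: r_coset_def)
    thus "N ** adj2 M \<in> Gamma0 p" by (simp only: 1)
  next
    assume "N ** adj2 M \<in> Gamma0 p"
    thus "N \<in> Gamma0 p #>\<^bsub>SL2Z\<^esub> M" using 2 by (auto simp: r_coset_def)
  qed
qed

text \<open>Replaces coset sets by the relation N M^-1 in \<open>Gamma0 p\<close>, so that later
  arguments are matrix identities.\<close>

lemma Gamma0_transversal_iff:
  "Gamma0_transversal p R \<longleftrightarrow> R \<subseteq> carrier SL2Z \<and>
     (\<forall>M\<in>carrier SL2Z. \<exists>!N. N \<in> R \<and> N ** adj2 M \<in> Gamma0 p)"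
proof (cases "R \<subseteq> carrier SL2Z")
  case True
  have iff: "(\<exists>!N. N \<in> R \<inter> (Gamma0 p #>\<^bsub>SL2Z\<^esub> M)) \<longleftrightarrow> (\<exists>!N. N \<in> R \<and> N ** adj2 M \<in> Gamma0 p)"
    if "M \<in> carrier SL2Z" for M
  proof -
    have "N \<in> R \<inter> (Gamma0 p #>\<^bsub>SL2Z\<^esub> M) \<longleftrightarrow> N \<in> R \<and> N ** adj2 M \<in> Gamma0 p" for N
      using True Gamma0_coset_iff[OF that, of N] by blast
    thus ?thesis by (simp only:)
  qed
  have "(\<forall>C\<in>rcosets\<^bsub>SL2Z\<^esub> Gamma0 p. \<exists>!N. N \<in> R \<inter> C) \<longleftrightarrow>
        (\<forall>M\<in>carrier SL2Z. \<exists>!N. N \<in> R \<inter> (Gamma0 p #>\<^bsub>SL2Z\<^esub> M))"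
    by (simp add: RCOSETS_def)
  thus ?thesis using True iff by (simp add: Gamma0_transversal_def cong: ball_cong)
qed (auto simp: Gamma0_transversal_def)

lemma Gamma0_transversal_mult:
  assumes R: "Gamma0_transversal p R" and N: "N \<in> carrier SL2Z"
  shows "Gamma0_transversal p ((\<lambda>M. M ** N) ` R)"
  unfolding Gamma0_transversal_iff
proof (intro conjI ballI)
  show "(\<lambda>M. M ** N) ` R \<subseteq> carrier SL2Z"
    using R N by (auto simp: Gamma0_transversal_iff SL2Z_mult)
next
  fix M assume M: "M \<in> carrier SL2Z"
  have "M ** adj2 N \<in> carrier SL2Z" using M N by (simp add: SL2Z_mult)
  then obtain K where K: "K \<in> R" "K ** adj2 (M ** adj2 N) \<in> Gamma0 p"
    and uniq: "\<And>K'. K' \<in> R \<Longrightarrow> K' ** adj2 (M ** adj2 N) \<in> Gamma0 p \<Longrightarrow> K' = K"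
    using R unfolding Gamma0_transversal_iff by metis
  have *: "K' ** adj2 (M ** adj2 N) = (K' ** N) ** adj2 M" for K'
    by (simp add: adj2_mult matrix_mul_assoc)
  show "\<exists>!K'. K' \<in> (\<lambda>M. M ** N) ` R \<and> K' ** adj2 M \<in> Gamma0 p"
    by (rule ex1I[of _ "K ** N"]) (use K(1) K(2)[unfolded *] uniq[unfolded *] in blast)+
qed

text \<open>Each M in R is matched with the member of R' in its coset, where t has the same value.
  With R' explicit this evaluates the lift; with R and the translate R N it gives
  modularity.\<close>

lemma sum_Gamma0_transversal:
  fixes t :: "int^2^2 \<Rightarrow> 'a::comm_monoid_add"
  assumes R: "Gamma0_transversal p R" "Gamma0_transversal p R'"
    and t: "\<And>G M. G \<in> Gamma0 p \<Longrightarrow> M \<in> carrier SL2Z \<Longrightarrow> t (G ** M) = t M"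
  shows "sum t R = sum t R'"
proof -
  define g where "g X M = (THE N. N \<in> X \<and> N ** adj2 M \<in> Gamma0 p)" for X M
  have g: "g X M \<in> X \<and> g X M ** adj2 M \<in> Gamma0 p"
    and g_eq: "N \<in> X \<Longrightarrow> N ** adj2 M \<in> Gamma0 p \<Longrightarrow> g X M = N"
    if "Gamma0_transversal p X" "M \<in> carrier SL2Z" for X M N
  proof -
    have ex1: "\<exists>!N. N \<in> X \<and> N ** adj2 M \<in> Gamma0 p"
      using that by (simp add: Gamma0_transversal_iff)
    show "g X M \<in> X \<and> g X M ** adj2 M \<in> Gamma0 p"
      unfolding g_def by (rule theI'[OF ex1])
    show "g X M = N" if "N \<in> X" "N ** adj2 M \<in> Gamma0 p"
      unfolding g_def using ex1 that by (intro the1_equality) auto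
  qed
  have sub: "R \<subseteq> carrier SL2Z" "R' \<subseteq> carrier SL2Z"
    using R by (auto simp: Gamma0_transversal_iff)
  have sym: "M ** adj2 N \<in> Gamma0 p" if "N ** adj2 M \<in> Gamma0 p" for M N
    using Gamma0_adj2[OF that] by (simp add: adj2_mult)
  have inv: "g X (g Y M) = M"
    if "Gamma0_transversal p X" "Gamma0_transversal p Y" "M \<in> X" for X Y M
  proof -
    have M: "M \<in> carrier SL2Z" using that by (auto simp: Gamma0_transversal_iff)
    have "g Y M \<in> Y \<and> g Y M ** adj2 M \<in> Gamma0 p" using g that M by blast
    thus ?thesis using that sym by (intro g_eq) (auto simp: Gamma0_transversal_iff)
  qed
  show ?thesis
  proof (rule sum.reindex_bij_witness[where i = "g R" and j = "g R'"])
    fix M assume M: "M \<in> R"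
    hence M': "M \<in> carrier SL2Z" using sub by auto
    show "g R (g R' M) = M" using inv R M by blast
    show "g R' M \<in> R'" using g R(2) M' by blast
    have "g R' M = (g R' M ** adj2 M) ** M"
      using adj2_inverse[OF M'] by (simp flip: matrix_mul_assoc)
    moreover have "g R' M ** adj2 M \<in> Gamma0 p" using g R(2) M' by blast
    ultimately show "t (g R' M) = t M" using t M' by metis
  next
    fix M assume M: "M \<in> R'"
    hence M': "M \<in> carrier SL2Z" using sub by auto
    show "g R' (g R M) = M" using inv R M by blast
    show "g R M \<in> R" using g R(1) M' by blast
  qed
qed

definition ST_mat :: "int \<Rightarrow> int^2^2" where
  "ST_mat j = mat2 0 (-1) 1 j"

lemma ST_mat_in_SL2Z [simp]: "ST_mat j \<in> carrier SL2Z"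
  by (simp add: ST_mat_def SL2Z_iff)

context odd_prime
begin

lemma Gamma0_not_dvd:
  assumes "M \<in> carrier SL2Z" "int p dvd M $ 2 $ 1"
  shows "[M $ 1 $ 1 * M $ 2 $ 2 = 1] (mod int p)" "\<not> int p dvd M $ 1 $ 1" "\<not> int p dvd M $ 2 $ 2"
proof -
  have "M $ 1 $ 1 * M $ 2 $ 2 - 1 = M $ 1 $ 2 * M $ 2 $ 1"
    using assms(1) by (simp add: SL2Z_iff)
  thus *: "[M $ 1 $ 1 * M $ 2 $ 2 = 1] (mod int p)"
    using assms(2) by (simp add: cong_iff_dvd_diff)
  have "\<not> int p dvd M $ 1 $ 1 * M $ 2 $ 2"
    using cong_dvd_iff[OF *] p3 by auto
  thus "\<not> int p dvd M $ 1 $ 1" "\<not> int p dvd M $ 2 $ 2" by (auto simp: dvd_mult_iff)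
qed

text \<open>A coset is the bottom row (c : d) as a point of the projective line over F_p. For
  invertible c this point is (1 : d/c), and \<open>ST_mat j\<close>, which is S T^j, has bottom row
  (1, j).\<close>

lemma Gamma0_ST_mat:
  assumes "M \<in> carrier SL2Z" "\<not> int p dvd M $ 2 $ 1"
  shows "\<exists>!j. j \<in> {0..<int p} \<and> ST_mat j ** adj2 M \<in> Gamma0 p"
proof -
  obtain c' where c': "[M $ 2 $ 1 * c' = 1] (mod int p)"
    using assms coprime_p_iff cong_solve_coprime_int by blast
  have *: "ST_mat j ** adj2 M \<in> Gamma0 p \<longleftrightarrow> [j = c' * M $ 2 $ 2] (mod int p)" for j
  proof -
    have "ST_mat j ** adj2 M \<in> Gamma0 p \<longleftrightarrow> int p dvd M $ 2 $ 2 - M $ 2 $ 1 * j"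
    proof -
      have "ST_mat j ** adj2 M \<in> carrier SL2Z" using assms(1) by (simp add: SL2Z_mult)
      moreover have "(ST_mat j ** adj2 M) $ 2 $ 1 = M $ 2 $ 2 - M $ 2 $ 1 * j"
        by (simp add: ST_mat_def mat2_mult_nth)
      ultimately show ?thesis by (simp only: Gamma0_iff simp_thms)
    qed
    also have "\<dots> \<longleftrightarrow> [M $ 2 $ 1 * j = M $ 2 $ 2] (mod int p)"
      by (metis cong_iff_dvd_diff cong_sym_eq)
    also have "\<dots> \<longleftrightarrow> [M $ 2 $ 1 * j = M $ 2 $ 1 * (c' * M $ 2 $ 2)] (mod int p)"
    proof -
      have "[M $ 2 $ 1 * c' * M $ 2 $ 2 = 1 * M $ 2 $ 2] (mod int p)"
        using c' by (rule cong_scalar_right)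
      thus ?thesis by (simp add: mult.assoc) (meson cong_sym cong_trans)
    qed
    also have "\<dots> \<longleftrightarrow> [j = c' * M $ 2 $ 2] (mod int p)"
      using assms(2) by (simp add: cong_mult_lcancel coprime_p_iff)
    finally show ?thesis .
  qed
  show ?thesis unfolding *
    by (rule ex1I[of _ "(c' * M $ 2 $ 2) mod int p"]) (auto simp: cong_def)
qed

text \<open>These are the p + 1 points of the projective line: the identity gives (0 : 1) and
  \<open>ST_mat j\<close> gives (1 : j).\<close>

lemma Gamma0_transversal_ST:
  "Gamma0_transversal p (insert (mat 1) (ST_mat ` {0..<int p}))"
  unfolding Gamma0_transversal_iff
proof (intro conjI ballI)
  fix M assume M: "M \<in> carrier SL2Z"
  have 1: "mat 1 ** adj2 M \<in> Gamma0 p \<longleftrightarrow> int p dvd M $ 2 $ 1"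
    using M by (simp add: Gamma0_iff)
  show "\<exists>!N. N \<in> insert (mat 1) (ST_mat ` {0..<int p}) \<and> N ** adj2 M \<in> Gamma0 p"
  proof (cases "int p dvd M $ 2 $ 1")
    case True
    have "ST_mat j ** adj2 M \<notin> Gamma0 p" for j
    proof
      assume "ST_mat j ** adj2 M \<in> Gamma0 p"
      hence "int p dvd (ST_mat j ** adj2 M) $ 2 $ 1" by (simp only: Gamma0_iff)
      hence "int p dvd M $ 2 $ 2 - j * M $ 2 $ 1" by (simp add: ST_mat_def mat2_mult_nth algebra_simps)
      hence "int p dvd (M $ 2 $ 2 - j * M $ 2 $ 1) + j * M $ 2 $ 1" using True by (intro dvd_add) auto
      thus False using Gamma0_not_dvd[OF M True] by simp
    qed
    thus ?thesis using True 1 by (intro ex1I[of _ "mat 1"]) auto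
  next
    case False
    obtain j where j: "j \<in> {0..<int p}" "ST_mat j ** adj2 M \<in> Gamma0 p"
      and uniq: "\<And>j'. j' \<in> {0..<int p} \<Longrightarrow> ST_mat j' ** adj2 M \<in> Gamma0 p \<Longrightarrow> j' = j"
      using Gamma0_ST_mat[OF M False] by metis
    show ?thesis
      by (rule ex1I[of _ "ST_mat j"]) (use j uniq False 1 in blast)+
  qed
qed auto

lemma sum_transversal_ST:
  fixes t :: "int^2^2 \<Rightarrow> 'a::comm_monoid_add"
  assumes R: "Gamma0_transversal p R"
    and t: "\<And>G M. G \<in> Gamma0 p \<Longrightarrow> M \<in> carrier SL2Z \<Longrightarrow> t (G ** M) = t M"
  shows "sum t R = t (mat 1) + (\<Sum>j\<in>{0..<int p}. t (ST_mat j))"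
proof -
  have "inj ST_mat" by (auto simp: inj_def ST_mat_def mat2_eq_iff)
  moreover have "mat 1 \<notin> range ST_mat" by (auto simp: ST_mat_def mat2_eq_iff)
  ultimately have "sum t (insert (mat 1) (ST_mat ` {0..<int p})) = t (mat 1) + (\<Sum>j\<in>{0..<int p}. t (ST_mat j))"
    by (subst sum.insert) (auto simp: sum.reindex inj_on_subset)
  thus ?thesis using sum_Gamma0_transversal[OF R Gamma0_transversal_ST t] by simp
qed

end

subsection \<open>The discriminant group\<close>

lemma rcong_1_iff: "[a = b] (rmod 1) \<longleftrightarrow> a - b \<in> \<int>"
proof
  assume "[a = b] (rmod 1)"
  then obtain n where "b = a + of_int n * 1" by (auto simp: rcong_altdef)
  hence "a - b = of_int (- n)" by simp
  thus "a - b \<in> \<int>" by (simp only: Ints_of_int)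
next
  assume "a - b \<in> \<int>"
  then obtain n where "a - b = of_int n" by (auto elim: Ints_cases)
  hence "b = a + of_int (- n) * 1" by simp
  thus "[a = b] (rmod 1)" unfolding rcong_altdef by blast
qed

locale prime_disc = odd_prime p for p :: nat +
  fixes B :: "'v::euclidean_space \<Rightarrow> 'v \<Rightarrow> real" and L :: "'v set" and \<alpha> :: int
  assumes lattice: "even_lattice B L"
    and ord: "order (disc_group B L) = p"
    and \<alpha>: "\<not> int p dvd \<alpha>" "disc_form_equiv B L p \<alpha>"
begin

abbreviation D :: "'v set set" where "D \<equiv> carrier (disc_group B L)"
abbreviation Q :: "'v set \<Rightarrow> real" where "Q \<equiv> disc_quad B"
abbreviation P :: "'v set \<Rightarrow> 'v set \<Rightarrow> real" where "P \<equiv> disc_pair B"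

lemma bil: "bilinear B" and sym: "B x y = B y x" and quad_int: "x \<in> L \<Longrightarrow> quad B x \<in> \<int>"
  and full: "full_lattice L"
  using lattice by (auto simp: even_lattice_def)

lemmas B_simps = bilinear_ladd[OF bil] bilinear_radd[OF bil] bilinear_lneg[OF bil]
  bilinear_rneg[OF bil] bilinear_lsub[OF bil] bilinear_rsub[OF bil]

lemma L_0: "0 \<in> L" and L_add: "x \<in> L \<Longrightarrow> y \<in> L \<Longrightarrow> x + y \<in> L" and L_minus: "x \<in> L \<Longrightarrow> - x \<in> L"
proof -
  obtain b where L: "L = {(\<Sum>v\<in>b. of_int (c v) *\<^sub>R v) | c :: 'v \<Rightarrow> int. True}"
    using full by (auto simp: full_lattice_def)
  show "0 \<in> L" unfolding L by (auto intro!: exI[of _ "\<lambda>_. 0"])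
  show "- x \<in> L" if x: "x \<in> L"
  proof -
    obtain c :: "'v \<Rightarrow> int" where "x = (\<Sum>v\<in>b. of_int (c v) *\<^sub>R v)"
      using x unfolding L by auto
    hence "- x = (\<Sum>v\<in>b. of_int (- c v) *\<^sub>R v)" by (simp add: sum_negf)
    thus ?thesis unfolding L mem_Collect_eq by (intro exI[of _ "\<lambda>v. - c v"]) simp
  qed
  show "x + y \<in> L" if xy: "x \<in> L" "y \<in> L"
  proof -
    obtain c d :: "'v \<Rightarrow> int" where "x = (\<Sum>v\<in>b. of_int (c v) *\<^sub>R v)" "y = (\<Sum>v\<in>b. of_int (d v) *\<^sub>R v)"
      using xy unfolding L by auto
    hence "x + y = (\<Sum>v\<in>b. of_int (c v + d v) *\<^sub>R v)" by (simp add: sum.distrib scaleR_add_left)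
    thus ?thesis unfolding L mem_Collect_eq by (intro exI[of _ "\<lambda>v. c v + d v"]) simp
  qed
qed

lemma L_diff: "x \<in> L \<Longrightarrow> y \<in> L \<Longrightarrow> x - y \<in> L"
  using L_add[OF _ L_minus] by simp

lemma quad_add: "quad B (x + y) = quad B x + quad B y + B x y"
  using sym[of x y] by (simp add: quad_def B_simps field_simps)

lemma disc_group_simps:
  "D = {{h + a | h. h \<in> L} | a. a \<in> dual_lattice B L}"
  "\<one>\<^bsub>disc_group B L\<^esub> = L"
  "\<gamma> \<otimes>\<^bsub>disc_group B L\<^esub> \<delta> = {x + y | x y. x \<in> \<gamma> \<and> y \<in> \<delta>}"
  by (auto simp: disc_group_def FactGroup_def RCOSETS_def r_coset_def set_mult_def)

lemma D_rep:
  assumes "\<gamma> \<in> D" "x \<in> \<gamma>"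
  shows "x \<in> dual_lattice B L" "\<gamma> = {h + x | h. h \<in> L}"
proof -
  obtain a where a: "a \<in> dual_lattice B L" "\<gamma> = {h + a | h. h \<in> L}"
    using assms by (auto simp: disc_group_simps)
  then obtain h where h: "h \<in> L" "x = h + a" using assms by auto
  \<comment> \<open>Polarization makes the pairing integral on L, so membership in the dual lattice
    passes from one representative to the whole coset.\<close>
  have int: "B h y \<in> \<int>" if "y \<in> L" for y
  proof -
    have "B h y = quad B (h + y) - quad B h - quad B y" by (simp add: quad_add)
    moreover have "h + y \<in> L" using that h by (simp add: L_add)
    ultimately show ?thesis using that h by (simp only:) (intro Ints_diff quad_int)
  qed
  show "x \<in> dual_lattice B L"
    using a h int by (auto simp: dual_lattice_def B_simps)
  show "\<gamma> = {h + x | h. h \<in> L}"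
  proof (intro equalityI subsetI)
    fix y assume "y \<in> \<gamma>"
    then obtain h' where h': "h' \<in> L" "y = h' + a" using a by auto
    hence "y = (h' - h) + x" using h by simp
    thus "y \<in> {h + x | h. h \<in> L}" using h' h L_diff by blast
  next
    fix y assume "y \<in> {h + x | h. h \<in> L}"
    then obtain h' where h': "h' \<in> L" "y = h' + x" by auto
    hence "y = (h' + h) + a" using h by simp
    thus "y \<in> \<gamma>" using a(2) h' h L_add by blast
  qed
qed

lemma D_nonempty: "\<gamma> \<in> D \<Longrightarrow> \<exists>x. x \<in> \<gamma>"
  using L_0 by (auto simp: disc_group_simps)

lemma D_diff: "\<gamma> \<in> D \<Longrightarrow> x \<in> \<gamma> \<Longrightarrow> y \<in> \<gamma> \<Longrightarrow> y - x \<in> L"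
proof -
  assume "\<gamma> \<in> D" "x \<in> \<gamma>" "y \<in> \<gamma>"
  then obtain h where "h \<in> L" "y = h + x" using D_rep(2) by blast
  thus "y - x \<in> L" by simp
qed

text \<open>Moving x in the dual lattice by h in L changes q by q(h) + (x, h), a sum of two
  integers. This justifies the arbitrary representative in \<open>disc_quad\<close>.\<close>

lemma disc_quad_eq:
  assumes "\<gamma> \<in> D" "x \<in> \<gamma>"
  shows "Q \<gamma> - quad B x \<in> \<int>"
proof -
  define y where "y = (SOME y. y \<in> \<gamma>)"
  have y: "y \<in> \<gamma>" unfolding y_def by (rule someI[of _ x]) fact
  hence l: "y - x \<in> L" and "x \<in> dual_lattice B L" using assms D_diff D_rep(1) by auto
  hence "B x (y - x) \<in> \<int>" "quad B (y - x) \<in> \<int>" using quad_int by (auto simp: dual_lattice_def)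
  moreover have "quad B y - quad B x = quad B (y - x) + B x (y - x)"
    using quad_add[of x "y - x"] by simp
  ultimately show ?thesis by (simp add: disc_quad_def y_def)
qed

lemma disc_pair_eq:
  assumes "\<gamma> \<in> D" "x \<in> \<gamma>" "\<delta> \<in> D" "z \<in> \<delta>"
  shows "P \<gamma> \<delta> - B x z \<in> \<int>"
proof -
  define y where "y = (SOME y. y \<in> \<gamma>)"
  define w where "w = (SOME y. y \<in> \<delta>)"
  have y: "y \<in> \<gamma>" unfolding y_def by (rule someI[of _ x]) fact
  have w: "w \<in> \<delta>" unfolding w_def by (rule someI[of _ z]) fact
  have "y - x \<in> L" "w - z \<in> L" "x \<in> dual_lattice B L" "w \<in> dual_lattice B L"
    using assms y w D_diff D_rep(1) by auto
  hence "B w (y - x) \<in> \<int>" "B x (w - z) \<in> \<int>" by (auto simp: dual_lattice_def)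
  moreover have "B y w - B x z = B w (y - x) + B x (w - z)"
    by (simp add: B_simps sym[of w])
  ultimately show ?thesis by (simp add: disc_pair_def y_def w_def)
qed

lemma disc_quad_mult:
  assumes "\<gamma> \<in> D" "\<delta> \<in> D" "\<gamma> \<otimes>\<^bsub>disc_group B L\<^esub> \<delta> \<in> D"
  shows "[P \<gamma> \<delta> = Q (\<gamma> \<otimes>\<^bsub>disc_group B L\<^esub> \<delta>) - Q \<gamma> - Q \<delta>] (rmod 1)"
proof -
  obtain x y where xy: "x \<in> \<gamma>" "y \<in> \<delta>" using assms D_nonempty by blast
  hence "x + y \<in> \<gamma> \<otimes>\<^bsub>disc_group B L\<^esub> \<delta>" by (auto simp: disc_group_simps)
  hence 1: "Q (\<gamma> \<otimes>\<^bsub>disc_group B L\<^esub> \<delta>) - quad B (x + y) \<in> \<int>"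
    using assms disc_quad_eq by blast
  have 2: "Q \<gamma> - quad B x \<in> \<int>" "Q \<delta> - quad B y \<in> \<int>" "P \<gamma> \<delta> - B x y \<in> \<int>"
    using assms xy disc_quad_eq disc_pair_eq by auto
  have "(P \<gamma> \<delta> - B x y) - (Q (\<gamma> \<otimes>\<^bsub>disc_group B L\<^esub> \<delta>) - quad B (x + y))
      + (Q \<gamma> - quad B x) + (Q \<delta> - quad B y) \<in> \<int>"
    by (rule Ints_add[OF Ints_add[OF Ints_diff[OF 2(3) 1] 2(1)] 2(2)])
  thus ?thesis by (simp add: rcong_1_iff quad_add algebra_simps)
qed

section \<open>Coordinates on the discriminant group by residues modulo p\<close>

definition \<phi> :: "int \<Rightarrow> 'v set" where
  "\<phi> = (SOME \<phi>. \<phi> \<in> iso (integer_mod_group p) (disc_group B L) \<and>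
     (\<forall>x \<in> carrier (integer_mod_group p).
        [disc_quad B (\<phi> x) = of_int (\<alpha> * x\<^sup>2) / real p] (rmod 1)))"

lemma \<phi>_iso: "\<phi> \<in> iso (integer_mod_group p) (disc_group B L)"
  and \<phi>_quad: "x \<in> {0..<int p} \<Longrightarrow> [Q (\<phi> x) = of_int (\<alpha> * x\<^sup>2) / real p] (rmod 1)"
proof -
  have "\<exists>\<phi>. \<phi> \<in> iso (integer_mod_group p) (disc_group B L) \<and>
     (\<forall>x \<in> carrier (integer_mod_group p).
        [disc_quad B (\<phi> x) = of_int (\<alpha> * x\<^sup>2) / real p] (rmod 1))"
    using \<alpha>(2) unfolding disc_form_equiv_def by blast
  from someI_ex[OF this]
  have *: "\<phi> \<in> iso (integer_mod_group p) (disc_group B L) \<and>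
     (\<forall>x \<in> carrier (integer_mod_group p).
        [disc_quad B (\<phi> x) = of_int (\<alpha> * x\<^sup>2) / real p] (rmod 1))"
    unfolding \<phi>_def[symmetric] .
  show "\<phi> \<in> iso (integer_mod_group p) (disc_group B L)" using * by blast
  show "[Q (\<phi> x) = of_int (\<alpha> * x\<^sup>2) / real p] (rmod 1)" if "x \<in> {0..<int p}"
    using * that p_pos by (simp add: carrier_integer_mod_group del: p_pos)
qed

text \<open>The isomorphism \<open>\<phi>\<close> is used on {0..<p} only. The periodic extension to
  all integers allows indices such as x + y or -x without explicit reduction.\<close>

definition \<psi> :: "int \<Rightarrow> 'v set" where "\<psi> x = \<phi> (x mod int p)"

lemma \<phi>_bij: "bij_betw \<phi> {0..<int p} D"
  using \<phi>_iso p_pos by (simp add: iso_def carrier_integer_mod_group del: p_pos)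

lemma \<psi>_cong: "[x = y] (mod int p) \<Longrightarrow> \<psi> x = \<psi> y"
  by (simp add: \<psi>_def cong_def)

lemma mod_p_in [simp]: "x mod int p \<in> {0..<int p}"
  using p_pos by (simp del: p_pos)

lemma \<psi>_in_D [simp]: "\<psi> x \<in> D"
  using \<phi>_bij mod_p_in[of x] unfolding \<psi>_def bij_betw_def by blast

lemma \<psi>_eq_iff: "\<psi> x = \<psi> y \<longleftrightarrow> [x = y] (mod int p)"
  unfolding \<psi>_def cong_def
  by (rule inj_on_eq_iff[OF bij_betw_imp_inj_on[OF \<phi>_bij] mod_p_in mod_p_in])

lemma \<psi>_surj: "\<gamma> \<in> D \<Longrightarrow> \<exists>x. \<gamma> = \<psi> x"
proof -
  assume "\<gamma> \<in> D"
  then obtain x where "x \<in> {0..<int p}" "\<gamma> = \<phi> x" using \<phi>_bij unfolding bij_betw_def by blast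
  hence "\<gamma> = \<psi> x" by (simp add: \<psi>_def)
  thus ?thesis ..
qed

lemma sum_D: "(\<Sum>\<gamma>\<in>D. f \<gamma>) = (\<Sum>x\<in>{0..<int p}. f (\<psi> x))"
proof -
  have "(\<Sum>x\<in>{0..<int p}. f (\<psi> x)) = (\<Sum>x\<in>{0..<int p}. f (\<phi> x))"
    by (intro sum.cong) (auto simp: \<psi>_def)
  thus ?thesis using sum.reindex_bij_betw[OF \<phi>_bij, of f] by simp
qed

lemma finite_D [simp]: "finite D"
  using \<phi>_bij bij_betw_finite by blast

lemma \<psi>_add: "\<psi> (x + y) = \<psi> x \<otimes>\<^bsub>disc_group B L\<^esub> \<psi> y"
proof -
  have "\<phi> ((x mod int p) \<otimes>\<^bsub>integer_mod_group p\<^esub> (y mod int p)) = \<psi> x \<otimes>\<^bsub>disc_group B L\<^esub> \<psi> y"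
  proof -
    have h: "\<phi> \<in> hom (integer_mod_group p) (disc_group B L)" using \<phi>_iso by (simp add: iso_def)
    have c: "z mod int p \<in> carrier (integer_mod_group p)" for z
      using p_pos by (simp add: carrier_integer_mod_group del: p_pos)
    show ?thesis unfolding \<psi>_def by (rule Group.hom_mult[OF h c c])
  qed
  thus ?thesis by (simp add: \<psi>_def mod_add_eq)
qed

text \<open>Additivity makes \<open>\<psi> 0\<close> idempotent: with x it contains x + x, and the
  difference of two of its elements lies in L, so x itself does.\<close>

lemma \<psi>_0: "\<psi> 0 = L"
proof -
  obtain x where x: "x \<in> \<psi> 0" using D_nonempty[OF \<psi>_in_D] by blast
  have "\<psi> 0 = \<psi> 0 \<otimes>\<^bsub>disc_group B L\<^esub> \<psi> 0" using \<psi>_add[of 0 0] by simp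
  hence "x + x \<in> \<psi> 0" using x by (auto simp: disc_group_simps)
  hence "(x + x) - x \<in> L" using x D_diff[OF \<psi>_in_D] by blast
  hence xL: "x \<in> L" by simp
  have "\<psi> 0 = {h + x | h. h \<in> L}" using D_rep(2)[OF \<psi>_in_D x] .
  also have "\<dots> = L"
  proof (intro equalityI subsetI)
    fix y assume "y \<in> L"
    hence "y = (y - x) + x" "y - x \<in> L" using xL L_diff by auto
    thus "y \<in> {h + x | h. h \<in> L}" by blast
  qed (use xL L_add in auto)
  finally show ?thesis .
qed

lemma \<psi>_eq_L_iff: "\<psi> x = L \<longleftrightarrow> int p dvd x"
  using \<psi>_eq_iff[of x 0] by (simp add: \<psi>_0 cong_0_iff)

lemma L_in_D [simp]: "L \<in> D"
  using \<psi>_in_D[of 0] by (simp add: \<psi>_0)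

lemma quad_\<psi>: "[Q (\<psi> x) = of_int (\<alpha> * x\<^sup>2) / real p] (rmod 1)"
proof -
  have "[(x mod int p)\<^sup>2 = x\<^sup>2] (mod int p)" by (intro cong_pow) (simp add: cong_def)
  hence "[\<alpha> * (x mod int p)\<^sup>2 = \<alpha> * x\<^sup>2] (mod int p)" by (rule cong_scalar_left)
  then obtain n where n: "\<alpha> * x\<^sup>2 = \<alpha> * (x mod int p)\<^sup>2 + int p * n"
    by (auto simp: cong_iff_lin)
  have "real_of_int (\<alpha> * x\<^sup>2) / real p = of_int (\<alpha> * (x mod int p)\<^sup>2) / real p + of_int n * 1"
    unfolding n using p_pos by (simp add: field_simps del: p_pos)
  hence "[real_of_int (\<alpha> * (x mod int p)\<^sup>2) / real p = of_int (\<alpha> * x\<^sup>2) / real p] (rmod 1)"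
    unfolding rcong_altdef by blast
  thus ?thesis unfolding \<psi>_def using \<phi>_quad[OF mod_p_in] rcong_trans by blast
qed

lemma e_quad: "e (of_int m * of_real (Q (\<psi> x))) = unit_root p (m * \<alpha> * x\<^sup>2)"
  using e_rcong_of_int_mult[OF quad_\<psi>, of m x] by (simp add: unit_root_def mult.assoc)

text \<open>Polarization modulo 1, (\<gamma>, \<delta>) = q(\<gamma> + \<delta>) - q(\<gamma>) -
  q(\<delta>), leaves only the cross term of \<alpha> (x + y)^2.\<close>

lemma e_pair: "e (- of_real (P (\<psi> x) (\<psi> y))) = unit_root p (- (2 * \<alpha> * x * y))"
proof -
  have "[P (\<psi> x) (\<psi> y) = Q (\<psi> (x + y)) - Q (\<psi> x) - Q (\<psi> y)] (rmod 1)"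
    using disc_quad_mult[of "\<psi> x" "\<psi> y"] by (simp flip: \<psi>_add)
  from e_rcong_of_int_mult[OF this, of "-1"]
  have "e (- of_real (P (\<psi> x) (\<psi> y))) =
        e (of_int (-1) * of_real (Q (\<psi> (x + y))) + (of_int 1 * of_real (Q (\<psi> x)) + of_int 1 * of_real (Q (\<psi> y))))"
    by (simp add: algebra_simps)
  also have "\<dots> = unit_root p (-1 * \<alpha> * (x + y)\<^sup>2) * (unit_root p (1 * \<alpha> * x\<^sup>2) * unit_root p (1 * \<alpha> * y\<^sup>2))"
    by (simp only: e_add e_quad)
  also have "\<dots> = unit_root p (- (2 * \<alpha> * x * y))"
    by (simp only: unit_root_add[symmetric]) (simp add: power2_eq_square algebra_simps)
  finally show ?thesis .
qed

text \<open>The condition on exponents in the theorem is a congruence of reals, since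
  \<open>disc_quad\<close> is real-valued; this converts it to integers.\<close>

lemma quad_\<psi>_rcong_iff:
  "[of_int n = real p * Q (\<psi> x)] (rmod real p) \<longleftrightarrow> [n = \<alpha> * x\<^sup>2] (mod int p)"
proof -
  obtain m where m: "of_int (\<alpha> * x\<^sup>2) / real p = Q (\<psi> x) + of_int m * 1"
    using quad_\<psi>[of x] unfolding rcong_altdef by blast
  hence Q: "real p * Q (\<psi> x) = of_int (\<alpha> * x\<^sup>2 - int p * m)"
    using p_pos by (simp add: field_simps del: p_pos)
  have "[of_int n = real p * Q (\<psi> x)] (rmod real p) \<longleftrightarrow> (\<exists>l. \<alpha> * x\<^sup>2 - int p * m = n + l * int p)"
    unfolding rcong_altdef Q by (simp flip: of_int_eq_iff[where 'a = real])
  also have "\<dots> \<longleftrightarrow> [n = \<alpha> * x\<^sup>2] (mod int p)"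
  proof
    assume "\<exists>l. \<alpha> * x\<^sup>2 - int p * m = n + l * int p"
    then obtain l where "\<alpha> * x\<^sup>2 = n + int p * (l + m)" by (auto simp: algebra_simps)
    thus "[n = \<alpha> * x\<^sup>2] (mod int p)" unfolding cong_iff_lin by blast
  next
    assume "[n = \<alpha> * x\<^sup>2] (mod int p)"
    then obtain l where "\<alpha> * x\<^sup>2 = n + int p * l" by (auto simp: cong_iff_lin)
    hence "\<alpha> * x\<^sup>2 - int p * m = n + (l - m) * int p" by (simp add: algebra_simps)
    thus "\<exists>l. \<alpha> * x\<^sup>2 - int p * m = n + l * int p" by blast
  qed
  finally show ?thesis .
qed

lemma sum_dvd: "(\<Sum>x\<in>{0..<int p}. if int p dvd x then f x else 0) = f 0"
proof -
  have "(\<Sum>x\<in>{0..<int p}. if int p dvd x then f x else 0) = (\<Sum>x\<in>{0..<int p}. if x = 0 then f x else 0)"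
    using zdvd_not_zless by (intro sum.cong refl) (auto simp: order_le_less)
  thus ?thesis using p_pos by (simp del: p_pos)
qed

end

subsection \<open>The Weil representation\<close>

locale weil = prime_disc p B L \<alpha>
  for p :: nat and B :: "'v::euclidean_space \<Rightarrow> 'v \<Rightarrow> real" and L \<alpha> +
  fixes r k :: int and \<rho> :: "int^2^2 \<Rightarrow> ('v set \<Rightarrow> complex) \<Rightarrow> ('v set \<Rightarrow> complex)"
  assumes \<rho>: "weil_rep B L r \<rho>" and k: "[2 * k = r] (mod 4)"
begin

abbreviation GA :: "('v set \<Rightarrow> complex) set" where "GA \<equiv> group_alg B L"
abbreviation e0 :: "'v set \<Rightarrow> complex" where "e0 \<equiv> basis_vec L"

lemma GA_notin: "v \<in> GA \<Longrightarrow> \<gamma> \<notin> D \<Longrightarrow> v \<gamma> = 0"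
  by (simp add: group_alg_def)

lemma GA_eqI:
  assumes "u \<in> GA" "v \<in> GA" "\<And>x. u (\<psi> x) = v (\<psi> x)"
  shows "u = v"
proof
  fix \<gamma> show "u \<gamma> = v \<gamma>"
  proof (cases "\<gamma> \<in> D")
    case True
    then obtain x where "\<gamma> = \<psi> x" using \<psi>_surj by blast
    thus ?thesis using assms(3) by simp
  next
    case False
    thus ?thesis using GA_notin[OF assms(1)] GA_notin[OF assms(2)] by simp
  qed
qed

lemma basis_GA [simp]: "\<gamma> \<in> D \<Longrightarrow> basis_vec \<gamma> \<in> GA"
  by (auto simp: group_alg_def basis_vec_def)

lemma zero_GA [simp]: "(\<lambda>_. 0) \<in> GA"
  by (simp add: group_alg_def)

lemma cmult_GA: "u \<in> GA \<Longrightarrow> (\<lambda>\<gamma>. c * u \<gamma>) \<in> GA"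
  by (simp add: group_alg_def)

lemma sum_GA: "(\<And>i. i \<in> I \<Longrightarrow> v i \<in> GA) \<Longrightarrow> (\<lambda>\<eta>. \<Sum>i\<in>I. c i * v i \<eta>) \<in> GA"
  by (simp add: group_alg_def)

lemma action: "group_action SL2Z GA \<rho>"
  and \<rho>_linear: "M \<in> carrier SL2Z \<Longrightarrow> u \<in> GA \<Longrightarrow> v \<in> GA \<Longrightarrow>
        \<rho> M (\<lambda>\<gamma>. c * u \<gamma> + v \<gamma>) = (\<lambda>\<gamma>. c * \<rho> M u \<gamma> + \<rho> M v \<gamma>)"
  and \<rho>_unitary: "M \<in> carrier SL2Z \<Longrightarrow> u \<in> GA \<Longrightarrow> v \<in> GA \<Longrightarrow>
        (\<Sum>\<gamma>\<in>D. \<rho> M u \<gamma> * cnj (\<rho> M v \<gamma>)) = (\<Sum>\<gamma>\<in>D. u \<gamma> * cnj (v \<gamma>))"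
  and \<rho>_T_basis: "\<gamma> \<in> D \<Longrightarrow> \<rho> T_mat (basis_vec \<gamma>) = (\<lambda>\<eta>. e (of_real (Q \<gamma>)) * basis_vec \<gamma> \<eta>)"
  and \<rho>_S_basis: "\<gamma> \<in> D \<Longrightarrow> \<rho> S_mat (basis_vec \<gamma>) =
        (\<lambda>\<eta>. \<i> powi (- (r div 2)) / of_real (sqrt (real p)) *
          (\<Sum>\<delta>\<in>D. e (- of_real (P \<gamma> \<delta>)) * basis_vec \<delta> \<eta>))"
  using \<rho> unfolding weil_rep_def ord by blast+

lemma \<rho>_in_GA: "M \<in> carrier SL2Z \<Longrightarrow> v \<in> GA \<Longrightarrow> \<rho> M v \<in> GA"
  using group_action.element_image[OF action] by blast

lemma \<rho>_mult: "M \<in> carrier SL2Z \<Longrightarrow> N \<in> carrier SL2Z \<Longrightarrow> v \<in> GA \<Longrightarrow> \<rho> (M ** N) v = \<rho> M (\<rho> N v)"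
  using group_action.composition_rule[OF action, of v M N] by simp

lemma \<rho>_one: "v \<in> GA \<Longrightarrow> \<rho> (mat 1) v = v"
  using fun_cong[OF group_action.id_eq_one[OF action], of v] by simp

lemma \<rho>_inverse:
  assumes "M \<in> carrier SL2Z" "v \<in> GA"
  shows "inv_into GA (\<rho> M) v = \<rho> (adj2 M) v"
proof -
  have "\<rho> M (\<rho> (adj2 M) v) = v"
    using assms by (simp add: adj2_inverse \<rho>_one flip: \<rho>_mult)
  moreover have "inj_on (\<rho> M) GA"
    using group_action.inj_prop[OF action] assms by blast
  ultimately show ?thesis
    using assms by (intro inv_into_f_eq \<rho>_in_GA) auto
qed

lemma \<rho>_zero: "M \<in> carrier SL2Z \<Longrightarrow> \<rho> M (\<lambda>_. 0) = (\<lambda>_. 0)"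
  using \<rho>_linear[of M "\<lambda>_. 0" "\<lambda>_. 0" 1] by (simp add: fun_eq_iff)

lemma \<rho>_sum:
  assumes M: "M \<in> carrier SL2Z" and v: "\<And>i. i \<in> I \<Longrightarrow> v i \<in> GA"
  shows "\<rho> M (\<lambda>\<eta>. \<Sum>i\<in>I. c i * v i \<eta>) = (\<lambda>\<eta>. \<Sum>i\<in>I. c i * \<rho> M (v i) \<eta>)"
  using v
proof (induction I rule: infinite_finite_induct)
  case (insert i I)
  have "(\<lambda>\<eta>. \<Sum>i\<in>insert i I. c i * v i \<eta>) = (\<lambda>\<eta>. c i * v i \<eta> + (\<Sum>i\<in>I. c i * v i \<eta>))"
    using insert.hyps by simp
  thus ?case using insert M by (simp add: \<rho>_linear sum_GA)
qed (use M in \<open>auto simp: \<rho>_zero\<close>)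

lemma GA_expand:
  assumes "v \<in> GA"
  shows "v = (\<lambda>\<eta>. \<Sum>\<gamma>\<in>D. v \<gamma> * basis_vec \<gamma> \<eta>)"
proof
  fix \<eta>
  have "(\<Sum>\<gamma>\<in>D. v \<gamma> * basis_vec \<gamma> \<eta>) = (\<Sum>\<gamma>\<in>D. if \<gamma> = \<eta> then v \<gamma> else 0)"
    by (intro sum.cong) (auto simp: basis_vec_def)
  thus "v \<eta> = (\<Sum>\<gamma>\<in>D. v \<gamma> * basis_vec \<gamma> \<eta>)"
    using GA_notin[OF assms] by simp
qed

section \<open>The generators in coordinates and the arithmetic of the constant
  \<open>C\<close>\<close>

definition C :: complex where "C = \<i> powi (- (r div 2)) / of_real (sqrt (real p))"

lemma C_nonzero [simp]: "C \<noteq> 0"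
  by (simp add: C_def)

lemma \<rho>_T: "v \<in> GA \<Longrightarrow> \<rho> T_mat v (\<psi> x) = unit_root p (\<alpha> * x\<^sup>2) * v (\<psi> x)"
proof -
  assume v: "v \<in> GA"
  have "\<rho> T_mat v = \<rho> T_mat (\<lambda>\<eta>. \<Sum>\<gamma>\<in>D. v \<gamma> * basis_vec \<gamma> \<eta>)"
    using GA_expand[OF v] by simp
  also have "\<dots> = (\<lambda>\<eta>. \<Sum>\<gamma>\<in>D. v \<gamma> * (e (of_real (Q \<gamma>)) * basis_vec \<gamma> \<eta>))"
    by (subst \<rho>_sum) (auto simp: \<rho>_T_basis)
  finally have "\<rho> T_mat v (\<psi> x) = (\<Sum>\<gamma>\<in>D. v \<gamma> * (e (of_real (Q \<gamma>)) * basis_vec \<gamma> (\<psi> x)))" by simp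
  also have "\<dots> = (\<Sum>\<gamma>\<in>D. if \<gamma> = \<psi> x then v \<gamma> * e (of_real (Q \<gamma>)) else 0)"
    by (intro sum.cong) (auto simp: basis_vec_def)
  also have "\<dots> = v (\<psi> x) * e (of_real (Q (\<psi> x)))" by simp
  finally show ?thesis using e_quad[of 1 x] by simp
qed

lemma \<rho>_S: "v \<in> GA \<Longrightarrow>
  \<rho> S_mat v (\<psi> y) = C * (\<Sum>x\<in>{0..<int p}. unit_root p (- (2 * \<alpha> * x * y)) * v (\<psi> x))"
proof -
  assume v: "v \<in> GA"
  have "\<rho> S_mat v = \<rho> S_mat (\<lambda>\<eta>. \<Sum>\<gamma>\<in>D. v \<gamma> * basis_vec \<gamma> \<eta>)"
    using GA_expand[OF v] by simp
  also have "\<dots> = (\<lambda>\<eta>. \<Sum>\<gamma>\<in>D. v \<gamma> * (C * (\<Sum>\<delta>\<in>D. e (- of_real (P \<gamma> \<delta>)) * basis_vec \<delta> \<eta>)))"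
    by (subst \<rho>_sum) (auto simp: \<rho>_S_basis C_def)
  finally have "\<rho> S_mat v (\<psi> y) = (\<Sum>\<gamma>\<in>D. v \<gamma> * (C * (\<Sum>\<delta>\<in>D. e (- of_real (P \<gamma> \<delta>)) * basis_vec \<delta> (\<psi> y))))"
    by simp
  also have "\<dots> = (\<Sum>\<gamma>\<in>D. v \<gamma> * (C * (\<Sum>\<delta>\<in>D. if \<delta> = \<psi> y then e (- of_real (P \<gamma> \<delta>)) else 0)))"
    by (intro sum.cong arg_cong2[of _ _ _ _ "(*)"] refl) (auto simp: basis_vec_def)
  also have "\<dots> = (\<Sum>\<gamma>\<in>D. v \<gamma> * (C * e (- of_real (P \<gamma> (\<psi> y)))))"
    by simp
  finally show ?thesis
    by (simp add: sum_D e_pair sum_distrib_left mult_ac)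
qed

lemma e0_\<psi>: "e0 (\<psi> x) = (if int p dvd x then 1 else 0)"
  by (simp add: basis_vec_def \<psi>_eq_L_iff)

text \<open>Completing the square: modulo p the exponent is t \<alpha> (x - t' y)^2 - t' \<alpha>
  y^2, and the shift of x does not change the full residue sum.\<close>

lemma sum_unit_root_quadratic:
  assumes t: "[t * t' = 1] (mod int p)"
  shows "(\<Sum>x\<in>{0..<int p}. unit_root p (- (2 * \<alpha> * x * y)) * unit_root p (t * \<alpha> * x\<^sup>2)) =
         unit_root p (- (t' * \<alpha> * y\<^sup>2)) * gauss_sum (t * \<alpha>)"
proof -
  have *: "unit_root p (- (2 * \<alpha> * x * y)) * unit_root p (t * \<alpha> * x\<^sup>2) =
        unit_root p (- (t' * \<alpha> * y\<^sup>2)) * unit_root p (t * \<alpha> * (1 * x + (- (t' * y)))\<^sup>2)" for x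
  proof -
    have "[(t * t') * (- 2 * \<alpha> * x * y + t' * \<alpha> * y\<^sup>2) = 1 * (- 2 * \<alpha> * x * y + t' * \<alpha> * y\<^sup>2)] (mod int p)"
      using t by (rule cong_scalar_right)
    hence "[t * \<alpha> * x\<^sup>2 - t' * \<alpha> * y\<^sup>2 + (t * t') * (- 2 * \<alpha> * x * y + t' * \<alpha> * y\<^sup>2) =
           t * \<alpha> * x\<^sup>2 - t' * \<alpha> * y\<^sup>2 + 1 * (- 2 * \<alpha> * x * y + t' * \<alpha> * y\<^sup>2)] (mod int p)"
      by (rule cong_add[OF cong_refl])
    moreover have "t * \<alpha> * x\<^sup>2 - t' * \<alpha> * y\<^sup>2 + (t * t') * (- 2 * \<alpha> * x * y + t' * \<alpha> * y\<^sup>2) =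
        - (t' * \<alpha> * y\<^sup>2) + t * \<alpha> * (1 * x + (- (t' * y)))\<^sup>2"
      by (simp add: power2_eq_square algebra_simps)
    moreover have "t * \<alpha> * x\<^sup>2 - t' * \<alpha> * y\<^sup>2 + 1 * (- 2 * \<alpha> * x * y + t' * \<alpha> * y\<^sup>2) =
        - (2 * \<alpha> * x * y) + t * \<alpha> * x\<^sup>2"
      by (simp add: algebra_simps)
    ultimately have "[- (t' * \<alpha> * y\<^sup>2) + t * \<alpha> * (1 * x + (- (t' * y)))\<^sup>2 =
        - (2 * \<alpha> * x * y) + t * \<alpha> * x\<^sup>2] (mod int p)"
      by (simp only:)
    from unit_root_cong[OF p_pos this] show ?thesis by (simp only: unit_root_add)
  qed
  have "(\<Sum>x\<in>{0..<int p}. unit_root p (t * \<alpha> * (1 * x + (- (t' * y)))\<^sup>2)) = gauss_sum (t * \<alpha>)"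
    unfolding gauss_sum_def
  proof (rule sum_residues_affine)
    show "periodic_mod p (\<lambda>x. unit_root p (t * \<alpha> * x\<^sup>2))"
      unfolding periodic_mod_def
      by (intro allI impI unit_root_cong[OF p_pos] cong_scalar_left cong_pow)
  qed auto
  thus ?thesis unfolding * by (simp only: sum_distrib_left[symmetric])
qed

text \<open>Milgram's formula, obtained from \<open>T S T S T = S\<close> applied to the zero basis vector.\<close>

lemma C_gauss_sum: "C * gauss_sum \<alpha> = 1"
proof -
  define v1 where "v1 = \<rho> S_mat e0"
  define v2 where "v2 = \<rho> T_mat v1"
  define v3 where "v3 = \<rho> S_mat v2"
  have GA: "v1 \<in> GA" "v2 \<in> GA" "v3 \<in> GA"
    by (simp_all add: v1_def v2_def v3_def \<rho>_in_GA)
  have Te0: "\<rho> T_mat e0 = e0"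
    by (rule GA_eqI) (auto simp: \<rho>_in_GA \<rho>_T e0_\<psi> unit_root_eq_1_iff power2_eq_square)
  have "T_mat ** (S_mat ** (T_mat ** (S_mat ** T_mat))) = S_mat"
    by (simp add: mat2_eq_iff mat2_mult_nth)
  moreover have "\<rho> (T_mat ** (S_mat ** (T_mat ** (S_mat ** T_mat)))) e0 = \<rho> T_mat v3"
    by (simp add: v1_def v2_def v3_def \<rho>_mult \<rho>_in_GA SL2Z_mult Te0)
  ultimately have eq: "\<rho> T_mat v3 = v1" by (simp add: v1_def)
  have v1: "v1 (\<psi> y) = C" for y
    unfolding v1_def \<rho>_S[OF basis_GA[OF L_in_D]] e0_\<psi>
    using sum_dvd[of "\<lambda>x. unit_root p (- (2 * \<alpha> * x * y))"] by (simp add: if_distrib cong: if_cong)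
  have v2: "v2 (\<psi> y) = C * unit_root p (1 * \<alpha> * y\<^sup>2)" for y
    unfolding v2_def \<rho>_T[OF GA(1)] v1 by simp
  have v3: "v3 (\<psi> 0) = C * C * gauss_sum \<alpha>"
  proof -
    have "v3 (\<psi> 0) = C * (\<Sum>x\<in>{0..<int p}. C * (unit_root p (- (2 * \<alpha> * x * 0)) * unit_root p (1 * \<alpha> * x\<^sup>2)))"
      unfolding v3_def \<rho>_S[OF GA(2)] v2 by (simp add: mult_ac)
    also have "\<dots> = C * C * (unit_root p (- (1 * \<alpha> * 0\<^sup>2)) * gauss_sum (1 * \<alpha>))"
      unfolding sum_distrib_left[symmetric] by (subst sum_unit_root_quadratic[where t' = 1]) auto
    finally show ?thesis by simp
  qed
  have "\<rho> T_mat v3 (\<psi> 0) = C * C * gauss_sum \<alpha>"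
    unfolding \<rho>_T[OF GA(3)] v3 by simp
  thus ?thesis using v1[of 0] by (simp add: eq)
qed

lemma gauss_sum_\<alpha>: "\<not> int p dvd t \<Longrightarrow> C * gauss_sum (t * \<alpha>) = of_int (chi t)"
  using gauss_sum_mult[OF _ \<alpha>(1), of t] C_gauss_sum by simp

lemma minus_one_not_dvd: "\<not> int p dvd -1" "\<not> int p dvd 1"
  using p3 by auto

text \<open>Conjugating \<open>C * gauss_sum \<alpha> = 1\<close> replaces the Gauss sum by that of
  -\<alpha>, which is chi(-1) times the original one.\<close>

lemma cnj_C: "cnj C = of_int (chi (-1)) * C"
proof -
  have "cnj C * (of_int (chi (-1)) * gauss_sum \<alpha>) = 1"
    using arg_cong[OF C_gauss_sum, of cnj] gauss_sum_mult[OF minus_one_not_dvd(1) \<alpha>(1)]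
    by (simp add: cnj_gauss_sum)
  hence "cnj C * (of_int (chi (-1)) * gauss_sum \<alpha>) = C * gauss_sum \<alpha>"
    using C_gauss_sum by simp
  moreover have "gauss_sum \<alpha> \<noteq> 0" using C_gauss_sum by auto
  ultimately have "cnj C * of_int (chi (-1)) = C" by (simp add: algebra_simps)
  hence "cnj C * of_int (chi (-1) * chi (-1)) = C * of_int (chi (-1))" by (simp add: mult.assoc[symmetric])
  thus ?thesis using chi_square[OF minus_one_not_dvd(1)] by (simp add: mult.commute)
qed

lemma i_powi: "\<i> powi (r div 2) = of_int (chi (-1)) * C * of_real (sqrt (real p))"
proof -
  have "cnj (\<i> powi (- (r div 2))) = \<i> powi (r div 2)"
    by (simp add: power_int_minus flip: power_int_inverse)
  hence "cnj C * of_real (sqrt (real p)) = \<i> powi (r div 2)"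
    by (simp add: C_def)
  thus ?thesis by (simp add: cnj_C)
qed

text \<open>Writing i^(-r/2) and its inverse i^(r/2) through \<open>C\<close> turns their product 1
  into this identity. By \<open>C_gauss_sum\<close> it is the classical value chi(-1) p of the
  squared Gauss sum.\<close>

lemma C_square: "C * C * of_nat p = of_int (chi (-1))"
proof -
  have s: "of_real (sqrt (real p)) * of_real (sqrt (real p)) = (of_nat p :: complex)"
    by (simp flip: of_real_mult)
  have "\<i> powi (- (r div 2)) * \<i> powi (r div 2) = 1"
    by (simp flip: power_int_add)
  moreover have "\<i> powi (- (r div 2)) = C * of_real (sqrt (real p))" by (simp add: C_def)
  ultimately have "(C * of_real (sqrt (real p))) * (of_int (chi (-1)) * C * of_real (sqrt (real p))) = 1"
    by (simp only: i_powi)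
  hence "of_int (chi (-1)) * (C * C * (of_real (sqrt (real p)) * of_real (sqrt (real p)))) = 1"
    by (simp only: mult_ac)
  hence "of_int (chi (-1)) * (C * C * of_nat p) = 1" by (simp only: s)
  hence "of_int (chi (-1) * chi (-1)) * (C * C * of_nat p) = of_int (chi (-1))"
    by (simp add: mult.assoc)
  thus ?thesis using chi_square[OF minus_one_not_dvd(1)] by simp
qed

text \<open>The compatibility of weight and signature: k and r/2 have the same parity, so (-1)^k is
  the square of i^(r/2), which the value of \<open>C * C\<close> identifies as chi(-1).\<close>

lemma minus_one_powi: "(-1) powi k = complex_of_int (chi (-1))"
proof -
  define s where "s = r div 2"
  \<comment> \<open>The congruence makes r even, so that \<open>r div 2\<close> is exact.\<close>
  obtain m where "r = 2 * k + 4 * m"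
    using k by (auto simp: cong_iff_lin)
  hence "s = k + 2 * m" by (simp add: s_def)
  hence ks: "even (k - s)" by simp
  have "(-1::complex) powi k = (-1) powi s"
    using ks by (auto simp: power_int_minus_one_minus power_int_minus_left)
  also have "\<dots> = (\<i> * \<i>) powi s" by simp
  also have "\<dots> = \<i> powi s * \<i> powi s" by (rule power_int_mult_distrib)
  also have "\<dots> = (of_int (chi (-1) * chi (-1))) * (C * C * (of_real (sqrt (real p)) * of_real (sqrt (real p))))"
    using i_powi by (simp add: s_def mult_ac)
  also have "\<dots> = of_int (chi (-1))"
    using C_square chi_square[OF minus_one_not_dvd(1)] by (simp flip: of_real_mult)
  finally show ?thesis .
qed

text \<open>The candidate for \<rho>(M) e0, where (a, c) is the first column of M. The second column
  cannot matter: T fixes e0, and right multiplication by T adds the first column to the second. The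
  exponent uses the inverse of c modulo p, which is harmless because p times the quadratic form is
  integral.\<close>

definition w :: "int \<Rightarrow> int \<Rightarrow> 'v set \<Rightarrow> complex" where
  "w a c = (\<lambda>\<eta>. if \<eta> \<notin> D then 0
     else if int p dvd c then of_int (chi a) * e0 \<eta>
     else C * of_int (chi c) * e (of_int (a * modular_inverse (int p) c) * of_real (Q \<eta>)))"

lemma w_GA [simp]: "w a c \<in> GA"
  by (simp add: w_def group_alg_def)

lemma w_\<psi>: "w a c (\<psi> x) =
  (if int p dvd c then if int p dvd x then of_int (chi a) else 0
   else C * of_int (chi c) * unit_root p (a * modular_inverse (int p) c * \<alpha> * x\<^sup>2))"
  unfolding w_def e_quad by (simp add: e0_\<psi>)

lemma modular_inverse_p:
  "\<not> int p dvd c \<Longrightarrow> [c * modular_inverse (int p) c = 1] (mod int p)"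
  by (rule cong_modular_inverse1) (simp add: coprime_p_iff)

lemma modular_inverse_p_not_dvd: "\<not> int p dvd c \<Longrightarrow> \<not> int p dvd modular_inverse (int p) c"
  using coprime_modular_inverse coprime_p_iff by blast

lemma \<rho>_T_w: "\<rho> T_mat (w a c) = w (a + c) c"
proof (rule GA_eqI)
  fix x
  show "\<rho> T_mat (w a c) (\<psi> x) = w (a + c) c (\<psi> x)"
  proof (cases "int p dvd c")
    case True
    hence "chi (a + c) = chi a" by (intro chi_cong) (simp add: cong_iff_dvd_diff)
    thus ?thesis using True
      by (simp add: \<rho>_T w_\<psi> unit_root_eq_1_iff power2_eq_square)
  next
    case False
    have "[(c * modular_inverse (int p) c) * (\<alpha> * x\<^sup>2) = 1 * (\<alpha> * x\<^sup>2)] (mod int p)"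
      using modular_inverse_p[OF False] by (rule cong_scalar_right)
    hence "unit_root p (\<alpha> * x\<^sup>2) = unit_root p ((c * modular_inverse (int p) c) * (\<alpha> * x\<^sup>2))"
      using unit_root_cong[OF p_pos] by (simp only: mult_1)
    moreover have "(a + c) * modular_inverse (int p) c * \<alpha> * x\<^sup>2 =
        (c * modular_inverse (int p) c) * (\<alpha> * x\<^sup>2) + a * modular_inverse (int p) c * \<alpha> * x\<^sup>2"
      by (simp add: algebra_simps)
    ultimately show ?thesis using False
      by (simp only: \<rho>_T[OF w_GA] w_\<psi> unit_root_add if_False) (simp only: mult_ac)
  qed
qed (auto simp: \<rho>_in_GA)

text \<open>A finite Fourier transform in three cases. If p | c, a multiple of e0 becomes a constant
  vector. If p | a, a constant vector becomes a multiple of e0, with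
  \<open>C * C * p = chi (-1)\<close> supplying the sign. Otherwise a quadratic exponential becomes
  another one, with a Gauss sum as factor.\<close>

lemma \<rho>_S_w:
  assumes "\<not> (int p dvd a \<and> int p dvd c)"
  shows "\<rho> S_mat (w a c) = w (- c) a"
proof (rule GA_eqI)
  fix y
  show "\<rho> S_mat (w a c) (\<psi> y) = w (- c) a (\<psi> y)"
  proof (cases "int p dvd c")
    case True
    have "\<rho> S_mat (w a c) (\<psi> y) = C * (\<Sum>x\<in>{0..<int p}. if int p dvd x then unit_root p (- (2 * \<alpha> * x * y)) * of_int (chi a) else 0)"
      by (simp only: \<rho>_S[OF w_GA] w_\<psi> True if_True) (auto intro!: sum.cong)
    also have "\<dots> = C * of_int (chi a)" by (simp add: sum_dvd)
    also have "\<dots> = w (- c) a (\<psi> y)"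
      using True assms by (simp add: w_\<psi> unit_root_eq_1_iff)
    finally show ?thesis .
  next
    case c: False
    define c' where "c' = modular_inverse (int p) c"
    have cc: "[c * c' = 1] (mod int p)" using modular_inverse_p[OF c] by (simp add: c'_def)
    have S: "\<rho> S_mat (w a c) (\<psi> y) = C * (\<Sum>x\<in>{0..<int p}. unit_root p (- (2 * \<alpha> * x * y)) *
        (C * of_int (chi c) * unit_root p (a * c' * \<alpha> * x\<^sup>2)))"
      using c by (simp add: \<rho>_S w_\<psi> c'_def)
    also have "\<dots> = C * C * of_int (chi c) *
        (\<Sum>x\<in>{0..<int p}. unit_root p (- (2 * \<alpha> * x * y)) * unit_root p (a * c' * \<alpha> * x\<^sup>2))"
      by (simp add: sum_distrib_left mult_ac)
    finally have S: "\<rho> S_mat (w a c) (\<psi> y) = C * C * of_int (chi c) *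
        (\<Sum>x\<in>{0..<int p}. unit_root p (- (2 * \<alpha> * x * y)) * unit_root p (a * c' * \<alpha> * x\<^sup>2))" .
    show ?thesis
    proof (cases "int p dvd a")
      case True
      have "(\<Sum>x\<in>{0..<int p}. unit_root p (- (2 * \<alpha> * x * y)) * unit_root p (a * c' * \<alpha> * x\<^sup>2)) =
            (\<Sum>x\<in>{0..<int p}. unit_root p ((- 2 * \<alpha> * y) * x))"
      proof (rule sum.cong[OF refl])
        fix x
        have "unit_root p (a * c' * \<alpha> * x\<^sup>2) = 1" using True by (simp add: unit_root_eq_1_iff)
        thus "unit_root p (- (2 * \<alpha> * x * y)) * unit_root p (a * c' * \<alpha> * x\<^sup>2) = unit_root p ((- 2 * \<alpha> * y) * x)"
          by (simp add: mult_ac)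
      qed
      also have "\<dots> = (if int p dvd (- 2 * \<alpha> * y) then of_nat p else 0)"
        by (rule unit_root_sum) simp
      also have "int p dvd (- 2 * \<alpha> * y) \<longleftrightarrow> int p dvd y"
      proof -
        have "- 2 * \<alpha> * y = - (2 * \<alpha> * y)" by simp
        thus ?thesis using not_dvd_double[OF \<alpha>(1)] dvd_mult_iff by (metis dvd_minus_iff)
      qed
      finally have "\<rho> S_mat (w a c) (\<psi> y) = (if int p dvd y then of_int (chi c) * (C * C * of_nat p) else 0)"
        unfolding S by simp
      moreover have "of_int (chi (- c)) = of_int (chi c) * (complex_of_int (chi (-1)))"
        using chi_mult[of c "-1"] by simp
      ultimately show ?thesis using True by (simp only: C_square w_\<psi> if_True)
    next
      case a: False
      define a' where "a' = modular_inverse (int p) a"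
      have aa: "[a * a' = 1] (mod int p)" using modular_inverse_p[OF a] by (simp add: a'_def)
      have "[a * a' * (c * c') = 1 * 1] (mod int p)" by (rule cong_mult[OF aa cc])
      hence t: "[a * c' * (c * a') = 1] (mod int p)" by (simp add: mult_ac)
      have nd: "\<not> int p dvd a * c'"
        using a modular_inverse_p_not_dvd[OF c] by (simp add: dvd_mult_iff c'_def)
      have "\<rho> S_mat (w a c) (\<psi> y) = C * of_int (chi c) * unit_root p (- (c * a' * \<alpha> * y\<^sup>2)) *
           (C * gauss_sum (a * c' * \<alpha>))"
        unfolding S sum_unit_root_quadratic[OF t] by (simp add: mult_ac)
      also have "\<dots> = C * unit_root p (- (c * a' * \<alpha> * y\<^sup>2)) * of_int (chi a * (chi c * chi c))"
        unfolding gauss_sum_\<alpha>[OF nd] chi_mult chi_inverse[OF cc] by (simp add: mult_ac)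
      also have "\<dots> = w (- c) a (\<psi> y)"
        using a chi_square[OF c] by (simp add: w_\<psi> a'_def mult_ac)
      finally show ?thesis .
    qed
  qed
qed (auto simp: \<rho>_in_GA)

lemma \<rho>_e0:
  assumes "M \<in> carrier SL2Z"
  shows "\<rho> M e0 = w (M $ 1 $ 1) (M $ 2 $ 1)"
  using assms
proof (induction M rule: SL2Z_induct)
  case one
  have "e0 = w 1 0" by (rule GA_eqI) (auto simp: w_\<psi> e0_\<psi>)
  thus ?case by (simp add: \<rho>_one)
next
  case (S M)
  have "\<not> (int p dvd M $ 1 $ 1 \<and> int p dvd M $ 2 $ 1)"
  proof
    assume "int p dvd M $ 1 $ 1 \<and> int p dvd M $ 2 $ 1"
    hence "int p dvd M $ 1 $ 1 * M $ 2 $ 2 - M $ 1 $ 2 * M $ 2 $ 1" by simp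
    thus False using S(1) minus_one_not_dvd by (simp add: SL2Z_iff)
  qed
  thus ?case using S by (simp add: \<rho>_mult \<rho>_S_w mat2_mult_nth)
next
  case (T M)
  thus ?case by (simp add: \<rho>_mult \<rho>_T_w mat2_mult_nth)
qed

lemma w_scale:
  assumes "\<not> int p dvd d"
  shows "w (d * a) (d * c) = (\<lambda>\<eta>. of_int (chi d) * w a c \<eta>)"
proof (rule GA_eqI)
  fix x
  show "w (d * a) (d * c) (\<psi> x) = of_int (chi d) * w a c (\<psi> x)"
  proof (cases "int p dvd c")
    case False
    hence nd: "\<not> int p dvd d * c" using assms by (simp add: dvd_mult_iff)
    have "[(c * modular_inverse (int p) c) * (d * modular_inverse (int p) (d * c)) =
           1 * (d * modular_inverse (int p) (d * c))] (mod int p)"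
      using modular_inverse_p[OF False] by (rule cong_scalar_right)
    moreover have "[(d * c * modular_inverse (int p) (d * c)) * modular_inverse (int p) c =
           1 * modular_inverse (int p) c] (mod int p)"
      using modular_inverse_p[OF nd] by (rule cong_scalar_right)
    ultimately have "[d * modular_inverse (int p) (d * c) = modular_inverse (int p) c] (mod int p)"
      by (simp add: mult_ac) (meson cong_sym cong_trans)
    hence "[a * \<alpha> * x\<^sup>2 * (d * modular_inverse (int p) (d * c)) = a * \<alpha> * x\<^sup>2 * modular_inverse (int p) c] (mod int p)"
      by (rule cong_scalar_left)
    from unit_root_cong[OF p_pos this]
    have "unit_root p (d * a * modular_inverse (int p) (d * c) * \<alpha> * x\<^sup>2) =
          unit_root p (a * modular_inverse (int p) c * \<alpha> * x\<^sup>2)"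
      by (simp add: mult_ac)
    thus ?thesis using False nd by (simp add: w_\<psi> chi_mult)
  qed (simp add: w_\<psi> chi_mult)
qed (auto simp: cmult_GA)

lemma w_cong:
  assumes "[a = a'] (mod int p)" "[c = c'] (mod int p)"
  shows "w a c = w a' c'"
proof (rule GA_eqI)
  fix x
  have 1: "int p dvd c \<longleftrightarrow> int p dvd c'" "chi c = chi c'" "chi a = chi a'"
    using assms cong_dvd_iff by (auto intro!: chi_cong)
  show "w a c (\<psi> x) = w a' c' (\<psi> x)"
  proof (cases "int p dvd c")
    case False
    hence nd: "\<not> int p dvd c'" using 1 by simp
    have "modular_inverse (int p) c = modular_inverse (int p) c'"
    proof (rule modular_inverse_int_eqI)
      show "modular_inverse (int p) c' \<in> {0..<int p}"
        using p_pos by (simp add: modular_inverse_int_nonneg modular_inverse_int_less del: p_pos)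
      have "[c * modular_inverse (int p) c' = c' * modular_inverse (int p) c'] (mod int p)"
        using assms(2) by (rule cong_scalar_right)
      thus "[c * modular_inverse (int p) c' = 1] (mod int p)"
        using modular_inverse_p[OF nd] cong_trans by blast
    qed
    moreover have "unit_root p (a * m * \<alpha> * x\<^sup>2) = unit_root p (a' * m * \<alpha> * x\<^sup>2)" for m
      by (intro unit_root_cong[OF p_pos] cong_scalar_right assms)
    ultimately show ?thesis using False nd 1 by (simp add: w_\<psi>)
  qed (use 1 in \<open>simp add: w_\<psi>\<close>)
qed auto

lemma \<rho>_adj2_e0: "M \<in> carrier SL2Z \<Longrightarrow> \<rho> (adj2 M) e0 = w (M $ 2 $ 2) (- (M $ 2 $ 1))"
  by (simp add: \<rho>_e0)

text \<open>The first column of M^-1 is, up to sign, the bottom row of M in reverse order. Modulo p,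
  left multiplication by G scales that row by the lower right entry of G, and \<open>w\<close> turns
  the scaling into a factor chi.\<close>

lemma \<rho>_adj2_Gamma0:
  assumes "G \<in> Gamma0 p" "M \<in> carrier SL2Z"
  shows "\<rho> (adj2 (G ** M)) e0 = (\<lambda>\<eta>. of_int (chi (G $ 2 $ 2)) * \<rho> (adj2 M) e0 \<eta>)"
proof -
  have G: "G \<in> carrier SL2Z" "int p dvd G $ 2 $ 1" using assms by (auto simp: Gamma0_iff)
  have "\<rho> (adj2 (G ** M)) e0 = w ((G ** M) $ 2 $ 2) (- ((G ** M) $ 2 $ 1))"
    using assms G by (intro \<rho>_adj2_e0 SL2Z_mult)
  also have "\<dots> = w (G $ 2 $ 2 * M $ 2 $ 2) (G $ 2 $ 2 * (- (M $ 2 $ 1)))"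
    using G by (intro w_cong) (auto simp: cong_iff_dvd_diff mat2_mult_nth)
  also have "\<dots> = (\<lambda>\<eta>. of_int (chi (G $ 2 $ 2)) * w (M $ 2 $ 2) (- (M $ 2 $ 1)) \<eta>)"
    using Gamma0_not_dvd[OF G] by (intro w_scale)
  finally show ?thesis using assms by (simp add: \<rho>_adj2_e0)
qed

lemma \<rho>_Gamma0:
  assumes "G \<in> Gamma0 p"
  shows "\<rho> G e0 = (\<lambda>\<eta>. of_int (chi (G $ 2 $ 2)) * e0 \<eta>)"
proof -
  have G: "G \<in> carrier SL2Z" "int p dvd G $ 2 $ 1" using assms by (auto simp: Gamma0_iff)
  have "chi (G $ 2 $ 2) = chi (G $ 1 $ 1)"
    using chi_inverse[OF Gamma0_not_dvd(1)[OF G]] .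
  thus ?thesis using G GA_notin[OF basis_GA[OF L_in_D]] by (auto simp: \<rho>_e0[OF G(1)] w_def fun_eq_iff)
qed

text \<open>Pairing with e0 reads off the zero component, so the eigenvector e0 controls this
  component of every image vector, and no other basis vector has to be transformed
  explicitly.\<close>

lemma \<rho>_Gamma0_coeff:
  assumes "G \<in> Gamma0 p" "v \<in> GA"
  shows "\<rho> G v L = of_int (chi (G $ 2 $ 2)) * v L"
proof -
  have G: "G \<in> carrier SL2Z" "int p dvd G $ 2 $ 1" using assms by (auto simp: Gamma0_iff)
  have "(\<Sum>\<gamma>\<in>D. \<rho> G v \<gamma> * cnj (\<rho> G e0 \<gamma>)) = (\<Sum>\<gamma>\<in>D. v \<gamma> * cnj (e0 \<gamma>))"
    using G assms by (intro \<rho>_unitary) auto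
  moreover have "(\<Sum>\<gamma>\<in>D. u \<gamma> * cnj (e0 \<gamma>)) = u L" for u
  proof -
    have "(\<Sum>\<gamma>\<in>D. u \<gamma> * cnj (e0 \<gamma>)) = (\<Sum>\<gamma>\<in>D. if \<gamma> = L then u \<gamma> else 0)"
      by (intro sum.cong) (auto simp: basis_vec_def)
    thus ?thesis by simp
  qed
  moreover have "(\<Sum>\<gamma>\<in>D. \<rho> G v \<gamma> * cnj (\<rho> G e0 \<gamma>)) =
      of_int (chi (G $ 2 $ 2)) * (\<Sum>\<gamma>\<in>D. \<rho> G v \<gamma> * cnj (e0 \<gamma>))"
    by (simp add: \<rho>_Gamma0[OF assms(1)] sum_distrib_left mult_ac)
  ultimately have "of_int (chi (G $ 2 $ 2)) * \<rho> G v L = v L" by simp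
  hence "of_int (chi (G $ 2 $ 2) * chi (G $ 2 $ 2)) * \<rho> G v L = of_int (chi (G $ 2 $ 2)) * v L"
    by (simp add: mult.assoc)
  thus ?thesis using chi_square Gamma0_not_dvd(3)[OF G] by simp
qed

text \<open>Two finite Fourier transforms compose to the reflection x -> -x times p, and
  \<open>C * C\<close> normalises this p to chi(-1).\<close>

lemma \<rho>_S_S:
  assumes "v \<in> GA"
  shows "\<rho> (S_mat ** S_mat) v (\<psi> y) = of_int (chi (-1)) * v (\<psi> (- y))"
proof -
  have "\<rho> (S_mat ** S_mat) v (\<psi> y) = C * (\<Sum>z\<in>{0..<int p}. unit_root p (- (2 * \<alpha> * z * y)) *
       (C * (\<Sum>x\<in>{0..<int p}. unit_root p (- (2 * \<alpha> * x * z)) * v (\<psi> x))))"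
    using assms by (simp add: \<rho>_mult \<rho>_S \<rho>_in_GA)
  also have "\<dots> = C * C * (\<Sum>z\<in>{0..<int p}. \<Sum>x\<in>{0..<int p}.
      (unit_root p (- (2 * \<alpha> * x * z)) * unit_root p (- (2 * \<alpha> * z * y))) * v (\<psi> x))"
    by (simp add: sum_distrib_left mult_ac)
  also have "\<dots> = C * C * (\<Sum>z\<in>{0..<int p}. \<Sum>x\<in>{0..<int p}. unit_root p ((- 2 * \<alpha> * (x + y)) * z) * v (\<psi> x))"
    by (simp only: unit_root_add[symmetric]) (simp add: algebra_simps)
  also have "\<dots> = C * C * (\<Sum>x\<in>{0..<int p}. (\<Sum>z\<in>{0..<int p}. unit_root p ((- 2 * \<alpha> * (x + y)) * z)) * v (\<psi> x))"
    by (subst sum.swap) (simp add: sum_distrib_right)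
  also have "\<dots> = C * C * (\<Sum>x\<in>{0..<int p}. (if int p dvd x + y then of_nat p else 0) * v (\<psi> (- y)))"
  proof -
    have "(\<Sum>z\<in>{0..<int p}. unit_root p ((- 2 * \<alpha> * (x + y)) * z)) * v (\<psi> x) =
        (if int p dvd x + y then of_nat p else 0) * v (\<psi> (- y))" for x
    proof -
      have "- 2 * \<alpha> * (x + y) = - (2 * \<alpha> * (x + y))" by simp
      hence iff: "int p dvd - 2 * \<alpha> * (x + y) \<longleftrightarrow> int p dvd x + y"
        using not_dvd_double[OF \<alpha>(1)] dvd_mult_iff by (metis dvd_minus_iff)
      have "\<psi> x = \<psi> (- y)" if "int p dvd x + y"
        using that by (intro \<psi>_cong) (simp add: cong_iff_dvd_diff)
      thus "(\<Sum>z\<in>{0..<int p}. unit_root p ((- 2 * \<alpha> * (x + y)) * z)) * v (\<psi> x) =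
          (if int p dvd x + y then of_nat p else 0) * v (\<psi> (- y))"
        unfolding unit_root_sum[OF p_pos] iff by (cases "int p dvd x + y") simp_all
    qed
    thus ?thesis by (simp only:)
  qed
  also have "\<dots> = C * C * (\<Sum>x\<in>{0..<int p}. if int p dvd 1 * x + y then of_nat p * v (\<psi> (- y)) else 0)"
    by (intro arg_cong2[of _ _ _ _ "(*)"] refl sum.cong) auto
  also have "(\<Sum>x\<in>{0..<int p}. if int p dvd 1 * x + y then of_nat p * v (\<psi> (- y)) else 0) =
      (\<Sum>x\<in>{0..<int p}. if int p dvd x then of_nat p * v (\<psi> (- y)) else 0)"
    by (rule sum_residues_affine) (auto simp: periodic_mod_def cong_dvd_iff)
  also have "\<dots> = of_nat p * v (\<psi> (- y))" by (rule sum_dvd)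
  also have "C * C * (of_nat p * v (\<psi> (- y))) = (C * C * of_nat p) * v (\<psi> (- y))" by simp
  finally show ?thesis by (simp only: C_square)
qed

end

subsection \<open>Expansions in powers of \<open>q\<close>\<close>

lemma has_sum_sum:
  fixes f :: "'i \<Rightarrow> 'a \<Rightarrow> 'b::topological_comm_monoid_add"
  assumes "\<And>i. i \<in> I \<Longrightarrow> (f i has_sum s i) A"
  shows "((\<lambda>x. \<Sum>i\<in>I. f i x) has_sum (\<Sum>i\<in>I. s i)) A"
  using assms
  by (induction I rule: infinite_finite_induct) (auto intro: has_sum_add)

section \<open>The root-of-unity filter and uniqueness of coefficients\<close>

lemma q_expansionD:
  "q_expansion f a \<Longrightarrow> \<tau> \<in> \<H> \<Longrightarrow> ((\<lambda>n. a n * e (of_int n * \<tau>)) has_sum f \<tau>) UNIV"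
  by (simp add: q_expansion_def)

lemma \<H>_scale: "\<tau> \<in> \<H> \<Longrightarrow> c > 0 \<Longrightarrow> of_real c * \<tau> \<in> \<H>"
  by (simp add: \<H>_iff)

lemma \<H>_shift: "\<tau> \<in> \<H> \<Longrightarrow> p > 0 \<Longrightarrow> (\<tau> + of_int j) / of_nat p \<in> \<H>"
  using \<H>_scale[of "\<tau> + of_int j" "1 / real p"] by (simp add: \<H>_iff)

text \<open>Averaging over translates against a character keeps one residue class of exponents. The
  modulus is any positive number because the uniqueness proof lets it grow.\<close>

lemma q_section:
  assumes a: "q_expansion f a" and \<tau>: "\<tau> \<in> \<H>" and p: "p > 0"
  shows "((\<lambda>n. if [n = m] (mod int p) then a n * e (of_int n * \<tau> / of_nat p) else 0) has_sum
          (1 / of_nat p * (\<Sum>j\<in>{0..<int p}. f ((\<tau> + of_int j) / of_nat p) * unit_root p (- m * j)))) UNIV"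
proof -
  have 1: "((\<lambda>n. 1 / of_nat p * (\<Sum>j\<in>{0..<int p}.
         a n * e (of_int n * ((\<tau> + of_int j) / of_nat p)) * unit_root p (- m * j))) has_sum
          (1 / of_nat p * (\<Sum>j\<in>{0..<int p}. f ((\<tau> + of_int j) / of_nat p) * unit_root p (- m * j)))) UNIV"
    by (intro has_sum_cmult_right has_sum_sum has_sum_cmult_left q_expansionD[OF a] \<H>_shift \<tau> p)
  have "1 / of_nat p * (\<Sum>j\<in>{0..<int p}.
         a n * e (of_int n * ((\<tau> + of_int j) / of_nat p)) * unit_root p (- m * j)) =
        (if [n = m] (mod int p) then a n * e (of_int n * \<tau> / of_nat p) else 0)" for n
  proof -
    have "a n * e (of_int n * ((\<tau> + of_int j) / of_nat p)) * unit_root p (- m * j) =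
          a n * e (of_int n * \<tau> / of_nat p) * unit_root p ((n - m) * j)" for j
    proof -
      have "of_int n * ((\<tau> + of_int j) / of_nat p) =
            of_int n * \<tau> / of_nat p + of_int (n * j) / of_nat p"
        by (simp add: field_simps add_divide_distrib)
      hence "e (of_int n * ((\<tau> + of_int j) / of_nat p)) = e (of_int n * \<tau> / of_nat p) * unit_root p (n * j)"
        by (simp only: e_add unit_root_def)
      moreover have "unit_root p ((n - m) * j) = unit_root p (n * j) * unit_root p (- m * j)"
        by (simp add: algebra_simps flip: unit_root_add)
      ultimately show ?thesis by simp
    qed
    hence "1 / of_nat p * (\<Sum>j\<in>{0..<int p}.
         a n * e (of_int n * ((\<tau> + of_int j) / of_nat p)) * unit_root p (- m * j)) =
        1 / of_nat p * (a n * e (of_int n * \<tau> / of_nat p) * (\<Sum>j\<in>{0..<int p}. unit_root p ((n - m) * j)))"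
      by (simp only: sum_distrib_left)
    thus ?thesis using p by (simp add: unit_root_sum cong_iff_dvd_diff)
  qed
  thus ?thesis using 1 by (simp only:)
qed

text \<open>
  Averaging over translates by \<open>N\<close>-th parts of the period isolates the coefficients in a residue
  class modulo \<open>N\<close>; as \<open>N\<close> grows, all but the \<open>m\<close>-th leave any given finite set.
\<close>

lemma q_expansion_zero:
  assumes "q_expansion (\<lambda>_. 0) a"
  shows "a m = 0"
proof -
  define b where "b = (\<lambda>n. a n * e (of_int n * \<i>))"
  have b: "(b has_sum 0) UNIV"
    using q_expansionD[OF assms, of \<i>] by (simp add: b_def \<H>_iff)
  hence "(\<lambda>n. norm (b n)) summable_on UNIV"
    by (rule summable_on_iff_abs_summable_on_complex[THEN iffD1, OF has_sum_imp_summable])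
  then obtain T where T: "((\<lambda>n. norm (b n)) has_sum T) UNIV"
    by (auto simp: summable_on_def)
  have "norm (b m) \<le> \<epsilon>" if \<epsilon>: "\<epsilon> > 0" for \<epsilon>
  proof -
    obtain F where F: "finite F" "dist (\<Sum>n\<in>F. norm (b n)) T \<le> \<epsilon>"
      using has_sum_finite_approximation[OF T \<epsilon>] by auto
    \<comment> \<open>Enlarging the finite set only shrinks the tail; m has to be inside to be the
      index that survives the filter.\<close>
    define F' where "F' = insert m F"
    have F': "finite F'" "m \<in> F'" using F by (auto simp: F'_def)
    have "(\<Sum>n\<in>F. norm (b n)) \<le> (\<Sum>n\<in>F'. norm (b n))"
      using F' by (intro sum_mono2) (auto simp: F'_def)
    hence T': "T - (\<Sum>n\<in>F'. norm (b n)) \<le> \<epsilon>"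
      using F(2) by (simp add: dist_real_def)
    \<comment> \<open>Exceeds every |n - m| with n in \<open>F'\<close>, so m is the only index of
      \<open>F'\<close> in its class modulo N.\<close>
    define N where "N = nat (1 + (\<Sum>n\<in>F'. \<bar>n - m\<bar>))"
    have N: "N > 0" by (simp add: N_def sum_nonneg add_pos_nonneg)
    have small: "\<bar>n - m\<bar> < int N" if "n \<in> F'" for n
    proof -
      have "\<bar>n - m\<bar> \<le> (\<Sum>n\<in>F'. \<bar>n - m\<bar>)"
        using that F' by (intro member_le_sum) auto
      thus ?thesis by (simp add: N_def)
    qed
    define g where "g = (\<lambda>n. if [n = m] (mod int N) then b n else 0)"
    \<comment> \<open>The filter divides the argument by N. Starting from N i, it therefore selects
      from the same terms b n for every N.\<close>
    have i: "of_nat N * \<i> \<in> \<H>" using N by (simp add: \<H>_iff)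
    have eq: "of_int n * (of_nat N * \<i>) / of_nat N = of_int n * \<i>" for n
      using N by simp
    have g: "(g has_sum 0) UNIV"
      using q_section[OF assms i N, of m] unfolding eq g_def b_def by simp
    have gF: "(\<Sum>n\<in>F'. g n) = b m"
    proof -
      have "g n = (if n = m then b n else 0)" if "n \<in> F'" for n
      proof -
        have "int N dvd n - m \<longleftrightarrow> n - m = 0"
          using small[OF that] by (metis dvd_0_right zdvd_not_zless zero_less_abs_iff dvd_abs_iff)
        thus ?thesis by (auto simp: g_def cong_iff_dvd_diff)
      qed
      thus ?thesis using F' by simp
    qed
    \<comment> \<open>The filtered series has sum 0 and contributes b m over \<open>F'\<close>. Its
      tail must then sum to - b m, although it is dominated by the small tail of the norms.\<close>
    have "(g has_sum (0 - (\<Sum>n\<in>F'. g n))) (UNIV - F')"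
      using F' by (intro has_sum_Diff g has_sum_finite) auto
    hence gc: "(g has_sum (- b m)) (UNIV - F')" by (simp add: gF)
    have bc: "((\<lambda>n. norm (b n)) has_sum (T - (\<Sum>n\<in>F'. norm (b n)))) (UNIV - F')"
      using F' by (intro has_sum_Diff T has_sum_finite) auto
    have ga: "(\<lambda>n. norm (g n)) summable_on (UNIV - F')"
      by (rule summable_on_iff_abs_summable_on_complex[THEN iffD1, OF has_sum_imp_summable[OF gc]])
    then obtain U where U: "((\<lambda>n. norm (g n)) has_sum U) (UNIV - F')" by (auto simp: summable_on_def)
    have "norm (- b m) \<le> U" using norm_has_sum_bound[OF U gc] .
    also have "U \<le> T - (\<Sum>n\<in>F'. norm (b n))"
      by (rule has_sum_mono[OF U bc]) (simp add: g_def)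
    finally show ?thesis using T' by simp
  qed
  hence "norm (b m) = 0" by (metis field_le_epsilon add_0 norm_le_zero_iff norm_eq_zero)
  thus ?thesis by (simp add: b_def)
qed

lemma q_expansion_unique:
  assumes "q_expansion f a" "q_expansion f b"
  shows "a = b"
proof
  fix m
  have "q_expansion (\<lambda>_. 0) (\<lambda>n. a n + (- 1) * b n)"
    unfolding q_expansion_def
  proof
    fix \<tau> assume \<tau>: "\<tau> \<in> \<H>"
    have "((\<lambda>n. a n * e (of_int n * \<tau>) + (- 1) * (b n * e (of_int n * \<tau>))) has_sum (f \<tau> + (- 1) * f \<tau>)) UNIV"
      by (intro has_sum_add has_sum_cmult_right q_expansionD[OF _ \<tau>] assms)
    thus "((\<lambda>n. (a n + (- 1) * b n) * e (of_int n * \<tau>)) has_sum 0) UNIV"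
      by (simp add: algebra_simps)
  qed
  from q_expansion_zero[OF this, of m] show "a m = b m" by simp
qed

lemma A_spaceD:
  assumes "f \<in> A_space k p"
  shows "\<tau> \<notin> \<H> \<Longrightarrow> f \<tau> = 0" "f holomorphic_on \<H>" "mero_at_cusps k f"
    "M \<in> Gamma0 p \<Longrightarrow> slash k f (realmat M) = (\<lambda>\<tau>. of_int (Legendre (M $ 2 $ 2) (int p)) * f \<tau>)"
proof -
  show 1: "f \<tau> = 0" if "\<tau> \<notin> \<H>" for \<tau> using assms that by (auto simp: A_space_def)
  show "f holomorphic_on \<H>" "mero_at_cusps k f" using assms by (auto simp: A_space_def)
  show "slash k f (realmat M) = (\<lambda>\<tau>. of_int (Legendre (M $ 2 $ 2) (int p)) * f \<tau>)" if "M \<in> Gamma0 p"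
  proof
    fix \<tau>
    show "slash k f (realmat M) \<tau> = of_int (Legendre (M $ 2 $ 2) (int p)) * f \<tau>"
      using assms that 1[of \<tau>] by (cases "\<tau> \<in> \<H>") (auto simp: A_space_def slash_notin)
  qed
qed

text \<open>Meromorphy at infinity provides a lower bound for a possibly different expansion, in
  powers of e(\<tau>/h). Both become expansions of f(h \<tau>), where uniqueness identifies
  them.\<close>

lemma A_space_q_expansion_bounded_below:
  assumes f: "f \<in> A_space k p" and a: "q_expansion f a"
  shows "\<exists>n0. \<forall>n<n0. a n = 0"
proof -
  obtain h :: nat and n0 :: int and b where h: "h > 0" and b: "\<And>\<tau>. \<tau> \<in> \<H> \<Longrightarrow>
      ((\<lambda>n. b n * e (of_int n * \<tau> / of_nat h)) has_sum slash k f (realmat (mat 1)) \<tau>) {n0..}"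
    using A_spaceD(3)[OF f] SL2Z_one unfolding mero_at_cusps_def by blast
  define c where "c n = (if n \<ge> n0 then b n else 0)" for n
  define d where "d n = (if int h dvd n then a (n div int h) else 0)" for n
  define g where "g \<tau> = f (of_nat h * \<tau>)" for \<tau>
  have "q_expansion g c"
    unfolding q_expansion_def
  proof
    fix \<tau> assume "\<tau> \<in> \<H>"
    hence \<tau>: "of_nat h * \<tau> \<in> \<H>" using h by (simp add: \<H>_iff)
    have "((\<lambda>n. b n * e (of_int n * \<tau>)) has_sum g \<tau>) {n0..}"
      using b[OF \<tau>] h \<tau> by (simp add: slash_mat1 g_def)
    thus "((\<lambda>n. c n * e (of_int n * \<tau>)) has_sum g \<tau>) UNIV"
      by (rule has_sum_cong_neutral[THEN iffD1, rotated -1]) (auto simp: c_def)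
  qed
  moreover have "q_expansion g d"
    unfolding q_expansion_def
  proof
    fix \<tau> assume "\<tau> \<in> \<H>"
    hence \<tau>: "of_nat h * \<tau> \<in> \<H>" using h by (simp add: \<H>_iff)
    have "((\<lambda>n. (d n * e (of_int n * \<tau>))) \<circ> (\<lambda>n. int h * n) has_sum g \<tau>) UNIV"
      using q_expansionD[OF a \<tau>] h by (simp add: g_def d_def o_def mult_ac)
    moreover have "inj (\<lambda>n. int h * n)" using h by (auto simp: inj_def)
    ultimately have "((\<lambda>n. d n * e (of_int n * \<tau>)) has_sum g \<tau>) (range (\<lambda>n. int h * n))"
      by (simp add: has_sum_reindex)
    thus "((\<lambda>n. d n * e (of_int n * \<tau>)) has_sum g \<tau>) UNIV"
      by (rule has_sum_cong_neutral[THEN iffD1, rotated -1]) (auto simp: d_def)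
  qed
  ultimately have "c = d" by (rule q_expansion_unique)
  \<comment> \<open>Taking the negative absolute value makes n negative, so that multiplication by h
    keeps it below n0.\<close>
  have "a n = 0" if "n < - \<bar>n0\<bar>" for n
  proof -
    have "a n = d (int h * n)" using h by (simp add: d_def)
    also have "\<dots> = c (int h * n)" using \<open>c = d\<close> by simp
    also have "\<dots> = 0"
    proof -
      have "1 * (- n) \<le> int h * (- n)" using h that by (intro mult_right_mono) auto
      hence "int h * n \<le> n" by simp
      thus ?thesis using that by (simp add: c_def)
    qed
    finally show ?thesis .
  qed
  thus ?thesis by blast
qed

lemma A_epsD:
  assumes "f \<in> A_eps_space k p \<epsilon>"
  shows "f \<in> A_space k p" "q_expansion f a \<Longrightarrow> Legendre n (int p) = - \<epsilon> \<Longrightarrow> a n = 0"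
    "\<exists>a. q_expansion f a"
  using assms q_expansion_unique unfolding A_eps_space_def by blast+

subsection \<open>Lifting scalar-valued forms\<close>

context weil
begin

lemma det_W: "det (W_mat p) = real p"
  by (simp add: det_2)

lemma det_W_pos [simp]: "det (W_mat p) > 0"
  using p_pos by (simp add: det_W del: p_pos)

lemma det_realmat_pos: "M \<in> carrier SL2Z \<Longrightarrow> det (realmat M) > 0"
  by (simp add: det_realmat SL2Z_det)

lemma slash_SL2Z:
  "M \<in> carrier SL2Z \<Longrightarrow> \<tau> \<in> \<H> \<Longrightarrow>
    slash k f (realmat M) \<tau> = autf (realmat M) \<tau> powi (- k) * f (mob (realmat M) \<tau>)"
  by (simp add: slash_def det_realmat SL2Z_det)

lemma slash_mob:
  assumes "M \<in> carrier SL2Z" "\<tau> \<in> \<H>"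
  shows "f (mob (realmat M) \<tau>) = autf (realmat M) \<tau> powi k * slash k f (realmat M) \<tau>"
  using autf_nonzero[OF det_realmat_pos[OF assms(1)] assms(2)]
  by (simp add: slash_SL2Z[OF assms] power_int_minus)

text \<open>W_p normalises the group and exchanges the diagonal entries. Their product is 1 modulo
  p, so chi does not see the exchange.\<close>

lemma Gamma0_W_conj:
  assumes G: "G \<in> Gamma0 p"
  obtains G' where "G' \<in> Gamma0 p" "W_mat p ** realmat G = realmat G' ** W_mat p"
    "chi (G' $ 2 $ 2) = chi (G $ 2 $ 2)"
proof -
  have G1: "G \<in> carrier SL2Z" "int p dvd G $ 2 $ 1" using G by (auto simp: Gamma0_iff)
  then obtain c where c: "G $ 2 $ 1 = int p * c" by auto
  define G' where "G' = mat2 (G $ 2 $ 2) (- c) (- (int p * G $ 1 $ 2)) (G $ 1 $ 1)"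
  have "G' \<in> Gamma0 p"
    using G1(1) c by (simp add: Gamma0_iff SL2Z_iff G'_def algebra_simps)
  moreover have "W_mat p ** realmat G = realmat G' ** W_mat p"
    by (simp add: mat2_eq_iff mat2_mult_nth G'_def c)
  moreover have "chi (G' $ 2 $ 2) = chi (G $ 2 $ 2)"
    using chi_inverse[OF Gamma0_not_dvd(1)[OF G1]] by (simp add: G'_def)
  ultimately show ?thesis using that by blast
qed

lemma slash_W_Gamma0:
  assumes f: "\<And>G. G \<in> Gamma0 p \<Longrightarrow> slash k f (realmat G) = (\<lambda>\<tau>. of_int (chi (G $ 2 $ 2)) * f \<tau>)"
    and G: "G \<in> Gamma0 p"
  shows "slash k (slash k f (W_mat p)) (realmat G) = (\<lambda>\<tau>. of_int (chi (G $ 2 $ 2)) * slash k f (W_mat p) \<tau>)"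
proof -
  obtain G' where G': "G' \<in> Gamma0 p" "W_mat p ** realmat G = realmat G' ** W_mat p"
    "chi (G' $ 2 $ 2) = chi (G $ 2 $ 2)"
    using Gamma0_W_conj[OF G] .
  have det: "det (realmat G) > 0" "det (realmat G') > 0"
    using G G' by (auto simp: Gamma0_iff det_realmat_pos)
  have "slash k (slash k f (W_mat p)) (realmat G) = slash k (slash k f (realmat G')) (W_mat p)"
    using det by (simp add: slash_slash G'(2))
  thus ?thesis by (simp add: f[OF G'(1)] G'(3) slash_cmult)
qed

section \<open>Normalising constants and the components of the lift\<close>

definition lift_const :: complex where
  "lift_const = \<i> powi (r div 2) * of_real (real p powr (of_int k / 2 - 1 / 2))"

lemma lift_const: "lift_const = of_int (chi (-1)) * C * of_real (real p powr (of_int k / 2))"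
proof -
  have "sqrt (real p) * real p powr (of_int k / 2 - 1 / 2) = real p powr (of_int k / 2)"
    using p_pos by (simp add: powr_half_sqrt[symmetric] powr_add[symmetric] del: p_pos)
  hence "complex_of_real (sqrt (real p)) * of_real (real p powr (of_int k / 2 - 1 / 2)) = of_real (real p powr (of_int k / 2))"
    by (simp flip: of_real_mult)
  thus ?thesis by (simp add: lift_const_def i_powi mult.assoc)
qed

lemma p_powr_mult: "of_real (real p powr (of_int k / 2)) * of_real (real p powr (of_int k / 2)) = (of_nat p :: complex) powi k"
proof -
  have "real p powr (of_int k / 2) * real p powr (of_int k / 2) = real p powi k"
    using p_pos by (simp add: powr_add[symmetric] powr_real_of_int' del: p_pos)
  thus ?thesis by (metis of_real_mult of_real_power_int of_real_of_nat_eq)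
qed

lemma minus_p_powi: "(- of_nat p :: complex) powi (- k) = of_int (chi (-1)) * of_nat p powi (- k)"
proof -
  have "(- of_nat p :: complex) powi (- k) = (-1) powi (- k) * of_nat p powi (- k)"
    by (simp flip: power_int_mult_distrib)
  also have "(-1 :: complex) powi (- k) = inverse (of_int (chi (-1)))"
    by (simp add: power_int_minus minus_one_powi)
  also have "\<dots> = of_int (chi (-1))"
    using chi_values[of "-1"] by auto
  finally show ?thesis .
qed

lemma chi_C_C: "of_int (chi (-1)) * C * C = 1 / of_nat p"
proof -
  have "(of_int (chi (-1)) * C * C) * of_nat p = of_int (chi (-1)) * (C * C * of_nat p)" by simp
  also have "\<dots> = of_int (chi (-1) * chi (-1))" by (simp only: C_square of_int_mult)
  also have "\<dots> = 1" using chi_square[OF minus_one_not_dvd(1)] by simp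
  finally show ?thesis using p_pos by (simp add: field_simps del: p_pos)
qed

text \<open>W_p S T^j is minus the upper triangular matrix with rows (1, j) and (0, p). The constant
  i^(r/2) p^(k/2 - 1/2) is what makes everything except \<open>C\<close> cancel: the powers of p
  against the automorphy factor, and chi(-1) against (-1)^k.\<close>

lemma slash_W_ST:
  assumes "\<tau> \<in> \<H>"
  shows "lift_const * slash k (slash k f (W_mat p)) (realmat (ST_mat j)) \<tau> = C * f ((\<tau> + of_int j) / of_nat p)"
proof -
  define M where "M = W_mat p ** realmat (ST_mat j)"
  have M: "M $ 1 $ 1 = -1" "M $ 1 $ 2 = - of_int j" "M $ 2 $ 1 = 0" "M $ 2 $ 2 = - real p"
    by (simp_all add: M_def mat2_mult_nth ST_mat_def)
  have "mob M \<tau> = (\<tau> + of_int j) / of_nat p"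
    using p_pos by (simp add: mob_def M field_simps del: p_pos)
  moreover have "autf M \<tau> = - of_nat p" by (simp add: autf_def M)
  moreover have "det M = real p" by (simp add: det_2 M)
  ultimately have "slash k (slash k f (W_mat p)) (realmat (ST_mat j)) \<tau> =
      of_real (real p powr (of_int k / 2)) * (- of_nat p) powi (- k) * f ((\<tau> + of_int j) / of_nat p)"
    using assms by (simp add: slash_slash det_realmat_pos flip: M_def) (simp add: slash_def)
  hence "lift_const * slash k (slash k f (W_mat p)) (realmat (ST_mat j)) \<tau> =
      (of_int (chi (-1) * chi (-1))) * C * (of_real (real p powr (of_int k / 2)) * of_real (real p powr (of_int k / 2)) * of_nat p powi (- k))
      * f ((\<tau> + of_int j) / of_nat p)"
    by (simp add: lift_const minus_p_powi mult_ac)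
  also have "of_real (real p powr (of_int k / 2)) * of_real (real p powr (of_int k / 2)) * of_nat p powi (- k) = (1 :: complex)"
    unfolding p_powr_mult using p_pos by (simp add: power_int_minus del: p_pos)
  finally show ?thesis using chi_square[OF minus_one_not_dvd(1)] by simp
qed

lemma lift_map_eq:
  assumes "R \<subseteq> carrier SL2Z"
  shows "lift_map B L p r k \<rho> R f \<tau> = (\<lambda>\<gamma>. \<Sum>M\<in>R.
     (lift_const * slash k (slash k f (W_mat p)) (realmat M) \<tau>) * \<rho> (adj2 M) e0 \<gamma>)"
proof
  fix \<gamma>
  have "inv_into GA (\<rho> M) e0 \<gamma> = \<rho> (adj2 M) e0 \<gamma>" if "M \<in> R" for M
    using that assms by (subst \<rho>_inverse) auto
  thus "lift_map B L p r k \<rho> R f \<tau> \<gamma> = (\<Sum>M\<in>R.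
     (lift_const * slash k (slash k f (W_mat p)) (realmat M) \<tau>) * \<rho> (adj2 M) e0 \<gamma>)"
    by (simp add: lift_map_def disc_group_simps(2) sum_distrib_left mult_ac flip: lift_const_def)
qed

text \<open>Both factors change by chi of the same entry, and its square is 1. The additional N
  provides the same invariance for the shifted terms in the proof of modularity.\<close>

lemma lift_term_Gamma0:
  assumes f: "f \<in> A_space k p" and G: "G \<in> Gamma0 p" and M: "M \<in> carrier SL2Z" and N: "N \<in> carrier SL2Z"
  shows "slash k (slash k f (W_mat p)) (realmat (G ** M)) \<tau> * \<rho> (adj2 ((G ** M) ** N)) e0 \<gamma> =
         slash k (slash k f (W_mat p)) (realmat M) \<tau> * \<rho> (adj2 (M ** N)) e0 \<gamma>"
proof -
  have G1: "G \<in> carrier SL2Z" "int p dvd G $ 2 $ 1" using G by (auto simp: Gamma0_iff)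
  have "slash k (slash k f (W_mat p)) (realmat (G ** M)) =
        slash k (slash k (slash k f (W_mat p)) (realmat G)) (realmat M)"
    by (simp only: slash_slash[OF det_realmat_pos[OF G1(1)] det_realmat_pos[OF M]] realmat_mult)
  also have "\<dots> = (\<lambda>\<tau>. of_int (chi (G $ 2 $ 2)) * slash k (slash k f (W_mat p)) (realmat M) \<tau>)"
    by (simp add: slash_W_Gamma0[OF A_spaceD(4)[OF f] G] slash_cmult)
  finally have 1: "slash k (slash k f (W_mat p)) (realmat (G ** M)) \<tau> =
      of_int (chi (G $ 2 $ 2)) * slash k (slash k f (W_mat p)) (realmat M) \<tau>" by simp
  have 2: "\<rho> (adj2 ((G ** M) ** N)) e0 \<gamma> = of_int (chi (G $ 2 $ 2)) * \<rho> (adj2 (M ** N)) e0 \<gamma>"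
    using \<rho>_adj2_Gamma0[OF G SL2Z_mult[OF M N]] by (simp add: matrix_mul_assoc)
  have "complex_of_int (chi (G $ 2 $ 2)) * of_int (chi (G $ 2 $ 2)) = 1"
    using chi_square[OF Gamma0_not_dvd(3)[OF G1]] by (simp flip: of_int_mult)
  thus ?thesis unfolding 1 2 by (simp add: mult_ac)
qed

text \<open>The part of f(\<tau>/p) with exponents n/p, n congruent to \<alpha> x^2. It is given by
  values of f, the form in which the coset sum produces it.\<close>

definition sect :: "(complex \<Rightarrow> complex) \<Rightarrow> int \<Rightarrow> complex \<Rightarrow> complex" where
  "sect f x \<tau> = 1 / of_nat p *
     (\<Sum>j\<in>{0..<int p}. f ((\<tau> + of_int j) / of_nat p) * unit_root p (- (\<alpha> * x\<^sup>2) * j))"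

lemma sect_cong:
  assumes "[x = y] (mod int p)"
  shows "sect f x \<tau> = sect f y \<tau>"
proof -
  have "unit_root p (- (\<alpha> * x\<^sup>2) * j) = unit_root p (- (\<alpha> * y\<^sup>2) * j)" for j
    using assms by (intro unit_root_cong[OF p_pos] cong_scalar_right cong_scalar_left cong_pow
        cong_minus_minus_iff[THEN iffD2])
  thus ?thesis by (simp add: sect_def)
qed

lemma lift_map_\<psi>:
  assumes f: "f \<in> A_space k p" and R: "Gamma0_transversal p R" and \<tau>: "\<tau> \<in> \<H>"
  shows "lift_map B L p r k \<rho> R f \<tau> (\<psi> x) =
    (if int p dvd x then lift_const * slash k f (W_mat p) \<tau> else 0) + sect f x \<tau>"
proof -
  have R': "R \<subseteq> carrier SL2Z" using R by (simp add: Gamma0_transversal_iff)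
  define t where "t M = (lift_const * slash k (slash k f (W_mat p)) (realmat M) \<tau>) * \<rho> (adj2 M) e0 (\<psi> x)" for M
  have "lift_map B L p r k \<rho> R f \<tau> (\<psi> x) = sum t R"
    by (simp add: lift_map_eq[OF R'] t_def)
  also have "\<dots> = t (mat 1) + (\<Sum>j\<in>{0..<int p}. t (ST_mat j))"
  proof (rule sum_transversal_ST[OF R])
    fix G M assume "G \<in> Gamma0 p" "M \<in> carrier SL2Z"
    from lift_term_Gamma0[OF f this SL2Z_one, of \<tau> "\<psi> x"]
    show "t (G ** M) = t M" by (simp add: t_def mult.assoc)
  qed
  also have "t (mat 1) = (if int p dvd x then lift_const * slash k f (W_mat p) \<tau> else 0)"
  proof -
    have "adj2 (mat 1) = mat 1" by (simp add: mat2_eq_iff)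
    thus ?thesis using \<tau> by (simp add: t_def slash_mat1 \<rho>_one e0_\<psi>)
  qed
  also have "(\<Sum>j\<in>{0..<int p}. t (ST_mat j)) = sect f x \<tau>"
  proof -
    \<comment> \<open>\<open>w\<close> inverts the lower left entry -1 of
      \<open>adj2 (ST_mat j)\<close>; its modular inverse is a nonnegative residue, only congruent
      to -1.\<close>
    define m where "m = modular_inverse (int p) (-1)"
    have "[-1 * ((-1) * m) = -1 * 1] (mod int p)"
      unfolding m_def by (intro cong_scalar_left modular_inverse_p minus_one_not_dvd)
    hence m: "[m = -1] (mod int p)" by simp
    have "t (ST_mat j) = 1 / of_nat p * (f ((\<tau> + of_int j) / of_nat p) * unit_root p (- (\<alpha> * x\<^sup>2) * j))" for j
    proof -
      have "\<rho> (adj2 (ST_mat j)) e0 (\<psi> x) = C * of_int (chi (-1)) * unit_root p (j * m * \<alpha> * x\<^sup>2)"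
        using minus_one_not_dvd by (simp add: \<rho>_adj2_e0) (simp add: w_\<psi> ST_mat_def m_def)
      also have "unit_root p (j * m * \<alpha> * x\<^sup>2) = unit_root p (j * (-1) * \<alpha> * x\<^sup>2)"
        by (intro unit_root_cong[OF p_pos] cong_scalar_right cong_scalar_left m)
      also have "j * (-1) * \<alpha> * x\<^sup>2 = - (\<alpha> * x\<^sup>2) * j" by simp
      \<comment> \<open>One factor \<open>C\<close> comes from the slash operator and
        \<open>C * chi (-1)\<close> from the Weil representation; together they are the 1/p of the
        filter.\<close>
      finally have "t (ST_mat j) = (of_int (chi (-1)) * C * C) *
          (f ((\<tau> + of_int j) / of_nat p) * unit_root p (- (\<alpha> * x\<^sup>2) * j))"
        by (simp only: t_def slash_W_ST[OF \<tau>] mult_ac)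
      thus ?thesis by (simp only: chi_C_C)
    qed
    thus ?thesis by (simp only: sect_def sum_distrib_left)
  qed
  finally show ?thesis .
qed

lemma lift_in_GA:
  assumes "Gamma0_transversal p R"
  shows "lift_map B L p r k \<rho> R f \<tau> \<in> GA"
proof -
  have R': "R \<subseteq> carrier SL2Z" using assms by (simp add: Gamma0_transversal_iff)
  thus ?thesis unfolding lift_map_eq[OF R'] by (intro sum_GA \<rho>_in_GA) auto
qed

lemma lift_notin:
  assumes "\<tau> \<notin> \<H>"
  shows "lift_map B L p r k \<rho> R f \<tau> = (\<lambda>\<gamma>. 0)"
  by (simp add: lift_map_def slash_notin[OF assms])

text \<open>Passing to the point N \<tau> replaces M by M N in the slash factor, and right
  translation by N sends R to another transversal.\<close>

lemma lift_modular:
  assumes f: "f \<in> A_space k p" and R: "Gamma0_transversal p R" and N: "N \<in> carrier SL2Z" and \<tau>: "\<tau> \<in> \<H>"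
  shows "lift_map B L p r k \<rho> R f (mob (realmat N) \<tau>) =
    (\<lambda>\<gamma>. autf (realmat N) \<tau> powi k * \<rho> N (lift_map B L p r k \<rho> R f \<tau>) \<gamma>)"
proof
  fix \<gamma>
  have R': "R \<subseteq> carrier SL2Z" using R by (simp add: Gamma0_transversal_iff)
  define \<phi>' where "\<phi>' = slash k f (W_mat p)"
  \<comment> \<open>The vector is \<rho>(N) \<rho>(M)^-1 e0, written as the inverse of the single
    matrix M N^-1 so that invariance on cosets applies.\<close>
  define t where "t M = slash k \<phi>' (realmat M) \<tau> * \<rho> (adj2 (M ** adj2 N)) e0 \<gamma>" for M
  define j where "j = autf (realmat N) \<tau> powi k"
  have "lift_map B L p r k \<rho> R f (mob (realmat N) \<tau>) \<gamma> =
        (\<Sum>M\<in>R. lift_const * (j * t (M ** N)))"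
    unfolding lift_map_eq[OF R']
  proof (rule sum.cong[OF refl])
    fix M assume "M \<in> R"
    hence M: "M \<in> carrier SL2Z" using R' by auto
    have "slash k \<phi>' (realmat M) (mob (realmat N) \<tau>) = j * slash k \<phi>' (realmat (M ** N)) \<tau>"
      using M N by (simp add: slash_mob[OF N \<tau>] slash_slash det_realmat_pos realmat_mult j_def)
    moreover have "(M ** N) ** adj2 N = M"
      using adj2_inverse[OF N] by (simp flip: matrix_mul_assoc)
    ultimately show "lift_const * slash k (slash k f (W_mat p)) (realmat M) (mob (realmat N) \<tau>) *
        \<rho> (adj2 M) e0 \<gamma> = lift_const * (j * t (M ** N))"
      by (simp add: t_def \<phi>'_def mult.assoc)
  qed
  also have "\<dots> = lift_const * j * (\<Sum>M\<in>R. t (M ** N))"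
    by (simp add: sum_distrib_left mult.assoc)
  also have "(\<Sum>M\<in>R. t (M ** N)) = sum t ((\<lambda>M. M ** N) ` R)"
  proof (subst sum.reindex)
    show "inj_on (\<lambda>M. M ** N) R"
    proof (rule inj_onI)
      fix M M' assume "M ** N = M' ** N"
      hence "(M ** N) ** adj2 N = (M' ** N) ** adj2 N" by simp
      thus "M = M'" using adj2_inverse[OF N] by (simp flip: matrix_mul_assoc)
    qed
  qed (simp add: o_def)
  also have "\<dots> = sum t R"
  proof (rule sum_Gamma0_transversal[OF Gamma0_transversal_mult[OF R N] R])
    fix G M assume "G \<in> Gamma0 p" "M \<in> carrier SL2Z"
    thus "t (G ** M) = t M"
      unfolding t_def \<phi>'_def using N by (intro lift_term_Gamma0[OF f]) auto
  qed
  also have "lift_const * j * sum t R = j * \<rho> N (lift_map B L p r k \<rho> R f \<tau>) \<gamma>"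
  proof -
    have "\<rho> N (lift_map B L p r k \<rho> R f \<tau>) = (\<lambda>\<gamma>. \<Sum>M\<in>R.
        (lift_const * slash k \<phi>' (realmat M) \<tau>) * \<rho> N (\<rho> (adj2 M) e0) \<gamma>)"
      unfolding lift_map_eq[OF R'] \<phi>'_def using R'
      by (intro \<rho>_sum[OF N] \<rho>_in_GA) auto
    hence "\<rho> N (lift_map B L p r k \<rho> R f \<tau>) \<gamma> = (\<Sum>M\<in>R.
        (lift_const * slash k \<phi>' (realmat M) \<tau>) * \<rho> N (\<rho> (adj2 M) e0) \<gamma>)" by simp
    also have "\<dots> = (\<Sum>M\<in>R. lift_const * t M)"
    proof (rule sum.cong[OF refl])
      fix M assume "M \<in> R"
      hence M: "M \<in> carrier SL2Z" using R' by auto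
      have "\<rho> N (\<rho> (adj2 M) e0) = \<rho> (adj2 (M ** adj2 N)) e0"
        using M N by (simp add: adj2_mult flip: \<rho>_mult)
      thus "(lift_const * slash k \<phi>' (realmat M) \<tau>) * \<rho> N (\<rho> (adj2 M) e0) \<gamma> = lift_const * t M"
        by (simp add: t_def mult.assoc)
    qed
    finally have eq: "\<rho> N (lift_map B L p r k \<rho> R f \<tau>) \<gamma> = (\<Sum>M\<in>R. lift_const * t M)" .
    show ?thesis unfolding eq sum_distrib_left[symmetric] by (simp add: mult_ac)
  qed
  finally show "lift_map B L p r k \<rho> R f (mob (realmat N) \<tau>) \<gamma> =
    autf (realmat N) \<tau> powi k * \<rho> N (lift_map B L p r k \<rho> R f \<tau>) \<gamma>"
    by (simp add: j_def)
qed

section \<open>Fourier expansions of the lift\<close>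

lemma sect_has_sum:
  assumes "q_expansion f a" "\<tau> \<in> \<H>"
  shows "((\<lambda>n. if [n = \<alpha> * x\<^sup>2] (mod int p) then a n * e (of_int n * \<tau> / of_nat p) else 0) has_sum sect f x \<tau>) UNIV"
  unfolding sect_def by (rule q_section[OF assms p_pos])

lemma card_quad_eq:
  "int (card {x \<in> {0..<int p}. [n = \<alpha> * x\<^sup>2] (mod int p)}) = 1 + chi \<alpha> * chi n"
proof -
  define \<beta> where "\<beta> = modular_inverse (int p) \<alpha>"
  have \<beta>: "[\<alpha> * \<beta> = 1] (mod int p)" using modular_inverse_p[OF \<alpha>(1)] by (simp add: \<beta>_def)
  have "[n = \<alpha> * x\<^sup>2] (mod int p) \<longleftrightarrow> [x\<^sup>2 = \<beta> * n] (mod int p)" for x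
  proof
    assume "[n = \<alpha> * x\<^sup>2] (mod int p)"
    hence "[\<beta> * n = \<beta> * (\<alpha> * x\<^sup>2)] (mod int p)" by (rule cong_scalar_left)
    moreover have "[\<alpha> * \<beta> * x\<^sup>2 = 1 * x\<^sup>2] (mod int p)" using \<beta> by (rule cong_scalar_right)
    ultimately show "[x\<^sup>2 = \<beta> * n] (mod int p)"
      by (simp add: mult_ac) (meson cong_sym cong_trans)
  next
    assume "[x\<^sup>2 = \<beta> * n] (mod int p)"
    hence "[\<alpha> * x\<^sup>2 = \<alpha> * (\<beta> * n)] (mod int p)" by (rule cong_scalar_left)
    moreover have "[\<alpha> * \<beta> * n = 1 * n] (mod int p)" using \<beta> by (rule cong_scalar_right)
    ultimately show "[n = \<alpha> * x\<^sup>2] (mod int p)"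
      by (simp add: mult_ac) (meson cong_sym cong_trans)
  qed
  hence "int (card {x \<in> {0..<int p}. [n = \<alpha> * x\<^sup>2] (mod int p)}) = 1 + chi (\<beta> * n)"
    by (simp only: card_square_roots)
  thus ?thesis by (simp add: chi_mult chi_inverse[OF \<beta>])
qed

text \<open>Every exponent with a nonzero coefficient is hit by two residues x, except those
  divisible by p, which are hit by x = 0 alone; hence the correction by the zero section.\<close>

lemma sum_sect:
  assumes f: "f \<in> A_eps_space k p (chi \<alpha>)" and \<tau>: "\<tau> \<in> \<H>"
  shows "(\<Sum>x\<in>{0..<int p}. sect f x \<tau>) = 2 * f (\<tau> / of_nat p) - sect f 0 \<tau>"
proof -
  obtain a where a: "q_expansion f a" using A_epsD(3)[OF f] by blast
  define q where "q n = e (of_int n * \<tau> / of_nat p)" for n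
  have q: "((\<lambda>n. a n * q n) has_sum f (\<tau> / of_nat p)) UNIV"
    using q_expansionD[OF a, of "\<tau> / of_nat p"] \<H>_shift[OF \<tau> p_pos, of 0] by (simp add: q_def)
  have "((\<lambda>n. \<Sum>x\<in>{0..<int p}. if [n = \<alpha> * x\<^sup>2] (mod int p) then a n * q n else 0)
      has_sum (\<Sum>x\<in>{0..<int p}. sect f x \<tau>)) UNIV"
    unfolding q_def by (intro has_sum_sum sect_has_sum[OF a \<tau>])
  moreover have "(\<Sum>x\<in>{0..<int p}. if [n = \<alpha> * x\<^sup>2] (mod int p) then a n * q n else 0) =
      2 * (a n * q n) + (- 1) * (if [n = \<alpha> * 0\<^sup>2] (mod int p) then a n * q n else 0)" for n
  proof -
    have "(\<Sum>x\<in>{0..<int p}. if [n = \<alpha> * x\<^sup>2] (mod int p) then a n * q n else 0) =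
        of_int (int (card {x \<in> {0..<int p}. [n = \<alpha> * x\<^sup>2] (mod int p)})) * (a n * q n)"
      by (subst sum.inter_filter[symmetric]) auto
    also have "\<dots> = of_int (1 + chi \<alpha> * chi n) * (a n * q n)" by (simp only: card_quad_eq)
    also have "\<dots> = 2 * (a n * q n) + (- 1) * (if [n = \<alpha> * 0\<^sup>2] (mod int p) then a n * q n else 0)"
    proof (cases "int p dvd n")
      case True
      thus ?thesis by (simp add: chi_eq_0_iff cong_0_iff)
    next
      case False
      show ?thesis
      proof (cases "chi n = - chi \<alpha>")
        case True
        thus ?thesis using A_epsD(2)[OF f a] by simp
      next
        case neq: False
        hence "chi n = chi \<alpha>"
          using chi_values[of n] chi_values[of \<alpha>] False \<alpha>(1) chi_eq_0_iff by force
        thus ?thesis using False chi_square[OF \<alpha>(1)] by (simp add: cong_0_iff flip: of_int_mult)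
      qed
    qed
    finally show ?thesis .
  qed
  ultimately have "((\<lambda>n. 2 * (a n * q n) + (- 1) * (if [n = \<alpha> * 0\<^sup>2] (mod int p) then a n * q n else 0))
      has_sum (\<Sum>x\<in>{0..<int p}. sect f x \<tau>)) UNIV" by (simp only:)
  moreover have "((\<lambda>n. 2 * (a n * q n) + (- 1) * (if [n = \<alpha> * 0\<^sup>2] (mod int p) then a n * q n else 0))
      has_sum (2 * f (\<tau> / of_nat p) + (- 1) * sect f 0 \<tau>)) UNIV"
    by (intro has_sum_add has_sum_cmult_right q sect_has_sum[OF a \<tau>, of 0, folded q_def])
  ultimately show ?thesis using has_sum_unique by fastforce
qed

lemma slash_W_eq_sect:
  assumes f: "f \<in> A_eps_space k p (chi \<alpha>)" and R: "Gamma0_transversal p R" and \<tau>: "\<tau> \<in> \<H>"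
  shows "lift_const * slash k f (W_mat p) \<tau> = sect f 0 \<tau>"
proof -
  note fA = A_epsD(1)[OF f]
  define h where "h \<tau> = lift_const * slash k f (W_mat p) \<tau>" for \<tau>
  define u where "u \<tau> = sect f 0 \<tau> - h \<tau>" for \<tau>
  define F where "F = lift_map B L p r k \<rho> R f"
  define S where "S \<tau> = mob (realmat S_mat) \<tau>" for \<tau>
  have S: "S \<tau> = - 1 / \<tau>" for \<tau>
    by (simp add: S_def mob_def)
  have S_H: "S \<tau> \<in> \<H>" if "\<tau> \<in> \<H>" for \<tau>
    unfolding S_def using that by (intro mob_in_\<H> det_realmat_pos) auto
  have autf_S: "autf (realmat S_mat) \<tau> = \<tau>" for \<tau> by (simp add: autf_def)
  have F\<psi>: "F \<tau> (\<psi> x) = (if int p dvd x then h \<tau> else 0) + sect f x \<tau>" if "\<tau> \<in> \<H>" for \<tau> x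
    using lift_map_\<psi>[OF fA R that] by (simp add: F_def h_def)
  \<comment> \<open>Here u is the zero component minus 2 h. The S-transform of the zero component
    contains 2 f(\<tau>/p) by \<open>sum_sect\<close>, that of 2 h contains the same term, and the
    difference involves u alone.\<close>
  have uS: "u (S \<tau>) = - C * \<tau> powi k * u \<tau>" if \<tau>: "\<tau> \<in> \<H>" for \<tau>
  proof -
    have "h (S \<tau>) = \<tau> powi k * (C * f (\<tau> / of_nat p))"
    proof -
      have "S_mat = ST_mat 0" by (simp add: mat2_eq_iff ST_mat_def)
      hence "lift_const * slash k (slash k f (W_mat p)) (realmat S_mat) \<tau> = C * f (\<tau> / of_nat p)"
        using slash_W_ST[OF \<tau>, of f 0] by simp
      moreover have "h (S \<tau>) = \<tau> powi k * (lift_const * slash k (slash k f (W_mat p)) (realmat S_mat) \<tau>)"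
        unfolding h_def S_def by (simp add: slash_mob[OF SL2Z_S \<tau>, of "slash k f (W_mat p)"] autf_S)
      ultimately show ?thesis by simp
    qed
    moreover have "h (S \<tau>) + sect f 0 (S \<tau>) = \<tau> powi k * (C * (h \<tau> + (2 * f (\<tau> / of_nat p) - sect f 0 \<tau>)))"
    proof -
      have "h (S \<tau>) + sect f 0 (S \<tau>) = F (S \<tau>) (\<psi> 0)" using F\<psi>[OF S_H[OF \<tau>], of 0] by simp
      also have "\<dots> = \<tau> powi k * \<rho> S_mat (F \<tau>) (\<psi> 0)"
        unfolding F_def S_def lift_modular[OF fA R SL2Z_S \<tau>] autf_S ..
      also have "\<rho> S_mat (F \<tau>) (\<psi> 0) = C * (\<Sum>x\<in>{0..<int p}. F \<tau> (\<psi> x))"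
        unfolding F_def \<rho>_S[OF lift_in_GA[OF R]] by simp
      also have "(\<Sum>x\<in>{0..<int p}. F \<tau> (\<psi> x)) = h \<tau> + (2 * f (\<tau> / of_nat p) - sect f 0 \<tau>)"
        unfolding F\<psi>[OF \<tau>] sum.distrib sum_dvd sum_sect[OF f \<tau>] ..
      finally show ?thesis .
    qed
    ultimately show ?thesis by (simp add: u_def algebra_simps)
  qed
  have "\<tau> \<noteq> 0" using \<tau> by (auto simp: \<H>_iff)
  \<comment> \<open>S is an involution on the upper half-plane. The signs cancel, and the two
    automorphy factors combine to (-1)^k = chi(-1), which turns \<open>C * C\<close> into
    1/p.\<close>
  have "u \<tau> = u (S (S \<tau>))" using \<open>\<tau> \<noteq> 0\<close> by (simp add: S)
  also have "\<dots> = C * C * ((S \<tau>) powi k * \<tau> powi k) * u \<tau>"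
    by (simp add: uS[OF S_H[OF \<tau>]] uS[OF \<tau>])
  also have "(S \<tau>) powi k * \<tau> powi k = of_int (chi (-1))"
    using \<open>\<tau> \<noteq> 0\<close> minus_one_powi by (simp add: S flip: power_int_mult_distrib)
  also have "C * C * of_int (chi (-1)) = 1 / of_nat p"
    using chi_C_C by (simp add: mult_ac)
  finally have "u \<tau> * (1 - 1 / of_nat p) = 0" by (simp add: algebra_simps)
  moreover have "(1 - 1 / of_nat p :: complex) \<noteq> 0" using p3 by simp
  ultimately have "u \<tau> = 0" by simp
  thus ?thesis by (simp add: u_def h_def)
qed

lemma lift_map_eps:
  assumes f: "f \<in> A_eps_space k p (chi \<alpha>)" and R: "Gamma0_transversal p R" and \<tau>: "\<tau> \<in> \<H>"
  shows "lift_map B L p r k \<rho> R f \<tau> (\<psi> x) = (if int p dvd x then 2 else 1) * sect f x \<tau>"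
proof -
  have "sect f x \<tau> = sect f 0 \<tau>" if "int p dvd x"
    using that by (intro sect_cong) (simp add: cong_0_iff)
  thus ?thesis
    by (simp add: lift_map_\<psi>[OF A_epsD(1)[OF f] R \<tau>] slash_W_eq_sect[OF f R \<tau>])
qed

lemma lift_has_sum:
  assumes f: "f \<in> A_eps_space k p (chi \<alpha>)" and R: "Gamma0_transversal p R" and \<tau>: "\<tau> \<in> \<H>"
    and a: "q_expansion f a"
  shows "((\<lambda>n. (if int p dvd x then 2 else 1) * (a n * e (of_int n * \<tau> / of_nat p))) has_sum
           lift_map B L p r k \<rho> R f \<tau> (\<psi> x)) {n. [n = \<alpha> * x\<^sup>2] (mod int p)}"
  unfolding lift_map_eps[OF f R \<tau>]
proof (rule has_sum_cmult_right)
  show "((\<lambda>n. a n * e (of_int n * \<tau> / of_nat p)) has_sum sect f x \<tau>) {n. [n = \<alpha> * x\<^sup>2] (mod int p)}"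
    using sect_has_sum[OF a \<tau>, of x]
    by (rule has_sum_cong_neutral[THEN iffD1, rotated -1]) auto
qed

text \<open>\<open>A_rho_space\<close> indexes expansions by real exponents; this identifies the
  exponents of a component with n/p for n in a residue class.\<close>

lemma quad_class:
  "{y. [y = Q (\<psi> x)] (rmod 1)} = (\<lambda>n. of_int n / real p) ` {n. [n = \<alpha> * x\<^sup>2] (mod int p)}"
proof (intro equalityI subsetI)
  fix y assume "y \<in> {y. [y = Q (\<psi> x)] (rmod 1)}"
  hence "[y = of_int (\<alpha> * x\<^sup>2) / real p] (rmod 1)" using quad_\<psi> rcong_trans by blast
  then obtain m where "of_int (\<alpha> * x\<^sup>2) / real p = y + of_int m * 1" unfolding rcong_altdef by blast
  hence "y = of_int (\<alpha> * x\<^sup>2 - int p * m) / real p"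
    using p_pos by (simp add: field_simps del: p_pos)
  moreover have "[\<alpha> * x\<^sup>2 - int p * m = \<alpha> * x\<^sup>2] (mod int p)" by (simp add: cong_iff_dvd_diff)
  ultimately show "y \<in> (\<lambda>n. of_int n / real p) ` {n. [n = \<alpha> * x\<^sup>2] (mod int p)}" by blast
next
  fix y assume "y \<in> (\<lambda>n. of_int n / real p) ` {n. [n = \<alpha> * x\<^sup>2] (mod int p)}"
  then obtain n where n: "y = of_int n / real p" "[n = \<alpha> * x\<^sup>2] (mod int p)" by blast
  then obtain m where "\<alpha> * x\<^sup>2 = n + int p * m" by (auto simp: cong_iff_lin)
  hence "of_int (\<alpha> * x\<^sup>2) / real p = y + of_int m * 1"
    using n(1) p_pos by (simp add: field_simps del: p_pos)
  hence "[y = of_int (\<alpha> * x\<^sup>2) / real p] (rmod 1)" unfolding rcong_altdef by blast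
  thus "y \<in> {y. [y = Q (\<psi> x)] (rmod 1)}" using quad_\<psi> rcong_sym rcong_trans by blast
qed

lemma lift_expansion:
  assumes f: "f \<in> A_eps_space k p (chi \<alpha>)" and R: "Gamma0_transversal p R"
  shows "\<exists>(a :: real \<Rightarrow> complex) (n0::real). \<forall>\<tau>\<in>\<H>.
     ((\<lambda>n. a n * e (of_real n * \<tau>)) has_sum lift_map B L p r k \<rho> R f \<tau> (\<psi> x))
       {n. [n = Q (\<psi> x)] (rmod 1) \<and> n \<ge> n0}"
proof -
  obtain a where a: "q_expansion f a" using A_epsD(3)[OF f] by blast
  obtain n0 where n0: "\<And>n. n < n0 \<Longrightarrow> a n = 0"
    using A_space_q_expansion_bounded_below[OF A_epsD(1)[OF f] a] by blast
  \<comment> \<open>Only points y = n/p are summed, and there the floor returns n exactly.\<close>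
  define b :: "real \<Rightarrow> complex" where
    "b y = (if int p dvd x then 2 else 1) * a \<lfloor>real p * y\<rfloor>" for y
  define S where "S = {n. [n = \<alpha> * x\<^sup>2] (mod int p)}"
  have inj: "inj_on (\<lambda>n. of_int n / real p) S"
    using p_pos by (auto simp: inj_on_def simp del: p_pos)
  have b: "b (of_int n / real p) = (if int p dvd x then 2 else 1) * a n" for n
    using p_pos by (simp add: b_def del: p_pos)
  have "((\<lambda>y. b y * e (of_real y * \<tau>)) has_sum lift_map B L p r k \<rho> R f \<tau> (\<psi> x))
       {y. [y = Q (\<psi> x)] (rmod 1) \<and> y \<ge> of_int n0 / real p}" if \<tau>: "\<tau> \<in> \<H>" for \<tau>
  proof -
    have "((\<lambda>y. b y * e (of_real y * \<tau>)) has_sum lift_map B L p r k \<rho> R f \<tau> (\<psi> x))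
       {y. [y = Q (\<psi> x)] (rmod 1)}"
      unfolding quad_class has_sum_reindex[OF inj[unfolded S_def]] o_def b
      using lift_has_sum[OF f R \<tau> a, of x] by (simp add: mult.assoc)
    thus ?thesis
    proof (rule has_sum_cong_neutral[THEN iffD1, rotated -1])
      fix y assume y: "y \<in> {y. [y = Q (\<psi> x)] (rmod 1)} - {y. [y = Q (\<psi> x)] (rmod 1) \<and> y \<ge> of_int n0 / real p}"
      then obtain n where n: "y = of_int n / real p" using quad_class by auto
      have "\<not> of_int n0 / real p \<le> y" using y by blast
      hence "n < n0" using p_pos by (simp add: n divide_le_cancel del: p_pos)
      thus "b y * e (of_real y * \<tau>) = 0" by (simp add: n b n0)
    qed auto
  qed
  thus ?thesis by blast
qed

lemma lift_holomorphic:
  assumes f: "f \<in> A_space k p" and R: "Gamma0_transversal p R"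
  shows "(\<lambda>\<tau>. lift_map B L p r k \<rho> R f \<tau> \<gamma>) holomorphic_on \<H>"
proof -
  have R': "R \<subseteq> carrier SL2Z" using R by (simp add: Gamma0_transversal_iff)
  show ?thesis
    unfolding lift_map_eq[OF R'] using R'
    by (intro holomorphic_on_sum holomorphic_on_mult holomorphic_on_const slash_holomorphic
        A_spaceD(2)[OF f] det_W_pos det_realmat_pos) auto
qed

lemma lift_in_A_rho:
  assumes f: "f \<in> A_eps_space k p (chi \<alpha>)" and R: "Gamma0_transversal p R"
  shows "lift_map B L p r k \<rho> R f \<in> A_rho_space B L k \<rho>"
proof -
  note fA = A_epsD(1)[OF f]
  have "\<exists>(a :: real \<Rightarrow> complex) (n0::real). \<forall>\<tau>\<in>\<H>.
     ((\<lambda>n. a n * e (of_real n * \<tau>)) has_sum lift_map B L p r k \<rho> R f \<tau> \<gamma>)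
       {n. [n = Q \<gamma>] (rmod 1) \<and> n \<ge> n0}" if "\<gamma> \<in> D" for \<gamma>
    using lift_expansion[OF f R] \<psi>_surj[OF that] by blast
  thus ?thesis
    unfolding A_rho_space_def mem_Collect_eq
    using lift_notin lift_in_GA[OF R] lift_holomorphic[OF fA R] lift_modular[OF fA R] by blast
qed

end

subsection \<open>Descending to scalar-valued forms\<close>

context weil
begin

lemma A_rhoD:
  assumes "F \<in> A_rho_space B L k \<rho>"
  shows "\<tau> \<notin> \<H> \<Longrightarrow> F \<tau> = (\<lambda>\<gamma>. 0)" "F \<tau> \<in> GA"
    "\<gamma> \<in> D \<Longrightarrow> (\<lambda>\<tau>. F \<tau> \<gamma>) holomorphic_on \<H>"
    "M \<in> carrier SL2Z \<Longrightarrow> \<tau> \<in> \<H> \<Longrightarrow>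
       F (mob (realmat M) \<tau>) = (\<lambda>\<gamma>. autf (realmat M) \<tau> powi k * \<rho> M (F \<tau>) \<gamma>)"
    "\<gamma> \<in> D \<Longrightarrow> \<exists>(a :: real \<Rightarrow> complex) (n0::real). \<forall>\<tau>\<in>\<H>.
        ((\<lambda>n. a n * e (of_real n * \<tau>)) has_sum F \<tau> \<gamma>) {n. [n = Q \<gamma>] (rmod 1) \<and> n \<ge> n0}"
  using assms unfolding A_rho_space_def mem_Collect_eq by blast+

definition descent_const :: complex where
  "descent_const = \<i> powi (r div 2) / 2 * of_real (real p powr ((1 - of_int k) / 2))"

lemma descent_map_eq: "descent_map B L p r k F = (\<lambda>\<tau>. descent_const * slash k (\<lambda>\<tau>. F \<tau> L) (W_mat p) \<tau>)"
  by (simp add: descent_map_def disc_group_simps(2) descent_const_def)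

text \<open>The origin of the descent constant: it cancels p^(k/2) from the determinant of W_p and
  \<open>C\<close> from \<rho>(S), leaving the factor 1/2.\<close>

lemma descent_const_C: "descent_const * of_real (real p powr (of_int k / 2)) * C = 1 / 2"
proof -
  have "real p powr ((1 - of_int k) / 2) * real p powr (of_int k / 2) = sqrt (real p)"
    using p_pos by (simp add: powr_half_sqrt[symmetric] powr_add[symmetric] diff_divide_distrib del: p_pos)
  hence s: "complex_of_real (real p powr ((1 - of_int k) / 2)) * of_real (real p powr (of_int k / 2)) = of_real (sqrt (real p))"
    by (simp flip: of_real_mult)
  have "descent_const * of_real (real p powr (of_int k / 2)) * C =
        \<i> powi (r div 2) / 2 * (complex_of_real (real p powr ((1 - of_int k) / 2)) * of_real (real p powr (of_int k / 2))) * C"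
    by (simp add: descent_const_def)
  also have "\<dots> = of_int (chi (-1)) * C * C * (of_real (sqrt (real p)) * of_real (sqrt (real p))) / 2"
    unfolding s i_powi by (simp add: mult_ac)
  also have "of_real (sqrt (real p)) * of_real (sqrt (real p)) = (of_nat p :: complex)"
    by (simp flip: of_real_mult)
  finally show ?thesis using p_pos by (simp add: chi_C_C del: p_pos)
qed

lemma lift_const_descent_const: "lift_const * descent_const = of_int (chi (-1)) / 2"
proof -
  have "lift_const * descent_const = of_int (chi (-1)) * C * of_real (real p powr (of_int k / 2)) * descent_const"
    by (simp add: lift_const)
  also have "\<dots> = of_int (chi (-1)) * (descent_const * of_real (real p powr (of_int k / 2)) * C)"
    by (simp only: mult_ac)
  finally show ?thesis by (simp add: descent_const_C)
qed

lemma A_rho_T: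
  assumes F: "F \<in> A_rho_space B L k \<rho>" and \<tau>: "\<tau> \<in> \<H>"
  shows "F (\<tau> + of_nat j) (\<psi> x) = unit_root p (\<alpha> * x\<^sup>2 * int j) * F \<tau> (\<psi> x)"
proof (induction j)
  case (Suc j)
  have \<tau>': "\<tau> + of_nat j \<in> \<H>" using \<tau> by (simp add: \<H>_iff)
  have "F (mob (realmat T_mat) (\<tau> + of_nat j)) (\<psi> x) = unit_root p (\<alpha> * x\<^sup>2) * F (\<tau> + of_nat j) (\<psi> x)"
    by (simp add: A_rhoD(4)[OF F SL2Z_T \<tau>'] \<rho>_T[OF A_rhoD(2)[OF F]]) (simp add: autf_def)
  moreover have "mob (realmat T_mat) (\<tau> + of_nat j) = \<tau> + of_nat (Suc j)"
    by (simp add: mob_def algebra_simps)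
  ultimately show ?case
    using Suc by (simp add: distrib_left unit_root_add)
qed simp

text \<open>S^2 = -1 moves no point. Its automorphy factor (-1)^k and its scalar chi(-1) in the Weil
  representation cancel, leaving only the reflection.\<close>

lemma A_rho_minus:
  assumes F: "F \<in> A_rho_space B L k \<rho>" and \<tau>: "\<tau> \<in> \<H>"
  shows "F \<tau> (\<psi> (- x)) = F \<tau> (\<psi> x)"
proof -
  have S: "S_mat ** S_mat \<in> carrier SL2Z" by (simp add: SL2Z_mult)
  have "mob (realmat (S_mat ** S_mat)) \<tau> = \<tau>" "autf (realmat (S_mat ** S_mat)) \<tau> = -1"
    by (simp_all add: mob_def autf_def mat2_mult_nth)
  hence "F \<tau> (\<psi> x) = of_int (chi (-1)) * (of_int (chi (-1)) * F \<tau> (\<psi> (- x)))"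
    using fun_cong[OF A_rhoD(4)[OF F S \<tau>], of "\<psi> x"] by (simp add: minus_one_powi \<rho>_S_S[OF A_rhoD(2)[OF F]])
  also have "\<dots> = of_int (chi (-1) * chi (-1)) * F \<tau> (\<psi> (- x))" by simp
  finally show ?thesis using chi_square[OF minus_one_not_dvd(1)] by simp
qed

text \<open>W_p \<tau> = S(p \<tau>), and the zero component of \<rho>(S) v is \<open>C\<close>
  times the sum of all components of v.\<close>

lemma descent_sum:
  assumes F: "F \<in> A_rho_space B L k \<rho>" and \<tau>: "\<tau> \<in> \<H>"
  shows "descent_map B L p r k F \<tau> = 1 / 2 * (\<Sum>\<gamma>\<in>D. F (of_nat p * \<tau>) \<gamma>)"
proof -
  have \<tau>': "of_nat p * \<tau> \<in> \<H>" using \<H>_scale[OF \<tau>, of "real p"] by simp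
  hence nz: "of_nat p * \<tau> \<noteq> 0" by (auto simp: \<H>_iff)
  have "mob (W_mat p) \<tau> = mob (realmat S_mat) (of_nat p * \<tau>)"
    by (simp add: mob_def)
  moreover have "F (mob (realmat S_mat) (of_nat p * \<tau>)) L =
      (of_nat p * \<tau>) powi k * (C * (\<Sum>\<gamma>\<in>D. F (of_nat p * \<tau>) \<gamma>))"
    using \<rho>_S[OF A_rhoD(2)[OF F], of "of_nat p * \<tau>" 0]
    by (simp add: A_rhoD(4)[OF F SL2Z_S \<tau>'] \<psi>_0 sum_D) (simp add: autf_def)
  moreover have "autf (W_mat p) \<tau> = of_nat p * \<tau>" by (simp add: autf_def)
  ultimately have "slash k (\<lambda>\<tau>. F \<tau> L) (W_mat p) \<tau> =
      of_real (real p powr (of_int k / 2)) * ((of_nat p * \<tau>) powi (- k) * (of_nat p * \<tau>) powi k) * (C * (\<Sum>\<gamma>\<in>D. F (of_nat p * \<tau>) \<gamma>))"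
    using \<tau> by (simp add: slash_def det_W)
  also have "(of_nat p * \<tau>) powi (- k) * (of_nat p * \<tau>) powi k = 1"
    using nz by (simp add: power_int_minus)
  finally have "descent_map B L p r k F \<tau> =
      (descent_const * of_real (real p powr (of_int k / 2)) * C) * (\<Sum>\<gamma>\<in>D. F (of_nat p * \<tau>) \<gamma>)"
    by (simp add: descent_map_eq)
  thus ?thesis by (simp only: descent_const_C)
qed

text \<open>Reindexing by n = p y gives all components integer exponents over the common denominator
  p, so that they can be added.\<close>

lemma A_rho_expansion_int:
  assumes F: "F \<in> A_rho_space B L k \<rho>"
  shows "\<exists>a n0. \<forall>\<tau>\<in>\<H>. ((\<lambda>n. a n * e (of_int n * \<tau> / of_nat p)) has_sum F \<tau> (\<psi> x))
           {n. [n = \<alpha> * x\<^sup>2] (mod int p) \<and> n \<ge> n0}"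
proof -
  obtain a :: "real \<Rightarrow> complex" and y0 :: real where a: "\<And>\<tau>. \<tau> \<in> \<H> \<Longrightarrow>
      ((\<lambda>y. a y * e (of_real y * \<tau>)) has_sum F \<tau> (\<psi> x)) {y. [y = Q (\<psi> x)] (rmod 1) \<and> y \<ge> y0}"
    using A_rhoD(5)[OF F \<psi>_in_D] by blast
  define n0 where "n0 = \<lceil>real p * y0\<rceil>"
  define S where "S = {n. [n = \<alpha> * x\<^sup>2] (mod int p) \<and> n \<ge> n0}"
  have n0: "n \<ge> n0 \<longleftrightarrow> of_int n / real p \<ge> y0" for n
    using p_pos by (simp add: n0_def ceiling_le_iff pos_le_divide_eq mult.commute del: p_pos)
  have "{y. [y = Q (\<psi> x)] (rmod 1) \<and> y \<ge> y0} = {y. [y = Q (\<psi> x)] (rmod 1)} \<inter> {y. y \<ge> y0}" by blast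
  also have "\<dots> = (\<lambda>n. of_int n / real p) ` S"
    unfolding quad_class S_def n0 by blast
  finally have set: "{y. [y = Q (\<psi> x)] (rmod 1) \<and> y \<ge> y0} = (\<lambda>n. of_int n / real p) ` S" .
  have inj: "inj_on (\<lambda>n. of_int n / real p) S"
    using p_pos by (auto simp: inj_on_def simp del: p_pos)
  have "((\<lambda>n. a (of_int n / real p) * e (of_int n * \<tau> / of_nat p)) has_sum F \<tau> (\<psi> x)) S"
    if "\<tau> \<in> \<H>" for \<tau>
    using a[OF that] unfolding set has_sum_reindex[OF inj] by (simp add: o_def)
  thus ?thesis unfolding S_def
    by (intro exI[of _ "\<lambda>n. a (of_int n / real p)"] exI[of _ n0] ballI)
qed

lemma chi_quad: "[n = \<alpha> * x\<^sup>2] (mod int p) \<Longrightarrow> chi n \<noteq> - chi \<alpha>"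
proof -
  assume "[n = \<alpha> * x\<^sup>2] (mod int p)"
  hence "chi n = chi \<alpha> * (chi x * chi x)"
    using chi_cong by (simp add: chi_mult power2_eq_square)
  moreover have "chi \<alpha> \<noteq> 0" using \<alpha>(1) by (simp add: chi_eq_0_iff)
  ultimately show ?thesis using chi_values[of x] by auto
qed

lemma descent_q_expansion:
  assumes F: "F \<in> A_rho_space B L k \<rho>"
  shows "\<exists>c n0. q_expansion (descent_map B L p r k F) c \<and> (\<forall>n<n0. c n = 0) \<and>
           (\<forall>n. chi n = - chi \<alpha> \<longrightarrow> c n = 0)"
proof -
  have "\<forall>x. \<exists>a n0. \<forall>\<tau>\<in>\<H>. ((\<lambda>n. a n * e (of_int n * \<tau> / of_nat p)) has_sum F \<tau> (\<psi> x))
      {n. [n = \<alpha> * x\<^sup>2] (mod int p) \<and> n \<ge> n0}"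
    using A_rho_expansion_int[OF F] by blast
  from choice[OF this] obtain a where
    "\<forall>x. \<exists>n0. \<forall>\<tau>\<in>\<H>. ((\<lambda>n. a x n * e (of_int n * \<tau> / of_nat p)) has_sum F \<tau> (\<psi> x))
      {n. [n = \<alpha> * x\<^sup>2] (mod int p) \<and> n \<ge> n0}" by blast
  from choice[OF this] obtain n0 where a: "\<And>x \<tau>. \<tau> \<in> \<H> \<Longrightarrow>
     ((\<lambda>n. a x n * e (of_int n * \<tau> / of_nat p)) has_sum F \<tau> (\<psi> x)) {n. [n = \<alpha> * x\<^sup>2] (mod int p) \<and> n \<ge> n0 x}"
    by blast
  \<comment> \<open>Extension by zero, so that the expansions of all components share one index
    set.\<close>
  define b where "b x n = (if [n = \<alpha> * x\<^sup>2] (mod int p) \<and> n \<ge> n0 x then a x n else 0)" for x n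
  define c where "c n = 1 / 2 * (\<Sum>x\<in>{0..<int p}. b x n)" for n
  define m0 where "m0 = Min (n0 ` {0..<int p})"
  have "q_expansion (descent_map B L p r k F) c"
    unfolding q_expansion_def
  proof
    fix \<tau> assume \<tau>: "\<tau> \<in> \<H>"
    have \<tau>': "of_nat p * \<tau> \<in> \<H>" using \<H>_scale[OF \<tau>, of "real p"] by simp
    have "((\<lambda>n. b x n * e (of_int n * \<tau>)) has_sum F (of_nat p * \<tau>) (\<psi> x)) UNIV" for x
    proof -
      have "((\<lambda>n. a x n * e (of_int n * \<tau>)) has_sum F (of_nat p * \<tau>) (\<psi> x)) {n. [n = \<alpha> * x\<^sup>2] (mod int p) \<and> n \<ge> n0 x}"
      proof -
        have "of_int n * (of_nat p * \<tau>) / of_nat p = of_int n * \<tau>" for n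
          using p_pos by (simp del: p_pos)
        thus ?thesis using a[OF \<tau>', of x] by (simp only:)
      qed
      thus ?thesis by (rule has_sum_cong_neutral[THEN iffD1, rotated -1]) (auto simp: b_def)
    qed
    hence "((\<lambda>n. 1 / 2 * (\<Sum>x\<in>{0..<int p}. b x n * e (of_int n * \<tau>))) has_sum
        1 / 2 * (\<Sum>x\<in>{0..<int p}. F (of_nat p * \<tau>) (\<psi> x))) UNIV"
      by (intro has_sum_cmult_right has_sum_sum)
    thus "((\<lambda>n. c n * e (of_int n * \<tau>)) has_sum descent_map B L p r k F \<tau>) UNIV"
      by (simp add: descent_sum[OF F \<tau>] sum_D c_def sum_distrib_right)
  qed
  moreover have "c n = 0" if "n < m0" for n
  proof -
    have "b x n = 0" if "x \<in> {0..<int p}" for x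
    proof -
      have "m0 \<le> n0 x" unfolding m0_def using that by (intro Min_le) auto
      thus ?thesis using \<open>n < m0\<close> by (simp add: b_def)
    qed
    thus ?thesis by (simp add: c_def)
  qed
  moreover have "c n = 0" if "chi n = - chi \<alpha>" for n
    using chi_quad that by (auto simp: c_def b_def intro!: sum.neutral)
  ultimately show ?thesis by blast
qed

lemma A_rho_slash_Gamma0:
  assumes F: "F \<in> A_rho_space B L k \<rho>" and G: "G \<in> Gamma0 p"
  shows "slash k (\<lambda>\<tau>. F \<tau> L) (realmat G) = (\<lambda>\<tau>. of_int (chi (G $ 2 $ 2)) * F \<tau> L)"
proof
  fix \<tau>
  have G1: "G \<in> carrier SL2Z" using G by (simp add: Gamma0_iff)
  show "slash k (\<lambda>\<tau>. F \<tau> L) (realmat G) \<tau> = of_int (chi (G $ 2 $ 2)) * F \<tau> L"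
  proof (cases "\<tau> \<in> \<H>")
    case True
    have "autf (realmat G) \<tau> \<noteq> 0" using autf_nonzero[OF det_realmat_pos[OF G1] True] .
    thus ?thesis
      by (simp add: slash_SL2Z[OF G1 True] A_rhoD(4)[OF F G1 True] \<rho>_Gamma0_coeff[OF G A_rhoD(2)[OF F]]
          power_int_minus)
  qed (simp add: slash_notin A_rhoD(1)[OF F])
qed

lemma descent_Gamma0:
  assumes F: "F \<in> A_rho_space B L k \<rho>" and G: "G \<in> Gamma0 p"
  shows "slash k (descent_map B L p r k F) (realmat G) = (\<lambda>\<tau>. of_int (chi (G $ 2 $ 2)) * descent_map B L p r k F \<tau>)"
proof -
  have "slash k (slash k (\<lambda>\<tau>. F \<tau> L) (W_mat p)) (realmat G) =
      (\<lambda>\<tau>. of_int (chi (G $ 2 $ 2)) * slash k (\<lambda>\<tau>. F \<tau> L) (W_mat p) \<tau>)"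
    by (rule slash_W_Gamma0[OF A_rho_slash_Gamma0[OF F] G])
  thus ?thesis by (simp add: descent_map_eq slash_cmult mult_ac)
qed

text \<open>There are two cases of M modulo \<open>Gamma0 p\<close>. Inside the group the slash only
  multiplies by chi. Otherwise M = G S T^j, and W_p S T^j leads back to the zero component at
  (\<tau> + j)/p.\<close>

lemma descent_mero:
  assumes F: "F \<in> A_rho_space B L k \<rho>"
  shows "mero_at_cusps k (descent_map B L p r k F)"
  unfolding mero_at_cusps_def
proof
  fix M assume M: "M \<in> carrier SL2Z"
  define f where "f = descent_map B L p r k F"
  show "\<exists>(h::nat) (n0::int) (a :: int \<Rightarrow> complex). h > 0 \<and>
        (\<forall>\<tau>\<in>\<H>. ((\<lambda>n. a n * e (of_int n * \<tau> / of_nat h)) has_sum slash k (descent_map B L p r k F) (realmat M) \<tau>) {n0..})"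
  proof (cases "int p dvd M $ 2 $ 1")
    case True
    hence MG: "M \<in> Gamma0 p" using M by (simp add: Gamma0_iff)
    obtain c n0 where c: "q_expansion f c" and n0: "\<And>n. n < n0 \<Longrightarrow> c n = 0"
      using descent_q_expansion[OF F] unfolding f_def by blast
    have "((\<lambda>n. of_int (chi (M $ 2 $ 2)) * c n * e (of_int n * \<tau> / of_nat 1)) has_sum slash k f (realmat M) \<tau>) {n0..}"
      if "\<tau> \<in> \<H>" for \<tau>
    proof -
      have "((\<lambda>n. c n * e (of_int n * \<tau>)) has_sum f \<tau>) {n0..}"
        using q_expansionD[OF c that]
        by (rule has_sum_cong_neutral[THEN iffD1, rotated -1]) (use n0 in auto)
      from has_sum_cmult_right[OF this, of "of_int (chi (M $ 2 $ 2))"] show ?thesis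
        using descent_Gamma0[OF F MG] by (simp add: f_def mult.assoc)
    qed
    thus ?thesis unfolding f_def
      by (intro exI[of _ "1::nat"] exI[of _ n0] exI[of _ "\<lambda>n. of_int (chi (M $ 2 $ 2)) * c n"]) simp
  next
    case False
    obtain j where j: "ST_mat j ** adj2 M \<in> Gamma0 p" using Gamma0_ST_mat[OF M False] by blast
    define G where "G = M ** adj2 (ST_mat j)"
    have G: "G \<in> Gamma0 p" using Gamma0_adj2[OF j] by (simp add: adj2_mult G_def)
    hence G1: "G \<in> carrier SL2Z" by (simp add: Gamma0_iff)
    have MG: "M = G ** ST_mat j"
      using adj2_inverse[OF ST_mat_in_SL2Z] by (simp add: G_def flip: matrix_mul_assoc)
    obtain a n0 where a: "\<And>\<tau>. \<tau> \<in> \<H> \<Longrightarrow> ((\<lambda>n. a n * e (of_int n * \<tau> / of_nat p)) has_sum F \<tau> (\<psi> 0))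
           {n. [n = \<alpha> * 0\<^sup>2] (mod int p) \<and> n \<ge> n0}"
      using A_rho_expansion_int[OF F, of 0] by blast
    \<comment> \<open>The division by \<open>lift_const\<close> undoes the factor that
      \<open>slash_W_ST\<close> carries.\<close>
    define d where "d = of_int (chi (G $ 2 $ 2)) * descent_const * C / lift_const"
    \<comment> \<open>The component has exponents n/p and is evaluated at (\<tau> + j)/p, so the
      width becomes p^2 and the shift by j becomes a constant e(n j/p^2) in each
      coefficient.\<close>
    define b where "b n = d * (if [n = \<alpha> * 0\<^sup>2] (mod int p) then a n * e (of_int (n * j) / of_nat (p * p)) else 0)" for n
    have lc: "lift_const \<noteq> 0" by (simp add: lift_const_def)
    have "((\<lambda>n. b n * e (of_int n * \<tau> / of_nat (p * p))) has_sum slash k f (realmat M) \<tau>) {n0..}"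
      if \<tau>: "\<tau> \<in> \<H>" for \<tau>
    proof -
      have "slash k f (realmat M) = slash k (slash k f (realmat G)) (realmat (ST_mat j))"
        by (simp only: slash_slash[OF det_realmat_pos[OF G1] det_realmat_pos[OF ST_mat_in_SL2Z]] realmat_mult MG)
      hence "slash k f (realmat M) \<tau> = of_int (chi (G $ 2 $ 2)) * (descent_const *
          slash k (slash k (\<lambda>\<tau>. F \<tau> L) (W_mat p)) (realmat (ST_mat j)) \<tau>)"
        unfolding f_def descent_Gamma0[OF F G] slash_cmult by (simp only: descent_map_eq slash_cmult)
      also have "slash k (slash k (\<lambda>\<tau>. F \<tau> L) (W_mat p)) (realmat (ST_mat j)) \<tau> = C * F ((\<tau> + of_int j) / of_nat p) L / lift_const"
        using slash_W_ST[OF \<tau>, of "\<lambda>\<tau>. F \<tau> L" j] lc by (simp add: field_simps)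
      finally have eq: "slash k f (realmat M) \<tau> = d * F ((\<tau> + of_int j) / of_nat p) (\<psi> 0)"
        by (simp add: d_def \<psi>_0)
      have "((\<lambda>n. d * (a n * e (of_int n * ((\<tau> + of_int j) / of_nat p) / of_nat p))) has_sum slash k f (realmat M) \<tau>)
           {n. [n = \<alpha> * 0\<^sup>2] (mod int p) \<and> n \<ge> n0}"
        unfolding eq by (intro has_sum_cmult_right a \<H>_shift \<tau> p_pos)
      moreover have "e (of_int n * ((\<tau> + of_int j) / of_nat p) / of_nat p) =
          e (of_int (n * j) / of_nat (p * p)) * e (of_int n * \<tau> / of_nat (p * p))" for n
        by (simp add: distrib_left add_divide_distrib flip: e_add) (simp add: add.commute)
      ultimately have "((\<lambda>n. d * (a n * (e (of_int (n * j) / of_nat (p * p)) * e (of_int n * \<tau> / of_nat (p * p))))) has_sum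
            slash k f (realmat M) \<tau>) {n. [n = \<alpha> * 0\<^sup>2] (mod int p) \<and> n \<ge> n0}"
        by (simp only:)
      thus ?thesis
        by (rule has_sum_cong_neutral[THEN iffD1, rotated -1]) (auto simp: b_def)
    qed
    thus ?thesis unfolding f_def
      by (intro exI[of _ "p * p"] exI[of _ n0] exI[of _ b]) simp
  qed
qed

lemma descent_in_A_eps:
  assumes F: "F \<in> A_rho_space B L k \<rho>"
  shows "descent_map B L p r k F \<in> A_eps_space k p (chi \<alpha>)"
proof -
  have "descent_map B L p r k F \<tau> = 0" if "\<tau> \<notin> \<H>" for \<tau>
    by (simp add: descent_map_eq slash_notin[OF that])
  moreover have "descent_map B L p r k F holomorphic_on \<H>"
    unfolding descent_map_eq
    by (intro holomorphic_on_mult holomorphic_on_const slash_holomorphic A_rhoD(3)[OF F] L_in_D det_W_pos)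
  ultimately have "descent_map B L p r k F \<in> A_space k p"
    using descent_mero[OF F] descent_Gamma0[OF F] by (simp add: A_space_def)
  thus ?thesis using descent_q_expansion[OF F] by (auto simp: A_eps_space_def)
qed

section \<open>The two compositions and linearity\<close>

lemma descent_lift:
  assumes f: "f \<in> A_eps_space k p (chi \<alpha>)" and R: "Gamma0_transversal p R"
  shows "descent_map B L p r k (lift_map B L p r k \<rho> R f) = f"
proof
  fix \<tau>
  show "descent_map B L p r k (lift_map B L p r k \<rho> R f) \<tau> = f \<tau>"
  proof (cases "\<tau> \<in> \<H>")
    case \<tau>: True
    have \<tau>': "of_nat p * \<tau> \<in> \<H>" using \<H>_scale[OF \<tau>, of "real p"] by simp
    \<comment> \<open>The term from f | W_p equals the zero section and so cancels the correction in
      \<open>sum_sect\<close>.\<close>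
    have "(\<Sum>\<gamma>\<in>D. lift_map B L p r k \<rho> R f (of_nat p * \<tau>) \<gamma>) = 2 * f (of_nat p * \<tau> / of_nat p)"
      unfolding sum_D lift_map_\<psi>[OF A_epsD(1)[OF f] R \<tau>'] slash_W_eq_sect[OF f R \<tau>']
        sum.distrib sum_dvd sum_sect[OF f \<tau>'] by simp
    thus ?thesis by (simp add: descent_sum[OF lift_in_A_rho[OF f R] \<tau>])
  next
    case False
    thus ?thesis using A_spaceD(1)[OF A_epsD(1)[OF f]] by (simp add: descent_map_eq slash_notin)
  qed
qed

lemma slash_W_W:
  assumes "\<tau> \<in> \<H>"
  shows "slash k (slash k f (W_mat p)) (W_mat p) \<tau> = of_int (chi (-1)) * f \<tau>"
proof -
  define M where "M = W_mat p ** W_mat p"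
  have M: "M $ 1 $ 1 = - real p" "M $ 1 $ 2 = 0" "M $ 2 $ 1 = 0" "M $ 2 $ 2 = - real p"
    by (simp_all add: M_def mat2_mult_nth)
  have "mob M \<tau> = \<tau>" using p_pos by (simp add: mob_def M del: p_pos)
  moreover have "autf M \<tau> = - of_nat p" by (simp add: autf_def M)
  moreover have "det M = real p * real p" by (simp add: det_2 M)
  ultimately have "slash k (slash k f (W_mat p)) (W_mat p) \<tau> =
      (of_real (real p powr (of_int k / 2)) * of_real (real p powr (of_int k / 2)) * (- of_nat p) powi (- k)) * f \<tau>"
    using assms by (simp add: slash_slash flip: M_def) (simp add: slash_def powr_mult)
  also have "of_real (real p powr (of_int k / 2)) * of_real (real p powr (of_int k / 2)) * (- of_nat p) powi (- k) =
      (of_int (chi (-1)) :: complex)"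
    unfolding p_powr_mult minus_p_powi using p_pos by (simp add: power_int_minus del: p_pos)
  finally show ?thesis .
qed

text \<open>Filtering half the sum of the components keeps the y with y^2 congruent to x^2, that is
  y = x or y = -x, where the components agree. There are 1 + chi(x)^2 of them, which yields the full
  component for x nonzero and half of the zero component. The other half comes from f | W_p, as W_p
  squared is scalar.\<close>

lemma lift_descent:
  assumes F: "F \<in> A_rho_space B L k \<rho>" and R: "Gamma0_transversal p R"
  shows "lift_map B L p r k \<rho> R (descent_map B L p r k F) = F"
proof
  fix \<tau>
  define f where "f = descent_map B L p r k F"
  have f: "f \<in> A_space k p" using A_epsD(1)[OF descent_in_A_eps[OF F]] by (simp add: f_def)
  show "lift_map B L p r k \<rho> R (descent_map B L p r k F) \<tau> = F \<tau>"
  proof (cases "\<tau> \<in> \<H>")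
    case \<tau>: True
    show ?thesis
    proof (rule GA_eqI[OF lift_in_GA[OF R] A_rhoD(2)[OF F]])
      fix x
      \<comment> \<open>The shift by j multiplies each component by a power of its T-eigenvalue,
        which gives the filter its characters. \<open>A_rho_T\<close> handles natural shifts, and j
        \<ge> 0 here.\<close>
      have f_shift: "f ((\<tau> + of_int j) / of_nat p) = 1 / 2 * (\<Sum>y\<in>{0..<int p}. unit_root p (\<alpha> * y\<^sup>2 * j) * F \<tau> (\<psi> y))"
        if "j \<in> {0..<int p}" for j
      proof -
        have j: "of_int j = (of_nat (nat j) :: complex)" "int (nat j) = j" using that by auto
        have "f ((\<tau> + of_int j) / of_nat p) = 1 / 2 * (\<Sum>\<gamma>\<in>D. F (\<tau> + of_int j) \<gamma>)"
          using descent_sum[OF F \<H>_shift[OF \<tau> p_pos, of j]] p_pos by (simp add: f_def del: p_pos)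
        moreover have "F (\<tau> + of_int j) (\<psi> y) = unit_root p (\<alpha> * y\<^sup>2 * j) * F \<tau> (\<psi> y)" for y
          using A_rho_T[OF F \<tau>, of "nat j" y] unfolding j(2) j(1)[symmetric] .
        ultimately show ?thesis by (simp only: sum_D)
      qed
      have "sect f x \<tau> = 1 / of_nat p * (\<Sum>j\<in>{0..<int p}. (1 / 2 * (\<Sum>y\<in>{0..<int p}. unit_root p (\<alpha> * y\<^sup>2 * j) * F \<tau> (\<psi> y)))
          * unit_root p (- (\<alpha> * x\<^sup>2) * j))"
        unfolding sect_def by (intro arg_cong2[where f = "(*)"] refl sum.cong) (simp only: f_shift)
      also have "\<dots> = 1 / of_nat p * (1 / 2 * (\<Sum>j\<in>{0..<int p}. \<Sum>y\<in>{0..<int p}.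
          (unit_root p (\<alpha> * y\<^sup>2 * j) * unit_root p (- (\<alpha> * x\<^sup>2) * j)) * F \<tau> (\<psi> y)))"
        by (simp add: sum_distrib_left sum_distrib_right mult_ac)
      also have "\<dots> = 1 / of_nat p * (1 / 2 * (\<Sum>y\<in>{0..<int p}. \<Sum>j\<in>{0..<int p}.
          unit_root p ((\<alpha> * y\<^sup>2 - \<alpha> * x\<^sup>2) * j) * F \<tau> (\<psi> y)))"
        unfolding unit_root_add[symmetric] by (subst sum.swap) (simp add: algebra_simps)
      also have "\<dots> = 1 / of_nat p * (1 / 2 * (\<Sum>y\<in>{0..<int p}.
          if [\<alpha> * x\<^sup>2 = \<alpha> * y\<^sup>2] (mod int p) then of_nat p * F \<tau> (\<psi> x) else 0))"
      proof -
        have "(\<Sum>j\<in>{0..<int p}. unit_root p ((\<alpha> * y\<^sup>2 - \<alpha> * x\<^sup>2) * j) * F \<tau> (\<psi> y)) =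
            (if [\<alpha> * x\<^sup>2 = \<alpha> * y\<^sup>2] (mod int p) then of_nat p * F \<tau> (\<psi> x) else 0)" for y
        proof -
          have iff: "int p dvd \<alpha> * y\<^sup>2 - \<alpha> * x\<^sup>2 \<longleftrightarrow> [\<alpha> * x\<^sup>2 = \<alpha> * y\<^sup>2] (mod int p)"
            by (metis cong_iff_dvd_diff cong_sym_eq)
          have "F \<tau> (\<psi> y) = F \<tau> (\<psi> x)" if "[\<alpha> * x\<^sup>2 = \<alpha> * y\<^sup>2] (mod int p)"
          proof -
            have "[x\<^sup>2 = y\<^sup>2] (mod int p)"
              using that \<alpha>(1) by (simp add: cong_mult_lcancel coprime_p_iff)
            hence "\<psi> x = \<psi> y \<or> \<psi> x = \<psi> (- y)" unfolding square_cong_iff using \<psi>_cong by blast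
            thus ?thesis using A_rho_minus[OF F \<tau>, of y] by auto
          qed
          thus ?thesis unfolding sum_distrib_right[symmetric] unit_root_sum[OF p_pos] iff by auto
        qed
        thus ?thesis by (simp only:)
      qed
      also have "\<dots> = 1 / of_nat p * (1 / 2 * (of_int (int (card {y \<in> {0..<int p}. [\<alpha> * x\<^sup>2 = \<alpha> * y\<^sup>2] (mod int p)})) * (of_nat p * F \<tau> (\<psi> x))))"
        by (subst sum.inter_filter[symmetric]) auto
      also have "\<dots> = 1 / 2 * of_int (1 + chi \<alpha> * chi (\<alpha> * x\<^sup>2)) * F \<tau> (\<psi> x)"
        unfolding card_quad_eq using p_pos by (simp add: mult_ac del: p_pos)
      also have "chi \<alpha> * chi (\<alpha> * x\<^sup>2) = chi x * chi x"
        using chi_square[OF \<alpha>(1)] by (simp add: chi_mult power2_eq_square flip: mult.assoc)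
      finally have sect: "sect f x \<tau> = 1 / 2 * of_int (1 + chi x * chi x) * F \<tau> (\<psi> x)" .
      have "lift_const * slash k f (W_mat p) \<tau> = 1 / 2 * F \<tau> L"
      proof -
        have "lift_const * slash k f (W_mat p) \<tau> = (lift_const * descent_const) * (of_int (chi (-1)) * F \<tau> L)"
          unfolding f_def descent_map_eq slash_cmult slash_W_W[OF \<tau>] by simp
        also have "\<dots> = of_int (chi (-1) * chi (-1)) / 2 * F \<tau> L"
          by (simp add: lift_const_descent_const)
        finally show ?thesis using chi_square[OF minus_one_not_dvd(1)] by simp
      qed
      hence "lift_map B L p r k \<rho> R f \<tau> (\<psi> x) =
          (if int p dvd x then 1 / 2 * F \<tau> L else 0) + 1 / 2 * of_int (1 + chi x * chi x) * F \<tau> (\<psi> x)"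
        by (simp add: lift_map_\<psi>[OF f R \<tau>] sect)
      also have "\<dots> = F \<tau> (\<psi> x)"
      proof (cases "int p dvd x")
        case True
        hence "\<psi> x = L" "chi x = 0" by (auto simp: \<psi>_eq_L_iff chi_eq_0_iff)
        thus ?thesis using True by simp
      qed (simp add: chi_square)
      finally show "lift_map B L p r k \<rho> R (descent_map B L p r k F) \<tau> (\<psi> x) = F \<tau> (\<psi> x)"
        by (simp add: f_def)
    qed
  qed (simp add: lift_notin A_rhoD(1)[OF F])
qed

lemma lift_linear:
  "lift_map B L p r k \<rho> R (\<lambda>\<tau>. c * f \<tau> + g \<tau>) =
    (\<lambda>\<tau> \<gamma>. c * lift_map B L p r k \<rho> R f \<tau> \<gamma> + lift_map B L p r k \<rho> R g \<tau> \<gamma>)"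
  by (simp add: lift_map_def slash_linear sum.distrib distrib_left sum_distrib_left mult_ac)

lemma descent_linear:
  "descent_map B L p r k (\<lambda>\<tau> \<gamma>. c * F \<tau> \<gamma> + G \<tau> \<gamma>) =
    (\<lambda>\<tau>. c * descent_map B L p r k F \<tau> + descent_map B L p r k G \<tau>)"
  by (simp add: descent_map_def slash_linear distrib_left mult_ac)

lemma lift_fourier:
  assumes f: "f \<in> A_eps_space k p (chi \<alpha>)" and R: "Gamma0_transversal p R"
    and a: "q_expansion f a" and \<tau>: "\<tau> \<in> \<H>"
  shows "((\<lambda>n. 2 * (a n * e (of_int n * \<tau> / of_nat p))) has_sum lift_map B L p r k \<rho> R f \<tau> L) {n. [n = 0] (mod int p)}"
    and "\<gamma> \<in> D \<Longrightarrow> \<gamma> \<noteq> L \<Longrightarrow>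
      ((\<lambda>n. a n * e (of_int n * \<tau> / of_nat p)) has_sum lift_map B L p r k \<rho> R f \<tau> \<gamma>)
        {n. [real_of_int n = real p * Q \<gamma>] (rmod real p)}"
proof -
  show "((\<lambda>n. 2 * (a n * e (of_int n * \<tau> / of_nat p))) has_sum lift_map B L p r k \<rho> R f \<tau> L) {n. [n = 0] (mod int p)}"
    using lift_has_sum[OF f R \<tau> a, of 0] by (simp add: \<psi>_0)
  show "((\<lambda>n. a n * e (of_int n * \<tau> / of_nat p)) has_sum lift_map B L p r k \<rho> R f \<tau> \<gamma>)
        {n. [real_of_int n = real p * Q \<gamma>] (rmod real p)}" if \<gamma>: "\<gamma> \<in> D" "\<gamma> \<noteq> L"
  proof -
    obtain x where x: "\<gamma> = \<psi> x" using \<psi>_surj[OF \<gamma>(1)] by blast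
    hence "\<not> int p dvd x" using \<gamma> \<psi>_eq_L_iff by blast
    thus ?thesis
      using lift_has_sum[OF f R \<tau> a, of x] unfolding x quad_\<psi>_rcong_iff by simp
  qed
qed

end

text \<open>The isomorphism is expressed by mutually inverse maps between the two sets together with
  linearity of both. R is an arbitrary transversal; as the descent does not mention R, its inverse,
  the lift, is the same for every choice.\<close>

theorem theorem5:
  fixes B :: "'v::euclidean_space \<Rightarrow> 'v \<Rightarrow> real" and L :: "'v set"
    and bp bn p :: nat and r k \<alpha> \<epsilon> :: int
    and \<rho> :: "int^2^2 \<Rightarrow> ('v set \<Rightarrow> complex) \<Rightarrow> ('v set \<Rightarrow> complex)"
    and R :: "(int^2^2) set"
  assumes lattice: "even_lattice B L"
    and signature: "has_signature B bp bn"
    and p: "prime p" "p \<ge> 3" "order (disc_group B L) = p"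
    and r: "r = int bp - int bn"
    and \<rho>: "weil_rep B L r \<rho>"
    and \<alpha>: "\<not> int p dvd \<alpha>" "disc_form_equiv B L p \<alpha>"
    and \<epsilon>: "\<epsilon> = Legendre \<alpha> (int p)"
    and k: "[2 * k = r] (mod 4)"
    and R: "Gamma0_transversal p R"
  shows
    "(\<forall>f \<in> A_eps_space k p \<epsilon>. lift_map B L p r k \<rho> R f \<in> A_rho_space B L k \<rho>) \<and>
     (\<forall>f \<in> A_eps_space k p \<epsilon>. \<forall>a. q_expansion f a \<longrightarrow> (\<forall>\<tau>\<in>\<H>.
        ((\<lambda>n. 2 * (a n * e (of_int n * \<tau> / of_nat p))) has_sum
           lift_map B L p r k \<rho> R f \<tau> \<one>\<^bsub>disc_group B L\<^esub>) {n. [n = 0] (mod int p)} \<and>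
        (\<forall>\<gamma> \<in> carrier (disc_group B L). \<gamma> \<noteq> \<one>\<^bsub>disc_group B L\<^esub> \<longrightarrow>
           ((\<lambda>n. a n * e (of_int n * \<tau> / of_nat p)) has_sum lift_map B L p r k \<rho> R f \<tau> \<gamma>)
             {n. [real_of_int n = real p * disc_quad B \<gamma>] (rmod real p)}))) \<and>
     (\<forall>F \<in> A_rho_space B L k \<rho>. \<forall>\<tau>\<in>\<H>.
        descent_map B L p r k F \<tau> =
          1 / 2 * (\<Sum>\<gamma>\<in>carrier (disc_group B L). F (of_nat p * \<tau>) \<gamma>)) \<and>
     (\<forall>F \<in> A_rho_space B L k \<rho>. descent_map B L p r k F \<in> A_eps_space k p \<epsilon>) \<and>
     (\<forall>f \<in> A_eps_space k p \<epsilon>. descent_map B L p r k (lift_map B L p r k \<rho> R f) = f) \<and>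
     (\<forall>F \<in> A_rho_space B L k \<rho>. lift_map B L p r k \<rho> R (descent_map B L p r k F) = F) \<and>
     (\<forall>f \<in> A_eps_space k p \<epsilon>. \<forall>g \<in> A_eps_space k p \<epsilon>. \<forall>c.
        lift_map B L p r k \<rho> R (\<lambda>\<tau>. c * f \<tau> + g \<tau>) =
          (\<lambda>\<tau> \<gamma>. c * lift_map B L p r k \<rho> R f \<tau> \<gamma> + lift_map B L p r k \<rho> R g \<tau> \<gamma>)) \<and>
     (\<forall>F \<in> A_rho_space B L k \<rho>. \<forall>G \<in> A_rho_space B L k \<rho>. \<forall>c.
        descent_map B L p r k (\<lambda>\<tau> \<gamma>. c * F \<tau> \<gamma> + G \<tau> \<gamma>) =
          (\<lambda>\<tau>. c * descent_map B L p r k F \<tau> + descent_map B L p r k G \<tau>))"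
proof -
  interpret weil p B L \<alpha> r k \<rho>
    using lattice p \<alpha> \<rho> k by unfold_locales
  show ?thesis
    unfolding \<epsilon> disc_group_simps(2)
    using R by (intro conjI ballI allI impI lift_in_A_rho lift_fourier descent_sum descent_in_A_eps
        descent_lift lift_descent lift_linear descent_linear)
qed

end
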